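(* Let $l\ge 1$, $\mathbf{s}=(s_1,\dots,s_l)\in\mathbb{Z}^l$, let $e\ge 2$ be an integer, and fix rational numbers $1>\alpha_1>\dots>\alpha_l>0$. For each $\boldsymbol{\lambda}\in\Pi_l$, the plus canonical basis element $G_e(\boldsymbol{\lambda},\mathbf{s})$ has an expansion on the plus canonical basis for $\infty$, $$G_e(\boldsymbol{\lambda},\mathbf{s})=\sum_{\boldsymbol{\nu}\in\Pi_l}d_{\boldsymbol{\lambda},\boldsymbol{\nu}}(v)\,G_\infty(\boldsymbol{\nu},\mathbf{s}),$$ where - $d_{\boldsymbol{\lambda},\boldsymbol{\lambda}}(v)=1$; - $d_{\boldsymbol{\lambda},\boldsymbol{\nu}}(v)\in v\mathbb{Z}[v]$ if $\boldsymbol{\lambda}\ne\boldsymbol{\nu}$; - $d_{\boldsymbol{\lambda},\boldsymbol{\nu}}(v)\ne0$ only if $\boldsymbol{\lambda}\succeq\boldsymbol{\nu}$ (that is, $\boldsymbol{\lambda}=\boldsymbol{\nu}$, or $\boldsymbol{\lambda},\boldsymbol{\nu}$ have the same rank and $\boldsymbol{\lambda}\succ\boldsymbol{\nu}$).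
   Context: **Fock space.** $\Pi_{l,n}$ is the set of $l$-partitions of rank $n$, i.e. tuples $\boldsymbol{\lambda}=(\lambda^{(1)},\dots,\lambda^{(l)})$ of partitions with $\sum_d|\lambda^{(d)}|=n$; $\Pi_l=\bigcup_{n\ge0}\Pi_{l,n}$. Partitions are extended by zeros. With $v$ an indeterminate, $\mathcal{F}=\bigoplus_{\boldsymbol{\lambda}\in\Pi_l}\mathbb{Q}(v)\boldsymbol{\lambda}$ and $\mathcal{L}_{\mathbb{Z}}=\bigoplus_{\boldsymbol{\lambda}\in\Pi_l}\mathbb{Z}[v]\boldsymbol{\lambda}$. **Bar-involution (Uglov), for $e\in\mathbb{Z}_{\ge2}\cup\{\infty\}$.** Fix $n$ and a sufficiently large integer $N$, divisible by $e$ if $e<\infty$. For $\boldsymbol{\lambda}\in\Pi_{l,n}$ and $1\le d\le l$, the beads of runner $d$ are the integers $\lambda^{(d)}_i+s_d+1-i$, $i\ge1$; those which are $>-N$ are given by $i=1,\dots,s_d+N$. Put $r=\sum_d(s_d+N)$. Let $\zeta(\boldsymbol{\lambda})\in\mathbb{Z}^r$ be the sequence listing the beads $>-N$ of runner $l$ in decreasing order, then those of runner $l-1$ in decreasing order, ..., finally those of runner $1$ in decreasing order, and let $b=(b_1,\dots,b_r)$ be the corresponding sequence of runner numbers ($s_l+N$ copies of $l$, then $s_{l-1}+N$ copies of $l-1$, ..., then $s_1+N$ copies of $1$). If $e=\infty$ let $W=S_r$ with Coxeter generators $s_1,\dots,s_{r-1}$, acting on $\mathbb{Z}^r$ on the right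 by place permutations ($\beta\cdot s_i$ exchanges $\beta_i,\beta_{i+1}$), and let $A^r=\{a\in\mathbb{Z}^r: a_1\le\dots\le a_r\}$. If $e<\infty$ let $W=S_r\ltimes\mathbb{Z}^r$ be the extended affine symmetric group acting on the right on $\mathbb{Z}^r$ by place permutations and by $\beta\cdot\mu=\beta+e\mu$ for $\mu\in\mathbb{Z}^r$; it is generated by $s_1,\dots,s_{r-1}$, by $s_0$ with $\beta\cdot s_0=(\beta_r-e,\beta_2,\dots,\beta_{r-1},\beta_1+e)$, and by $\omega$ with $\beta\cdot\omega=(\beta_2,\dots,\beta_r,\beta_1+e)$; $s_0,\dots,s_{r-1}$ are Coxeter generators of an affine Weyl group of type $A_{r-1}^{(1)}$ whose length function $\ell$ is extended to $W$ by $\ell(\omega^kw)=\ell(w)$; and $A^r=\{a\in\mathbb{Z}^r: 1\le a_1\le\dots\le a_r\le e\}$. In both cases $A^r$ is a fundamental domain. For $a\in A^r$ let ${}_aW\subset S_r$ be its stabilizer. For $\xi\in\mathbb{Z}^r$ write uniquely $\xi=a\cdot x(\xi)$ with $a\in A^r$ and $x(\xi)$ of minimal length in its coset ${}_aWx(\xi)$. Let $W_b\subset S_r$ be the subgroup generated by the $s_i$ ($1\le i\le r-1$) with $b_i=b_{i+1}$, and $w_b$ its longest element. Let $H$ be the Hecke algebra of $W$ over $\mathbb{Q}(v)$: basis $T_w$ ($w\in W$), $T_wT_{w'}=T_{ww'}$ if $\ell(ww')=\ell(w)+\ell(w')$, and $(T_{s_i}-v^{-1})(T_{s_i}+v)=0$.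 Its bar-involution is the ring automorphism with $\overline{v}=v^{-1}$, $\overline{T_w}=T_{w^{-1}}^{-1}$. Let $H_a,H_b\subset H$ be the subalgebras spanned by $T_w$, $w\in{}_aW$, resp. $w\in W_b$; let $1_a^+$ be the one-dimensional right $H_a$-module with $1_a^+T_{s_i}=v^{-1}1_a^+$ and $1_b^-$ the one-dimensional left $H_b$-module with $T_{s_i}1_b^-=-v1_b^-$. On $\Lambda^r(a,b)=1_a^+\otimes_{H_a}H\otimes_{H_b}1_b^-$ define $\overline{1_a^+\otimes h\otimes1_b^-}=1_a^+\otimes\overline{h}\otimes1_b^-$. Identify $\boldsymbol{\lambda}\in\Pi_{l,n}$ with $1_a^+\otimes T_{x(\zeta(\boldsymbol{\lambda}))w_b}\otimes1_b^-\in\Lambda^r(a,b)$, where $\zeta(\boldsymbol{\lambda})\in a\cdot W$. For $N$ large these vectors ($\boldsymbol{\lambda}\in\Pi_{l,n}$) are linearly independent in $\bigoplus_{a}\Lambda^r(a,b)$, their span is bar-stable, and the matrix of the bar map on them does not depend on $N$ (Uglov). Collecting all $n$, this gives a semilinear ($v\mapsto v^{-1}$) involution $\overline{\phantom{x}}$ on $\mathcal{F}$, depending on $\mathbf{s}$ and $e$. **Plus canonical basis (Uglov).** For $e\in\mathbb{Z}_{\ge2}\cup\{\infty\}$ there is a unique basis $\{G_e(\boldsymbol{\lambda},\mathbf{s}):\boldsymbol{\lambda}\in\Pi_l\}$ of $\mathcal{F}$ with $\overline{G_e(\boldsymbol{\lambda},\mathbf{s})}=G_e(\boldsymbol{\lambda},\mathbf{s})$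 (bar-involution for $e$) and $G_e(\boldsymbol{\lambda},\mathbf{s})\equiv\boldsymbol{\lambda}\pmod{v\mathcal{L}_{\mathbb{Z}}}$. **The order $\succ$ on $\Pi_{l,n}$.** For $\mathbf{u}\neq\mathbf{w}$ in $\mathbb{Q}^k$ write $\mathbf{u}\rhd\mathbf{w}$ if $\sum_{t=1}^{m}u_t\ge\sum_{t=1}^{m}w_t$ for all $m=1,\dots,k$. Choose an integer $K\ge n$ with $K+s_i\ge n$ for all $i$ (one may take $K=n$ if all $s_i\ge0$; the resulting order does not depend on $K$). For $\boldsymbol{\lambda}\in\Pi_{l,n}$ let $\gamma(\boldsymbol{\lambda})$ be the sequence of the rational numbers $\lambda^{(i)}_j-j+s_i-\alpha_i$, for $1\le i\le l$, $1\le j\le K+s_i$, arranged in decreasing order. Then $\boldsymbol{\lambda}\succ\boldsymbol{\mu}$ means $\gamma(\boldsymbol{\lambda})\rhd\gamma(\boldsymbol{\mu})$. *)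

theory Defs
  imports
    "HOL-Library.Poly_Mapping"
    "HOL-Library.Extended_Nat"
    "HOL-Computational_Algebra.Field_as_Ring"
    "HOL-Computational_Algebra.Polynomial_Factorial"
    "HOL-Combinatorics.Permutations"
    "HOL-Algebra.Generated_Groups"
    "HOL-Algebra.Ring"
begin

section \<open>Scalars\<close>

type_synonym ratfun = "rat poly fract"

definition vq :: ratfun where
  "vq = to_fract [:0, 1:]"

definition eval_inv :: "rat poly \<Rightarrow> ratfun" where
  "eval_inv p = poly (map_poly (\<lambda>c. to_fract [:c:]) p) (inverse vq)"

text \<open>The field automorphism of \<open>\<rat>(v)\<close> with \<open>v \<mapsto> v\<^sup>-\<^sup>1\<close>.\<close>

definition bar_scalar :: "ratfun \<Rightarrow> ratfun" where
  "bar_scalar f = (case quot_of_fract f of (p, q) \<Rightarrow> eval_inv p / eval_inv q)"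

definition Zv :: "ratfun set" where
  "Zv = range (\<lambda>p :: int poly. to_fract (map_poly of_int p))"

section \<open>Finitely supported functions as vector spaces\<close>

definition scale :: "ratfun \<Rightarrow> ('a \<Rightarrow>\<^sub>0 ratfun) \<Rightarrow> ('a \<Rightarrow>\<^sub>0 ratfun)" where
  "scale c f = Poly_Mapping.map ((*) c) f"

lemma lookup_scale [simp]: "Poly_Mapping.lookup (scale c f) k = c * Poly_Mapping.lookup f k"
  by (simp add: scale_def Poly_Mapping.map.rep_eq when_def)

global_interpretation fs: vector_space "scale :: ratfun \<Rightarrow> ('a \<Rightarrow>\<^sub>0 ratfun) \<Rightarrow> _"
  by unfold_locales (auto intro!: poly_mapping_eqI simp: lookup_add algebra_simps)

section \<open>Multipartitions and Fock space\<close>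

text \<open>
  Partitions are weakly decreasing lists of their positive parts. The index \<open>d\<close> of a component of an
  \<open>l\<close>-partition, the index \<open>i\<close> of a part, and the indices of the multicharge \<open>s\<close> and of
  \<open>\<alpha>\<close> all start at 1; values of \<open>s\<close> and \<open>\<alpha>\<close> outside \<open>{1..l}\<close> play no role.
\<close>

type_synonym multipartition = "nat list list"

definition multipartitions :: "nat \<Rightarrow> multipartition set" where
  "multipartitions l =
     {lam. length lam = l \<and> (\<forall>p \<in> set lam. sorted_wrt (\<ge>) p \<and> 0 \<notin> set p)}"

definition rank :: "multipartition \<Rightarrow> nat" where
  "rank lam = (\<Sum>p \<leftarrow> lam. sum_list p)"

definition multipartitions_of_rank :: "nat \<Rightarrow> nat \<Rightarrow> multipartition set" where
  "multipartitions_of_rank l n = {lam \<in> multipartitions l. rank lam = n}"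

definition part :: "multipartition \<Rightarrow> nat \<Rightarrow> nat \<Rightarrow> nat" where
  "part lam d i = (let p = lam ! (d - 1) in if i - 1 < length p then p ! (i - 1) else 0)"

type_synonym fock = "multipartition \<Rightarrow>\<^sub>0 ratfun"

abbreviation ket :: "multipartition \<Rightarrow> fock" where
  "ket lam \<equiv> Poly_Mapping.single lam 1"

definition fock_space :: "nat \<Rightarrow> fock set" where
  "fock_space l = {f. Poly_Mapping.keys f \<subseteq> multipartitions l}"

definition fock_space_of_rank :: "nat \<Rightarrow> nat \<Rightarrow> fock set" where
  "fock_space_of_rank l n = {f. Poly_Mapping.keys f \<subseteq> multipartitions_of_rank l n}"

definition fock_lattice :: "nat \<Rightarrow> fock set" where
  "fock_lattice l = {f \<in> fock_space l. \<forall>lam. Poly_Mapping.lookup f lam \<in> Zv}"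

section \<open>The symmetric and the extended affine symmetric group\<close>

text \<open>
  Elements of \<open>\<int>\<^sup>r\<close> are functions on \<open>{1..r}\<close>, extended by 0. The pair \<open>(\<sigma>, \<mu>)\<close> stands for the
  element \<open>\<sigma>\<mu>\<close> of \<open>S\<^sub>r \<ltimes> \<int>\<^sup>r\<close>, which acts on the right by first \<open>\<sigma>\<close>, i.e.
  \<open>(\<beta> \<cdot> \<sigma>)\<^sub>i = \<beta>\<^bsub>\<sigma>(i)\<^esub>\<close>, and then \<open>\<mu>\<close>. For \<open>e = \<infinity>\<close> the group is \<open>S\<^sub>r\<close>, embedded by \<open>\<mu> = 0\<close>.
\<close>

type_synonym zseq = "nat \<Rightarrow> int"
type_synonym affperm = "(nat \<Rightarrow> nat) \<times> zseq"

definition weyl :: "enat \<Rightarrow> nat \<Rightarrow> affperm monoid" where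
  "weyl e r =
     \<lparr>carrier = {(\<sigma>, \<mu>). \<sigma> permutes {1..r} \<and> (\<forall>i. i \<notin> {1..r} \<longrightarrow> \<mu> i = 0) \<and>
                         (e = \<infinity> \<longrightarrow> \<mu> = (\<lambda>_. 0))},
      mult = (\<lambda>(\<sigma>, \<mu>) (\<tau>, \<nu>). (\<sigma> \<circ> \<tau>, \<lambda>i. \<mu> (\<tau> i) + \<nu> i)),
      one = (id, \<lambda>_. 0)\<rparr>"

definition act :: "enat \<Rightarrow> zseq \<Rightarrow> affperm \<Rightarrow> zseq" where
  "act e \<beta> w =
     (\<lambda>i. \<beta> (fst w i) + (case e of enat k \<Rightarrow> int k * snd w i | \<infinity> \<Rightarrow> 0))"

definition cox :: "nat \<Rightarrow> nat \<Rightarrow> affperm" where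
  "cox r i = (if i = 0 then (transpose 1 r, (\<lambda>_. 0)(1 := -1, r := 1))
              else (transpose i (Suc i), \<lambda>_. 0))"

definition omega :: "nat \<Rightarrow> affperm" where
  "omega r = (\<lambda>i. if i \<in> {1..<r} then Suc i else if i = r then 1 else i, (\<lambda>_. 0)(r := 1))"

definition cox_index :: "enat \<Rightarrow> nat \<Rightarrow> nat set" where
  "cox_index e r = (if e = \<infinity> then {1..<r} else {0..<r})"

definition omega_powers :: "enat \<Rightarrow> nat \<Rightarrow> affperm set" where
  "omega_powers e r =
     (if e = \<infinity> then {\<one>\<^bsub>weyl e r\<^esub>} else range (\<lambda>k :: int. omega r [^]\<^bsub>weyl e r\<^esub> k))"

definition word :: "enat \<Rightarrow> nat \<Rightarrow> nat list \<Rightarrow> affperm" where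
  "word e r is = foldr (\<lambda>i w. cox r i \<otimes>\<^bsub>weyl e r\<^esub> w) is \<one>\<^bsub>weyl e r\<^esub>"

text \<open>Coxeter length, extended by \<open>\<ell>(\<omega>\<^sup>kw) = \<ell>(w)\<close>.\<close>

definition len :: "enat \<Rightarrow> nat \<Rightarrow> affperm \<Rightarrow> nat" where
  "len e r w =
     (LEAST m. \<exists>z \<in> omega_powers e r. \<exists>is. set is \<subseteq> cox_index e r \<and> length is = m \<and>
        w = z \<otimes>\<^bsub>weyl e r\<^esub> word e r is)"

definition alcove :: "enat \<Rightarrow> nat \<Rightarrow> zseq set" where
  "alcove e r =
     {a. (\<forall>i. i \<notin> {1..r} \<longrightarrow> a i = 0) \<and> mono_on {1..r} a \<and>
         (\<forall>k. e = enat k \<longrightarrow> (\<forall>i \<in> {1..r}. 1 \<le> a i \<and> a i \<le> int k))}"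

definition stab :: "enat \<Rightarrow> nat \<Rightarrow> zseq \<Rightarrow> affperm set" where
  "stab e r a = {w \<in> carrier (weyl e r). act e a w = a}"

definition min_rep :: "enat \<Rightarrow> nat \<Rightarrow> zseq \<Rightarrow> zseq \<Rightarrow> affperm" where
  "min_rep e r a \<xi> = (ARG_MIN (len e r) w. w \<in> carrier (weyl e r) \<and> act e a w = \<xi>)"

definition block_subgroup :: "enat \<Rightarrow> nat \<Rightarrow> zseq \<Rightarrow> affperm set" where
  "block_subgroup e r b = generate (weyl e r) (cox r ` {i \<in> {1..<r}. b i = b (Suc i)})"

definition block_longest :: "enat \<Rightarrow> nat \<Rightarrow> zseq \<Rightarrow> affperm" where
  "block_longest e r b = (ARG_MAX (len e r) w. w \<in> block_subgroup e r b)"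

section \<open>The Hecke algebra and the spaces of wedges\<close>

type_synonym hecke = "affperm \<Rightarrow>\<^sub>0 ratfun"

abbreviation T :: "affperm \<Rightarrow> hecke" where
  "T w \<equiv> Poly_Mapping.single w 1"

text \<open>These conditions determine the multiplication on the carrier uniquely.\<close>

definition hecke_algebra :: "enat \<Rightarrow> nat \<Rightarrow> hecke ring \<Rightarrow> bool" where
  "hecke_algebra e r H \<longleftrightarrow>
     ring H \<and>
     carrier H = {h. Poly_Mapping.keys h \<subseteq> carrier (weyl e r)} \<and>
     add H = (+) \<and>
     (\<forall>c. \<forall>x \<in> carrier H. \<forall>y \<in> carrier H.
        scale c x \<otimes>\<^bsub>H\<^esub> y = scale c (x \<otimes>\<^bsub>H\<^esub> y) \<and> x \<otimes>\<^bsub>H\<^esub> scale c y = scale c (x \<otimes>\<^bsub>H\<^esub> y)) \<and>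
     (\<forall>w \<in> carrier (weyl e r). \<forall>w' \<in> carrier (weyl e r).
        len e r (w \<otimes>\<^bsub>weyl e r\<^esub> w') = len e r w + len e r w' \<longrightarrow>
        T w \<otimes>\<^bsub>H\<^esub> T w' = T (w \<otimes>\<^bsub>weyl e r\<^esub> w')) \<and>
     (\<forall>i \<in> cox_index e r.
        (T (cox r i) - scale (inverse vq) \<one>\<^bsub>H\<^esub>) \<otimes>\<^bsub>H\<^esub> (T (cox r i) + scale vq \<one>\<^bsub>H\<^esub>) = 0)"

definition hecke_bar :: "enat \<Rightarrow> nat \<Rightarrow> hecke ring \<Rightarrow> hecke \<Rightarrow> hecke" where
  "hecke_bar e r H h =
     (\<Sum>w \<in> Poly_Mapping.keys h.
        scale (bar_scalar (Poly_Mapping.lookup h w)) (inv\<^bsub>H\<^esub> (T (inv\<^bsub>weyl e r\<^esub> w))))"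

text \<open>
  The one-dimensional modules \<open>1\<^sub>a\<^sup>+\<close> and \<open>1\<^sub>b\<^sup>-\<close> are given by the characters
  \<open>T\<^sub>w \<mapsto> v\<^bsup>-\<ell>(w)\<^esup>\<close> of \<open>H\<^sub>a\<close> and \<open>T\<^sub>w \<mapsto> (-v)\<^bsup>\<ell>(w)\<^esup>\<close> of \<open>H\<^sub>b\<close>. Hence \<open>\<Lambda>\<^sup>r(a,b)\<close> is the quotient
  of \<open>H\<close> by the subspace below: \<open>1\<^sub>a\<^sup>+ \<otimes> h \<otimes> 1\<^sub>b\<^sup>-\<close> is the class of \<open>h\<close>, and the two families of
  generators express that the tensor products are taken over \<open>H\<^sub>a\<close> and over \<open>H\<^sub>b\<close>.
\<close>

definition wedge_relations ::
  "enat \<Rightarrow> nat \<Rightarrow> hecke ring \<Rightarrow> zseq \<Rightarrow> zseq \<Rightarrow> hecke set" where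
  "wedge_relations e r H a b = fs.span
     ({T u \<otimes>\<^bsub>H\<^esub> h - scale (inverse vq ^ len e r u) h |u h. u \<in> stab e r a \<and> h \<in> carrier H} \<union>
      {h \<otimes>\<^bsub>H\<^esub> T w - scale ((- vq) ^ len e r w) h |h w.
         h \<in> carrier H \<and> w \<in> block_subgroup e r b})"

definition zseq_of_list :: "int list \<Rightarrow> zseq" where
  "zseq_of_list xs = (\<lambda>i. if i \<in> {1..length xs} then xs ! (i - 1) else 0)"

definition num_beads :: "nat \<Rightarrow> (nat \<Rightarrow> int) \<Rightarrow> nat \<Rightarrow> nat" where
  "num_beads l s N = (\<Sum>d = 1..l. nat (s d + int N))"

definition bead_seq :: "nat \<Rightarrow> (nat \<Rightarrow> int) \<Rightarrow> nat \<Rightarrow> multipartition \<Rightarrow> zseq" where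
  "bead_seq l s N lam = zseq_of_list (concat
     (map (\<lambda>d. map (\<lambda>i. int (part lam d i) + s d + 1 - int i) [1..<Suc (nat (s d + int N))])
        (rev [1..<Suc l])))"

definition runner_seq :: "nat \<Rightarrow> (nat \<Rightarrow> int) \<Rightarrow> nat \<Rightarrow> zseq" where
  "runner_seq l s N = zseq_of_list (concat
     (map (\<lambda>d. replicate (nat (s d + int N)) (int d)) (rev [1..<Suc l])))"

text \<open>
  A representative in \<open>H\<close> of the component in \<open>\<Lambda>\<^sup>r(a,b)\<close> of the image of \<open>f\<close> under the linear
  extension of the identification
  \<open>lam \<mapsto> 1\<^sub>a\<^sup>+ \<otimes> T\<^bsub>x(\<zeta>(lam))w\<^sub>b\<^esub> \<otimes> 1\<^sub>b\<^sup>-\<close>, \<open>\<zeta>(lam) \<in> a\<cdot>W\<close>.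
\<close>

definition wedge_component ::
  "enat \<Rightarrow> nat \<Rightarrow> (nat \<Rightarrow> int) \<Rightarrow> nat \<Rightarrow> zseq \<Rightarrow> fock \<Rightarrow> hecke" where
  "wedge_component e l s N a f =
     (let r = num_beads l s N; W = weyl e r; wb = block_longest e r (runner_seq l s N) in
      \<Sum>lam \<in> {lam \<in> Poly_Mapping.keys f. \<exists>w \<in> carrier W. act e a w = bead_seq l s N lam}.
        scale (Poly_Mapping.lookup f lam)
          (T (min_rep e r a (bead_seq l s N lam) \<otimes>\<^bsub>W\<^esub> wb)))"

section \<open>The bar-involution and the plus canonical basis\<close>

text \<open>
  For all large \<open>N\<close> (divisible by \<open>e\<close> if \<open>e < \<infinity>\<close>), the identification embeds the rank \<open>n\<close> part
  of Fock space into \<open>\<Oplus>\<^sub>a \<Lambda>\<^sup>r(a,b)\<close>, and \<open>\<beta>\<close> corresponds to the bar map there; this determines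
  \<open>\<beta>\<close> on Fock space.
\<close>

definition is_bar_involution ::
  "enat \<Rightarrow> nat \<Rightarrow> (nat \<Rightarrow> int) \<Rightarrow> (fock \<Rightarrow> fock) \<Rightarrow> bool" where
  "is_bar_involution e l s \<beta> \<longleftrightarrow>
     (\<forall>f \<in> fock_space l. \<beta> f \<in> fock_space l \<and> \<beta> (\<beta> f) = f) \<and>
     (\<forall>f \<in> fock_space l. \<forall>g \<in> fock_space l. \<beta> (f + g) = \<beta> f + \<beta> g) \<and>
     (\<forall>c. \<forall>f \<in> fock_space l. \<beta> (scale c f) = scale (bar_scalar c) (\<beta> f)) \<and>
     (\<forall>n. \<exists>N0. \<forall>N \<ge> N0. (\<forall>k. e = enat k \<longrightarrow> k dvd N) \<longrightarrow>
        (let r = num_beads l s N; b = runner_seq l s N in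
         \<exists>H. hecke_algebra e r H \<and>
           (\<forall>f \<in> fock_space_of_rank l n.
              (\<forall>a \<in> alcove e r. wedge_component e l s N a f \<in> wedge_relations e r H a b) \<longrightarrow>
              f = 0) \<and>
           (\<forall>f \<in> fock_space_of_rank l n.
              \<beta> f \<in> fock_space_of_rank l n \<and>
              (\<forall>a \<in> alcove e r.
                 wedge_component e l s N a (\<beta> f) -
                   hecke_bar e r H (wedge_component e l s N a f)
                 \<in> wedge_relations e r H a b))))"

definition is_plus_canonical_basis ::
  "enat \<Rightarrow> nat \<Rightarrow> (nat \<Rightarrow> int) \<Rightarrow> (multipartition \<Rightarrow> fock) \<Rightarrow> bool" where
  "is_plus_canonical_basis e l s G \<longleftrightarrow>
     (\<exists>\<beta>. is_bar_involution e l s \<beta> \<and>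
        inj_on G (multipartitions l) \<and>
        fs.independent (G ` multipartitions l) \<and>
        fs.span (G ` multipartitions l) = fock_space l \<and>
        (\<forall>lam \<in> multipartitions l.
           \<beta> (G lam) = G lam \<and> G lam - ket lam \<in> scale vq ` fock_lattice l))"

section \<open>The order on multipartitions\<close>

definition dominates :: "rat list \<Rightarrow> rat list \<Rightarrow> bool" (infix "\<rhd>" 50) where
  "u \<rhd> w \<longleftrightarrow> length u = length w \<and> u \<noteq> w \<and>
     (\<forall>m \<in> {1..length u}. sum_list (take m u) \<ge> sum_list (take m w))"

definition gamma ::
  "nat \<Rightarrow> (nat \<Rightarrow> int) \<Rightarrow> (nat \<Rightarrow> rat) \<Rightarrow> int \<Rightarrow> multipartition \<Rightarrow> rat list" where
  "gamma l s \<alpha> K lam = rev (sort (concat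
     (map (\<lambda>i. map (\<lambda>j. of_nat (part lam i j) - of_nat j + of_int (s i) - \<alpha> i)
                  [1..<Suc (nat (K + s i))])
        [1..<Suc l])))"

text \<open>The condition does not depend on the choice of an admissible \<open>K\<close>, and such \<open>K\<close> exist.\<close>

definition mp_greater ::
  "nat \<Rightarrow> (nat \<Rightarrow> int) \<Rightarrow> (nat \<Rightarrow> rat) \<Rightarrow> multipartition \<Rightarrow> multipartition \<Rightarrow> bool" where
  "mp_greater l s \<alpha> lam \<mu> \<longleftrightarrow> rank lam = rank \<mu> \<and>
     (\<forall>K. K \<ge> int (rank lam) \<and> (\<forall>i \<in> {1..l}. K + s i \<ge> int (rank lam)) \<longrightarrow>
        gamma l s \<alpha> K lam \<rhd> gamma l s \<alpha> K \<mu>)"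

end

theory Submission
  imports Defs
begin

text \<open>
  The argument does not compare the two bar-involutions directly: both are shown to be unitriangular
  for the order \<open>\<succ>\<close>. Expanding the inverse of \<open>T\<^bsub>w\<^sup>-\<^sup>1\<^esub>\<close> along a reduced word shows that the bar of
  \<open>T\<^sub>w\<close> is \<open>T\<^sub>w\<close> plus terms \<open>T\<^sub>y\<close> with \<open>y\<close> below \<open>w\<close> in the Bruhat order. A reflection that goes down in
  this order moves two beads of \<open>a\<cdot>w\<close> towards each other, where a bead \<open>x\<close> on runner \<open>d\<close> has weight
  \<open>x - \<alpha>\<^sub>d\<close>; the condition \<open>1 > \<alpha>\<^sub>1 > \<dots> > \<alpha>\<^sub>l > 0\<close> is exactly what makes this true also when two
  beads merely exchange their runners. Modulo the wedge relations every \<open>T\<^sub>y\<close> vanishes or is a multiple of the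
  vector of a multipartition with the same beads, so the bar of a multipartition is itself plus
  strictly smaller ones. A coefficient in \<open>v\<int>[v]\<close> fixed by the bar-involution is zero,
  hence both canonical bases are unitriangular over \<open>\<int>[v]\<close> with off-diagonal entries in
  \<open>v\<int>[v]\<close>, and the same holds for the transition matrix.
\<close>

section \<open>The extended affine symmetric group\<close>

text \<open>One group acts twice: with period \<open>r\<close> on windows, where lengths and Bruhat
  steps can be read off, and with period \<open>e\<close> on beads. The second action is the first
  one seen through k + r m |-> a_k + e m, and this map is only weakly increasing. So a Bruhat step
  never moves weighted beads apart, but it may leave their multiset unchanged; strictness has to be
  won at the first step of a chain, whose starting point is left minimal with increasing blocks.

  Partial sums of a sorted sequence are awkward when two entries move. They are replaced by sums of
  convex functions over the beads, \<open>max (x - t) 0\<close> for every threshold t and a square: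
  a reflection alters two summands, and convexity settles the comparison.

  The bar-involution is given only by congruences modulo the wedge relations, for large N divisible
  by \<open>e\<close>. An explicit Fock vector satisfying the same congruences is built and
  identified by injectivity. The order refers to every admissible K, so the comparison made at N is
  carried down to K, where both sides lose the same tail of empty parts. Giving beads the period 0
  for e = \<infinity> lets one argument serve both cases.\<close>

text \<open>
  \<open>win r w\<close> is the image of the regular sequence \<open>(1, \<dots>, r)\<close> under \<open>w\<close>, with modulus \<open>r\<close> instead of
  \<open>e\<close>. The triple \<open>(i, j, m)\<close> stands for the affine root \<open>\<beta>\<^sub>j - \<beta>\<^sub>i + rm\<close>, with reflection
  \<open>affrefl i j m\<close>; the simple root of \<open>cox r i\<close> is \<open>(src r i, tgt i, shft i)\<close>, so \<open>asc r w i\<close> says that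
  it is positive on \<open>win r w\<close>.
\<close>

definition modulus :: "enat \<Rightarrow> int" where
  "modulus e = (case e of enat k \<Rightarrow> int k | \<infinity> \<Rightarrow> 0)"

definition win :: "nat \<Rightarrow> affperm \<Rightarrow> zseq" where
  "win r w k = int (fst w k) + int r * snd w k"

definition affrefl :: "nat \<Rightarrow> nat \<Rightarrow> int \<Rightarrow> affperm" where
  "affrefl i j m = (transpose i j, (\<lambda>_. 0)(i := m, j := -m))"

definition pos_root :: "nat \<Rightarrow> nat \<Rightarrow> nat \<Rightarrow> int \<Rightarrow> bool" where
  "pos_root r i j m \<longleftrightarrow> i \<in> {1..r} \<and> j \<in> {1..r} \<and> (i < j \<and> m \<ge> 0 \<or> i \<noteq> j \<and> m > 0)"

definition src :: "nat \<Rightarrow> nat \<Rightarrow> nat" where "src r i = (if i = 0 then r else i)"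
definition tgt :: "nat \<Rightarrow> nat" where "tgt i = Suc i"
definition shft :: "nat \<Rightarrow> int" where "shft i = (if i = 0 then 1 else 0)"

definition asc :: "nat \<Rightarrow> affperm \<Rightarrow> nat \<Rightarrow> bool" where
  "asc r w i \<longleftrightarrow> win r w (src r i) < win r w (tgt i) + int r * shft i"

definition pairs :: "nat \<Rightarrow> (nat \<times> nat) set" where
  "pairs r = {(i, j). 1 \<le> i \<and> i < j \<and> j \<le> r}"

text \<open>Shi's length formula for affine permutations. Since \<open>div\<close> rounds down, a
  pair within one period contributes 0 in order and 1 out of order.\<close>

definition inversions :: "nat \<Rightarrow> zseq \<Rightarrow> nat" where
  "inversions r f = (\<Sum>(i, j)\<in>pairs r. nat \<bar>(f j - f i) div int r\<bar>)"

lemma finite_pairs [simp]: "finite (pairs r)"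
  by (rule finite_subset[of _ "{1..r} \<times> {1..r}"]) (auto simp: pairs_def)

section \<open>Group laws, windows and reflections\<close>

lemma weyl_carrier:
  "w \<in> carrier (weyl e r) \<longleftrightarrow> fst w permutes {1..r} \<and> (\<forall>i. i \<notin> {1..r} \<longrightarrow> snd w i = 0) \<and>
     (e = \<infinity> \<longrightarrow> snd w = (\<lambda>_. 0))"
  by (cases w) (simp add: weyl_def conj_commute)

lemma weyl_mult: "x \<otimes>\<^bsub>weyl e r\<^esub> y = (fst x \<circ> fst y, \<lambda>i. snd x (fst y i) + snd y i)"
  by (simp add: weyl_def split_beta)

lemma weyl_one: "\<one>\<^bsub>weyl e r\<^esub> = (id, \<lambda>_. 0)"
  by (simp add: weyl_def)

lemma weyl_inverse:
  assumes "w \<in> carrier (weyl e r)"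
  defines "w' \<equiv> (Hilbert_Choice.inv (fst w), \<lambda>i. - snd w (Hilbert_Choice.inv (fst w) i))"
  shows "w' \<in> carrier (weyl e r)" "w' \<otimes>\<^bsub>weyl e r\<^esub> w = \<one>\<^bsub>weyl e r\<^esub>"
proof -
  have p: "fst w permutes {1..r}" using assms by (simp add: weyl_carrier)
  have q: "Hilbert_Choice.inv (fst w) permutes {1..r}" using p by (rule permutes_inv)
  have "\<And>i. i \<notin> {1..r} \<Longrightarrow> Hilbert_Choice.inv (fst w) i = i"
    using q by (simp add: permutes_not_in)
  then show "w' \<in> carrier (weyl e r)"
    using assms(1) q by (auto simp: weyl_carrier w'_def)
  show "w' \<otimes>\<^bsub>weyl e r\<^esub> w = \<one>\<^bsub>weyl e r\<^esub>"
    by (simp add: weyl_mult weyl_one w'_def permutes_inv_o[OF p] permutes_inverses[OF p])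
qed

lemma weyl_group: "group (weyl e r)"
proof (rule groupI)
  show "x \<otimes>\<^bsub>weyl e r\<^esub> y \<in> carrier (weyl e r)"
    if "x \<in> carrier (weyl e r)" "y \<in> carrier (weyl e r)" for x y
  proof -
    have "fst y permutes {1..r}" using that by (simp add: weyl_carrier)
    then have "\<And>i. i \<notin> {1..r} \<Longrightarrow> fst y i = i" by (simp add: permutes_not_in)
    then show ?thesis using that
      by (auto simp: weyl_carrier weyl_mult intro: permutes_compose simp del: atLeastAtMost_iff)
  qed
  show "\<one>\<^bsub>weyl e r\<^esub> \<in> carrier (weyl e r)"
    by (simp add: weyl_carrier weyl_one)
  show "x \<otimes>\<^bsub>weyl e r\<^esub> y \<otimes>\<^bsub>weyl e r\<^esub> z = x \<otimes>\<^bsub>weyl e r\<^esub> (y \<otimes>\<^bsub>weyl e r\<^esub> z)" for x y z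
    by (simp add: weyl_mult o_assoc add.assoc)
  show "\<one>\<^bsub>weyl e r\<^esub> \<otimes>\<^bsub>weyl e r\<^esub> x = x" for x
    by (simp add: weyl_mult weyl_one)
  show "\<exists>y\<in>carrier (weyl e r). y \<otimes>\<^bsub>weyl e r\<^esub> x = \<one>\<^bsub>weyl e r\<^esub>" if "x \<in> carrier (weyl e r)" for x
    using weyl_inverse[OF that] by blast
qed

lemma weyl_inv:
  assumes "w \<in> carrier (weyl e r)"
  shows "inv\<^bsub>weyl e r\<^esub> w = (Hilbert_Choice.inv (fst w), \<lambda>i. - snd w (Hilbert_Choice.inv (fst w) i))"
  using group.inv_equality[OF weyl_group weyl_inverse(2)[OF assms] assms weyl_inverse(1)[OF assms]] .

lemma fst_carrier:
  assumes "w \<in> carrier (weyl e r)"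
  shows "k \<in> {1..r} \<Longrightarrow> fst w k \<in> {1..r}" "inj (fst w)"
  using assms by (auto simp: weyl_carrier simp del: atLeastAtMost_iff
      dest: permutes_in_image permutes_inj)

text \<open>Residues run from 1 to r, matching both positions (period \<open>r\<close>) and alcove
  entries (period \<open>e\<close>); the lemma is applied with either period.\<close>

lemma residue_unique:
  fixes x y m n :: int and r :: nat
  assumes "x \<in> {1..int r}" "y \<in> {1..int r}" "x + int r * m = y + int r * n"
  shows "x = y \<and> m = n"
proof -
  have "int r * (m - n) = y - x" using assms(3) by (simp add: algebra_simps)
  moreover have "\<bar>y - x\<bar> < int r" using assms by auto
  ultimately have "\<bar>int r * (m - n)\<bar> < int r" by simp
  then have "m - n = 0" 
    by (metis abs_mult abs_of_nat dvd_triv_left dvd_abs_iff zdvd_not_zless abs_ge_zero abs_mult_pos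
        mult_eq_0_iff abs_eq_0 order_le_less of_nat_0_le_iff order.irrefl)
  then show ?thesis using assms(3) by simp
qed

lemma win_inj:
  assumes "w \<in> carrier (weyl e r)" "w' \<in> carrier (weyl e r)"
    and "\<And>k. k \<in> {1..r} \<Longrightarrow> win r w k = win r w' k"
  shows "w = w'"
proof (rule prod_eqI)
  have *: "int (fst w k) = int (fst w' k) \<and> snd w k = snd w' k" if "k \<in> {1..r}" for k
    using residue_unique[of "int (fst w k)" r "int (fst w' k)" "snd w k" "snd w' k"]
      fst_carrier(1)[OF assms(1) that] fst_carrier(1)[OF assms(2) that] assms(3)[OF that]
    by (auto simp: win_def)
  show "fst w = fst w'"
  proof
    fix k show "fst w k = fst w' k"
      using *[of k] assms(1,2) by (cases "k \<in> {1..r}") (auto simp: weyl_carrier permutes_not_in)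
  qed
  show "snd w = snd w'"
  proof
    fix k show "snd w k = snd w' k"
      using *[of k] assms(1,2) by (cases "k \<in> {1..r}") (auto simp: weyl_carrier)
  qed
qed

text \<open>Different positions keep different residues modulo r, so no root vanishes on a window
  and the negation of \<open>asc\<close> is a strict descent.\<close>

lemma win_distinct:
  assumes "w \<in> carrier (weyl e r)" "i \<in> {1..r}" "j \<in> {1..r}" "i \<noteq> j"
  shows "win r w i \<noteq> win r w j + int r * m"
proof
  assume "win r w i = win r w j + int r * m"
  then have "int (fst w i) = int (fst w j)"
    using residue_unique[of "int (fst w i)" r "int (fst w j)" "snd w i" "snd w j + m"]
      fst_carrier(1)[OF assms(1,2)] fst_carrier(1)[OF assms(1,3)]
    by (auto simp: win_def algebra_simps)
  then show False using fst_carrier(2)[OF assms(1)] assms(4) by (auto dest: injD)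
qed

lemma act_alt: "act e a w = (\<lambda>i. a (fst w i) + modulus e * snd w i)"
  by (auto simp: act_def modulus_def split: enat.splits)

lemma act_mult: "act e a (x \<otimes>\<^bsub>weyl e r\<^esub> y) = act e (act e a x) y"
  by (auto simp: act_alt weyl_mult algebra_simps)

lemma act_one [simp]: "act e a \<one>\<^bsub>weyl e r\<^esub> = a"
  by (simp add: act_alt weyl_one)

lemma act_refl:
  assumes "i \<noteq> j"
  shows "act e f (affrefl i j m) = f(i := f j + modulus e * m, j := f i - modulus e * m)"
  using assms by (auto simp: act_alt affrefl_def transpose_def)

lemma win_refl:
  assumes "i \<noteq> j"
  shows "win r (w \<otimes>\<^bsub>weyl e r\<^esub> affrefl i j m) =
    (win r w)(i := win r w j + int r * m, j := win r w i - int r * m)"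
  using assms by (auto simp: win_def weyl_mult affrefl_def transpose_def algebra_simps)

lemma refl_carrier:
  assumes "i \<in> {1..r}" "j \<in> {1..r}" "e = \<infinity> \<longrightarrow> m = 0"
  shows "affrefl i j m \<in> carrier (weyl e r)"
  using assms by (auto simp: weyl_carrier affrefl_def intro!: permutes_swap_id)

text \<open>The bound \<open>2 \<le> r\<close> excludes the degenerate root with equal ends that
  index 0 would give for r = 1.\<close>

lemma cox_refl: "2 \<le> r \<Longrightarrow> i < r \<Longrightarrow> cox r i = affrefl (src r i) (tgt i) (shft i)"
  by (auto simp: cox_def affrefl_def src_def tgt_def shft_def transpose_def)

lemma cox_index_less: "2 \<le> r \<Longrightarrow> i \<in> cox_index e r \<Longrightarrow> i < r"
  by (auto simp: cox_index_def split: if_splits)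

lemma src_tgt:
  assumes "2 \<le> r" "i < r"
  shows "src r i \<in> {1..r}" "tgt i \<in> {1..r}" "src r i \<noteq> tgt i" "pos_root r (src r i) (tgt i) (shft i)"
  using assms by (auto simp: src_def tgt_def shft_def pos_root_def)

lemma cox_carrier:
  assumes "2 \<le> r" "i \<in> cox_index e r"
  shows "cox r i \<in> carrier (weyl e r)"
  using assms src_tgt[of r i] cox_index_less[OF assms]
  by (auto simp: cox_refl shft_def cox_index_def intro!: refl_carrier)

lemma win_cox:
  assumes "2 \<le> r" "i < r"
  shows "win r (w \<otimes>\<^bsub>weyl e r\<^esub> cox r i) =
    (win r w)(src r i := win r w (tgt i) + int r * shft i, tgt i := win r w (src r i) - int r * shft i)"
  using assms src_tgt[OF assms] by (simp add: cox_refl win_refl)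

lemma cox_cox:
  assumes "2 \<le> r" "i < r"
  shows "cox r i \<otimes>\<^bsub>weyl e r\<^esub> cox r i = \<one>\<^bsub>weyl e r\<^esub>"
  using assms src_tgt[OF assms]
  by (auto simp: cox_refl affrefl_def weyl_mult weyl_one transpose_def fun_eq_iff)

lemma inv_cox:
  assumes "2 \<le> r" "i \<in> cox_index e r"
  shows "inv\<^bsub>weyl e r\<^esub> (cox r i) = cox r i"
  using group.inv_equality[OF weyl_group cox_cox] cox_carrier[OF assms] cox_index_less[OF assms] assms
  by blast

lemma mult_cox_cox:
  assumes "2 \<le> r" "i \<in> cox_index e r" "w \<in> carrier (weyl e r)"
  shows "w \<otimes>\<^bsub>weyl e r\<^esub> cox r i \<otimes>\<^bsub>weyl e r\<^esub> cox r i = w"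
proof -
  interpret group "weyl e r" by (rule weyl_group)
  show ?thesis
    using assms cox_carrier[OF assms(1,2)] cox_cox[of r i e] cox_index_less[OF assms(1,2)]
    by (simp add: m_assoc)
qed

lemma asc_cox:
  assumes "2 \<le> r" "i \<in> cox_index e r" "w \<in> carrier (weyl e r)"
  shows "asc r (w \<otimes>\<^bsub>weyl e r\<^esub> cox r i) i \<longleftrightarrow> \<not> asc r w i"
proof -
  note st = src_tgt[OF assms(1) cox_index_less[OF assms(1,2)]]
  have "win r w (src r i) \<noteq> win r w (tgt i) + int r * shft i"
    using win_distinct[OF assms(3) st(1-3)] .
  then show ?thesis
    using st by (auto simp: asc_def win_cox[OF assms(1) cox_index_less[OF assms(1,2)]])
qed

subsection \<open>Length\<close>

lemma div_neg_nat:
  fixes x :: int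
  assumes "\<not> int r dvd x" "r > 0"
  shows "(- x) div int r = - (x div int r) - 1"
  using assms by (simp add: zdiv_zminus1_eq_if dvd_eq_mod_eq_0)

text \<open>The transposition permutes all other pairs among themselves. On the pair (k, k + 1) the
  positive difference x becomes -x, and rounding down turns x div r into -(x div r) - 1, whose
  absolute value is one larger.\<close>

lemma inversions_swap:
  assumes "1 \<le> k" "k < r" "f k < f (Suc k)" "\<not> int r dvd f (Suc k) - f k"
  shows "inversions r (f(k := f (Suc k), Suc k := f k)) = Suc (inversions r f)"
proof -
  define g where "g = f(k := f (Suc k), Suc k := f k)"
  let ?t = "transpose k (Suc k)"
  let ?h = "\<lambda>f (i, j). nat \<bar>(f j - f i) div int r\<bar>"
  have kp: "(k, Suc k) \<in> pairs r" using assms by (auto simp: pairs_def)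
  have g: "g i = f (?t i)" for i by (auto simp: g_def transpose_def)
  have "sum (?h g) (pairs r - {(k, Suc k)}) = sum (?h f) (pairs r - {(k, Suc k)})"
    by (rule sum.reindex_bij_witness[where i = "map_prod ?t ?t" and j = "map_prod ?t ?t"])
      (use assms in \<open>auto simp: pairs_def g transpose_def split: if_splits\<close>)
  moreover have "?h g (k, Suc k) = Suc (?h f (k, Suc k))"
  proof -
    have "(f k - f (Suc k)) div int r = - ((f (Suc k) - f k) div int r) - 1"
      using div_neg_nat[OF assms(4)] assms by simp
    moreover have "(f (Suc k) - f k) div int r \<ge> 0" using assms(2,3)
      by (simp add: pos_imp_zdiv_nonneg_iff) 
    ultimately show ?thesis by (auto simp: g_def)
  qed
  ultimately have "sum (?h g) (pairs r) = Suc (sum (?h f) (pairs r))"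
    using sum.remove[OF finite_pairs kp, of "?h g"] sum.remove[OF finite_pairs kp, of "?h f"] by simp
  then show ?thesis by (simp add: inversions_def g_def[symmetric])
qed

text \<open>Pairs not involving the last position are shifted by one. A pair (i, r) corresponds to
  (1, i + 1), and its difference r - x has floor quotient -(x div r), hence the same absolute
  value.\<close>

lemma inversions_rotate:
  assumes "2 \<le> r" "\<And>j. j \<in> {2..r} \<Longrightarrow> \<not> int r dvd f j - f 1"
    and "\<And>i. i \<in> {1..<r} \<Longrightarrow> g i = f (Suc i)" and "g r = f 1 + int r"
  shows "inversions r g = inversions r f"
  unfolding inversions_def
proof (rule sum.reindex_bij_witness[
      where j = "\<lambda>(i, j). if j < r then (Suc i, Suc j) else (1, Suc i)"
        and i = "\<lambda>(i, j). if i = 1 then (j - 1, r) else (i - 1, j - 1)"])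
  fix p assume p: "p \<in> pairs r"
  obtain i j where ij: "p = (i, j)" by (cases p)
  show "(case (case p of (i, j) \<Rightarrow> if j < r then (Suc i, Suc j) else (1, Suc i)) of
       (i, j) \<Rightarrow> nat \<bar>(f j - f i) div int r\<bar>) = (case p of (i, j) \<Rightarrow> nat \<bar>(g j - g i) div int r\<bar>)"
  proof (cases "j < r")
    case True then show ?thesis using p ij assms(3) by (auto simp: pairs_def)
  next
    case False
    then have *: "j = r" "i \<in> {1..<r}" using p ij by (auto simp: pairs_def)
    let ?x = "f (Suc i) - f 1"
    have nd: "\<not> int r dvd ?x" using assms(2)[of "Suc i"] * by auto
    have "(g r - g i) div int r = (- ?x + int r) div int r" using * assms(3,4) by (simp add: algebra_simps)
    also have "\<dots> = (- ?x) div int r + 1" using assms(1) by (intro div_add_self2) simp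
    also have "\<dots> = - (?x div int r)" using div_neg_nat[OF nd] assms(1) by simp
    finally show ?thesis using ij * by simp
  qed
qed (use assms(1) in \<open>auto simp: pairs_def split: if_splits\<close>)

lemma omega_props:
  assumes "2 \<le> r"
  shows "fst (omega r) permutes {1..r}"
    "i \<in> {1..<r} \<Longrightarrow> win r (w \<otimes>\<^bsub>weyl e r\<^esub> omega r) i = win r w (Suc i)"
    "win r (w \<otimes>\<^bsub>weyl e r\<^esub> omega r) r = win r w 1 + int r"
proof -
  show p: "fst (omega r) permutes {1..r}"
  proof (rule bij_imp_permutes)
    show "bij_betw (fst (omega r)) {1..r} {1..r}"
    proof (rule bij_betwI[where g = "\<lambda>i. if i = 1 then r else i - 1"])
      fix i assume "i \<in> {1..r}"
      then show "(if fst (omega r) i = 1 then r else fst (omega r) i - 1) = i"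
        "fst (omega r) (if i = 1 then r else i - 1) = i"
        using assms by (auto simp: omega_def)
    next
      show "fst (omega r) \<in> {1..r} \<rightarrow> {1..r}" using assms by (auto simp: omega_def)
      show "(\<lambda>i. if i = 1 then r else i - 1) \<in> {1..r} \<rightarrow> {1..r}" using assms by auto
    qed
    show "fst (omega r) x = x" if "x \<notin> {1..r}" for x
      using that assms by (auto simp: omega_def)
  qed
  show "i \<in> {1..<r} \<Longrightarrow> win r (w \<otimes>\<^bsub>weyl e r\<^esub> omega r) i = win r w (Suc i)"
    "win r (w \<otimes>\<^bsub>weyl e r\<^esub> omega r) r = win r w 1 + int r"
    by (auto simp: win_def weyl_mult omega_def algebra_simps)
qed

lemma omega_carrier: "2 \<le> r \<Longrightarrow> e \<noteq> \<infinity> \<Longrightarrow> omega r \<in> carrier (weyl e r)"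
  using omega_props(1)[of r] by (auto simp: weyl_carrier omega_def simp del: not_infinity_eq)

lemma inversions_omega:
  assumes "2 \<le> r" "w \<in> carrier (weyl e r)"
  shows "inversions r (win r (w \<otimes>\<^bsub>weyl e r\<^esub> omega r)) = inversions r (win r w)"
proof (rule inversions_rotate[OF assms(1)])
  fix j assume j: "j \<in> {2..r}"
  show "\<not> int r dvd win r w j - win r w 1"
  proof
    assume "int r dvd win r w j - win r w 1"
    then obtain m where "win r w j - win r w 1 = int r * m" by blast
    then show False using win_distinct[OF assms(2), of j 1 m] j assms(1) by auto
  qed
qed (use omega_props[OF assms(1)] in auto)

lemma not_dvd_win:
  assumes "w \<in> carrier (weyl e r)" "i \<in> {1..r}" "j \<in> {1..r}" "i \<noteq> j"
  shows "\<not> int r dvd win r w i - win r w j"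
proof
  assume "int r dvd win r w i - win r w j"
  then obtain m where "win r w i - win r w j = int r * m" by blast
  then show False using win_distinct[OF assms, of m] by auto
qed

text \<open>The reflection \<open>cox r 0\<close> is conjugate to \<open>cox r 1\<close> under \<open>omega r\<close>.\<close>

lemma inversions_cox_asc:
  assumes r: "2 \<le> r" and i: "i \<in> cox_index e r" and w: "w \<in> carrier (weyl e r)" and "asc r w i"
  shows "inversions r (win r (w \<otimes>\<^bsub>weyl e r\<^esub> cox r i)) = Suc (inversions r (win r w))"
proof (cases "i = 0")
  case False
  have ir: "i < r" using cox_index_less[OF r i] .
  have "inversions r ((win r w)(i := win r w (Suc i), Suc i := win r w i)) = Suc (inversions r (win r w))"
    using False ir assms(4) not_dvd_win[OF w, of "Suc i" i]
    by (intro inversions_swap) (auto simp: asc_def src_def tgt_def shft_def)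
  then show ?thesis using False ir by (simp add: win_cox[OF r ir] src_def tgt_def shft_def)
next
  case True
  interpret group "weyl e r" by (rule weyl_group)
  have e: "e \<noteq> \<infinity>" using i True by (simp add: cox_index_def split: if_splits del: not_infinity_eq)
  note om = omega_carrier[OF r e]
  define u where "u = w \<otimes>\<^bsub>weyl e r\<^esub> inv\<^bsub>weyl e r\<^esub> omega r"
  have u: "u \<in> carrier (weyl e r)" and wu: "u \<otimes>\<^bsub>weyl e r\<^esub> omega r = w"
    using w om by (auto simp: u_def m_assoc)
  have i1: "1 \<in> cox_index e r" using r by (auto simp: cox_index_def)
  have uc: "u \<otimes>\<^bsub>weyl e r\<^esub> cox r 1 \<in> carrier (weyl e r)" using u cox_carrier[OF r i1] by simp
  have eq: "u \<otimes>\<^bsub>weyl e r\<^esub> cox r 1 \<otimes>\<^bsub>weyl e r\<^esub> omega r = w \<otimes>\<^bsub>weyl e r\<^esub> cox r i"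
  proof (rule win_inj)
    fix k assume "k \<in> {1..r}"
    then consider "k = r" | "k = 1" "k < r" | "k \<in> {2..<r}" using r by force
    then show "win r (u \<otimes>\<^bsub>weyl e r\<^esub> cox r 1 \<otimes>\<^bsub>weyl e r\<^esub> omega r) k =
        win r (w \<otimes>\<^bsub>weyl e r\<^esub> cox r i) k"
      using True r unfolding wu[symmetric]
      by cases (auto simp: omega_props[OF r] win_cox[OF r] src_def tgt_def shft_def)
  qed (use om uc w cox_carrier[OF r i] in auto)
  have "win r u 1 < win r u 2"
    using assms(4) True omega_props(2,3)[OF r, where w = u and e = e] r
    by (auto simp: asc_def src_def tgt_def shft_def wu numeral_2_eq_2)
  then have "inversions r ((win r u)(1 := win r u (Suc 1), Suc 1 := win r u 1)) = Suc (inversions r (win r u))"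
    using r not_dvd_win[OF u, of 2 1]
    by (intro inversions_swap) (auto simp: numeral_2_eq_2)
  then have "inversions r (win r (u \<otimes>\<^bsub>weyl e r\<^esub> cox r 1)) = Suc (inversions r (win r u))"
    using r by (simp add: win_cox src_def tgt_def shft_def)
  then show ?thesis
    using inversions_omega[OF r u] inversions_omega[OF r uc] unfolding eq wu by simp
qed

lemma inversions_cox_desc:
  assumes r: "2 \<le> r" and i: "i \<in> cox_index e r" and w: "w \<in> carrier (weyl e r)" and "\<not> asc r w i"
  shows "Suc (inversions r (win r (w \<otimes>\<^bsub>weyl e r\<^esub> cox r i))) = inversions r (win r w)"
proof -
  interpret group "weyl e r" by (rule weyl_group)
  show ?thesis
    using inversions_cox_asc[OF r i, of "w \<otimes>\<^bsub>weyl e r\<^esub> cox r i"] asc_cox[OF r i w] assms(4)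
      mult_cox_cox[OF r i w] w cox_carrier[OF r i] by simp
qed

lemma inversions_cox_le:
  assumes r: "2 \<le> r" and i: "i \<in> cox_index e r" and w: "w \<in> carrier (weyl e r)"
  shows "inversions r (win r (w \<otimes>\<^bsub>weyl e r\<^esub> cox r i)) \<le> Suc (inversions r (win r w))"
  using inversions_cox_asc[OF assms] inversions_cox_desc[OF assms] by fastforce

lemma strict_step_diff:
  fixes f :: "nat \<Rightarrow> int"
  assumes "\<And>k. p \<le> k \<Longrightarrow> k < q \<Longrightarrow> f k < f (Suc k)" "p \<le> q"
  shows "f p + int (q - p) \<le> f q"
  using assms(2,1)
proof (induction q rule: dec_induct)
  case (step n)
  have "f p + int (n - p) \<le> f n" by (rule step.IH) (use step.prems in simp)
  moreover have "f n < f (Suc n)" using step.prems[of n] step.hyps by simp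
  ultimately show ?case using step.hyps by linarith
qed simp

text \<open>Strict growth over r - 1 steps already uses up the spread r - 1 that the bound allows,
  so every step is exactly 1.\<close>

lemma consecutive:
  fixes f :: "nat \<Rightarrow> int"
  assumes "\<And>k. k \<in> {1..<r} \<Longrightarrow> f k < f (Suc k)" "f r < f 1 + int r" "k \<in> {1..r}"
  shows "f k = f 1 + int k - 1"
proof -
  have "f 1 + int (k - 1) \<le> f k" "f k + int (r - k) \<le> f r"
    by (rule strict_step_diff; use assms(1,3) in simp)+
  then show ?thesis using assms(2,3) by auto
qed

section \<open>Powers of the rotation\<close>

lemma win_one: "win r \<one>\<^bsub>weyl e r\<^esub> k = int k"
  by (simp add: win_def weyl_one)

text \<open>Left multiplication acts on the entries of a window, not on their places:
  \<open>omega r\<close> adds 1 to every integer, r + 1 being the next copy of 1. Differences, and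
  hence inversions, are then visibly preserved on this side; on the right a rotation of places has
  to be analysed.\<close>

lemma win_omega_mult:
  assumes "2 \<le> r" "w \<in> carrier (weyl e r)" "k \<in> {1..r}"
  shows "win r (omega r \<otimes>\<^bsub>weyl e r\<^esub> w) k = win r w k + 1"
  using fst_carrier(1)[OF assms(2,3)] by (auto simp: win_def weyl_mult omega_def algebra_simps)

lemma win_omega_power:
  assumes "2 \<le> r" "e \<noteq> \<infinity>" "w \<in> carrier (weyl e r)" "k \<in> {1..r}"
  shows "win r (omega r [^]\<^bsub>weyl e r\<^esub> (m::int) \<otimes>\<^bsub>weyl e r\<^esub> w) k = win r w k + m"
proof -
  interpret group "weyl e r" by (rule weyl_group)
  note om = omega_carrier[OF assms(1,2)]
  have suc: "win r (omega r [^]\<^bsub>weyl e r\<^esub> (m + 1) \<otimes>\<^bsub>weyl e r\<^esub> w) k =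
      win r (omega r [^]\<^bsub>weyl e r\<^esub> m \<otimes>\<^bsub>weyl e r\<^esub> w) k + 1" for m :: int
  proof -
    have "omega r [^]\<^bsub>weyl e r\<^esub> (m + 1) = omega r \<otimes>\<^bsub>weyl e r\<^esub> omega r [^]\<^bsub>weyl e r\<^esub> m"
      using om int_pow_mult[OF om, of 1 m] by (simp add: add.commute int_pow_1)
    then show ?thesis
      using win_omega_mult[OF assms(1) _ assms(4)] assms(3) om by (simp add: m_assoc int_pow_closed)
  qed
  show ?thesis
  proof (induction m rule: int_induct[where k = 0])
    case base show ?case using assms(3) by simp
  next
    case (step1 i) then show ?case using suc[of i] by simp
  next
    case (step2 i) then show ?case using suc[of "i - 1"] by simp
  qed
qed

lemma omega_powers_carrier:
  assumes "2 \<le> r" "z \<in> omega_powers e r"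
  shows "z \<in> carrier (weyl e r)" "\<exists>m. \<forall>w\<in>carrier (weyl e r). \<forall>k\<in>{1..r}. win r (z \<otimes>\<^bsub>weyl e r\<^esub> w) k = win r w k + m"
    "inv\<^bsub>weyl e r\<^esub> z \<in> omega_powers e r"
proof -
  interpret group "weyl e r" by (rule weyl_group)
  consider "z = \<one>\<^bsub>weyl e r\<^esub>" "e = \<infinity>" | m :: int where "e \<noteq> \<infinity>" "z = omega r [^]\<^bsub>weyl e r\<^esub> m"
    using assms(2) by (auto simp: omega_powers_def split: if_splits)
  note c = this
  show "z \<in> carrier (weyl e r)" using c
    using one_closed int_pow_closed[OF omega_carrier[OF assms(1)]] by metis
  show "\<exists>m. \<forall>w\<in>carrier (weyl e r). \<forall>k\<in>{1..r}. win r (z \<otimes>\<^bsub>weyl e r\<^esub> w) k = win r w k + m" using c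
  proof cases
    case 1
    show ?thesis unfolding 1(1) using l_one by (intro exI[of _ 0]) simp
  next
    case (2 m) then show ?thesis using win_omega_power[OF assms(1)] by blast
  qed
  show "inv\<^bsub>weyl e r\<^esub> z \<in> omega_powers e r" using c
  proof cases
    case 1
    then show ?thesis using inv_one by (simp add: omega_powers_def)
  next
    case (2 m)
    then have "inv\<^bsub>weyl e r\<^esub> z = omega r [^]\<^bsub>weyl e r\<^esub> (- m)"
      using int_pow_neg[OF omega_carrier[OF assms(1) 2(1)]] by simp
    then show ?thesis using 2(1) by (simp add: omega_powers_def del: not_infinity_eq)
  qed
qed

lemma inversions_omega_powers_left:
  assumes "2 \<le> r" "z \<in> omega_powers e r" "w \<in> carrier (weyl e r)"
  shows "inversions r (win r (z \<otimes>\<^bsub>weyl e r\<^esub> w)) = inversions r (win r w)"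
proof -
  obtain m where m: "\<And>k. k \<in> {1..r} \<Longrightarrow> win r (z \<otimes>\<^bsub>weyl e r\<^esub> w) k = win r w k + m"
    using omega_powers_carrier(2)[OF assms(1,2)] assms(3) by blast
  show ?thesis unfolding inversions_def
    by (rule sum.cong) (auto simp: m pairs_def)
qed

lemma inversions_omega_powers_right:
  assumes "2 \<le> r" "z \<in> omega_powers e r" "w \<in> carrier (weyl e r)"
  shows "inversions r (win r (w \<otimes>\<^bsub>weyl e r\<^esub> z)) = inversions r (win r w)"
proof (cases "e = \<infinity>")
  case True
  interpret group "weyl e r" by (rule weyl_group)
  have "z = \<one>\<^bsub>weyl e r\<^esub>" using True assms(2) by (simp add: omega_powers_def)
  then show ?thesis using assms(3) by simp
next
  case False
  interpret group "weyl e r" by (rule weyl_group)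
  note om = omega_carrier[OF assms(1) False]
  obtain m :: int where z: "z = omega r [^]\<^bsub>weyl e r\<^esub> m"
    using assms(2) False by (auto simp: omega_powers_def)
  have suc: "inversions r (win r (w \<otimes>\<^bsub>weyl e r\<^esub> omega r [^]\<^bsub>weyl e r\<^esub> (m + 1))) =
      inversions r (win r (w \<otimes>\<^bsub>weyl e r\<^esub> omega r [^]\<^bsub>weyl e r\<^esub> m))" for m :: int
  proof -
    have "omega r [^]\<^bsub>weyl e r\<^esub> (m + 1) = omega r [^]\<^bsub>weyl e r\<^esub> m \<otimes>\<^bsub>weyl e r\<^esub> omega r"
      using om int_pow_mult[OF om, of m 1] by (simp add: int_pow_1)
    then show ?thesis
      using inversions_omega[OF assms(1), of "w \<otimes>\<^bsub>weyl e r\<^esub> omega r [^]\<^bsub>weyl e r\<^esub> m" e] assms(3) om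
      by (simp add: m_assoc int_pow_closed)
  qed
  show ?thesis unfolding z
  proof (induction m rule: int_induct[where k = 0])
    case base show ?case using assms(3) by simp
  next
    case (step1 i) then show ?case using suc[of i] by simp
  next
    case (step2 i) then show ?case using suc[of "i - 1"] by simp
  qed
qed


section \<open>Words in the generators and reduced expressions\<close>

lemma word_Nil [simp]: "word e r [] = \<one>\<^bsub>weyl e r\<^esub>"
  by (simp add: word_def)

lemma word_Cons: "word e r (i # is) = cox r i \<otimes>\<^bsub>weyl e r\<^esub> word e r is"
  by (simp add: word_def)

lemma word_carrier:
  assumes "2 \<le> r" "set is \<subseteq> cox_index e r"
  shows "word e r is \<in> carrier (weyl e r)"
proof -
  interpret group "weyl e r" by (rule weyl_group)
  show ?thesis using assms(2)
    by (induction "is") (auto simp del: word_Nil simp: word_Cons cox_carrier[OF assms(1)], simp)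
qed

lemma word_append:
  assumes "2 \<le> r" "set is \<subseteq> cox_index e r" "set js \<subseteq> cox_index e r"
  shows "word e r (is @ js) = word e r is \<otimes>\<^bsub>weyl e r\<^esub> word e r js"
proof -
  interpret group "weyl e r" by (rule weyl_group)
  show ?thesis using assms(2)
  proof (induction "is")
    case Nil
    show ?case using word_carrier[OF assms(1,3)] by simp
  next
    case (Cons i "is")
    then show ?case
      using word_carrier[OF assms(1,3)] word_carrier[OF assms(1), of "is"] cox_carrier[OF assms(1), of i]
      by (simp add: word_Cons m_assoc)
  qed
qed

lemma inversions_one: "inversions r (win r \<one>\<^bsub>weyl e r\<^esub>) = 0"
  unfolding inversions_def by (rule sum.neutral) (auto simp: pairs_def win_one)

lemma inversions_word_le:
  assumes "2 \<le> r" "set is \<subseteq> cox_index e r"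
  shows "inversions r (win r (word e r is)) \<le> length is"
  using assms(2)
proof (induction "is" rule: rev_induct)
  case Nil
  show ?case by (simp add: inversions_one)
next
  case (snoc i "is")
  interpret group "weyl e r" by (rule weyl_group)
  have i: "i \<in> cox_index e r" "set is \<subseteq> cox_index e r" using snoc.prems by auto
  have "word e r (is @ [i]) = word e r is \<otimes>\<^bsub>weyl e r\<^esub> cox r i"
    using word_append[OF assms(1) i(2), of "[i]"] i cox_carrier[OF assms(1) i(1)] by (simp add: word_Cons)
  then show ?case
    using inversions_cox_le[OF assms(1) i(1) word_carrier[OF assms(1) i(2)]] snoc.IH[OF i(2)] by simp
qed

text \<open>Ascents at all simple roots make the window a run of consecutive integers, which is the
  window of a power of the rotation. For e = \<infinity> the root of index 0 is missing, but there
  the entries already lie between 1 and r and the run must start at 1.\<close>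

lemma no_descent_omega_power:
  assumes r: "2 \<le> r" and w: "w \<in> carrier (weyl e r)" and "\<And>i. i \<in> cox_index e r \<Longrightarrow> asc r w i"
  shows "w \<in> omega_powers e r"
proof -
  interpret group "weyl e r" by (rule weyl_group)
  have inc: "win r w k < win r w (Suc k)" if "k \<in> {1..<r}" for k
    using assms(3)[of k] that by (auto simp: cox_index_def asc_def src_def tgt_def shft_def split: if_splits)
  show ?thesis
  proof (cases "e = \<infinity>")
    case True
    have fs: "win r w k = int (fst w k)" for k using w True by (simp add: weyl_carrier win_def)
    have range: "win r w k \<in> {1..int r}" if "k \<in> {1..r}" for k
      using fst_carrier(1)[OF w that] by (simp add: fs)
    have "win r w k = win r w 1 + int k - 1" if "k \<in> {1..r}" for k
      using range[of 1] range[of r] r by (intro consecutive[of r "win r w"] inc that) auto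
    moreover from this[of r] have "win r w 1 = 1" using range[of 1] range[of r] r by auto
    ultimately have "w = \<one>\<^bsub>weyl e r\<^esub>"
      using w by (intro win_inj[of _ e r]) (auto simp: win_one)
    then show ?thesis using True by (simp add: omega_powers_def)
  next
    case False
    have "win r w r < win r w 1 + int r"
      using assms(3)[of 0] False r by (simp add: cox_index_def asc_def src_def tgt_def shft_def)
    then have *: "win r w k = win r w 1 + int k - 1" if "k \<in> {1..r}" for k
      using that by (intro consecutive[of r "win r w"] inc that)
    \<comment> \<open>The m-th power has the window k + m, so the exponent is read off at k =
      1.\<close>
    define z where "z = omega r [^]\<^bsub>weyl e r\<^esub> (win r w 1 - 1)"
    have z: "z \<in> carrier (weyl e r)" using omega_carrier[OF r False] by (simp add: z_def)
    have "z = w"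
    proof (rule win_inj[OF z w])
      fix k assume k: "k \<in> {1..r}"
      show "win r z k = win r w k"
        using win_omega_power[OF r False one_closed k, of "win r w 1 - 1"] *[OF k] z
        unfolding z_def[symmetric] by (simp add: win_one)
    qed
    then show ?thesis using False unfolding omega_powers_def z_def by (metis rangeI)
  qed
qed

lemma reduced_word_exists:
  assumes r: "2 \<le> r" and w: "w \<in> carrier (weyl e r)"
  shows "\<exists>z\<in>omega_powers e r. \<exists>is. set is \<subseteq> cox_index e r \<and> length is \<le> inversions r (win r w) \<and>
    w = z \<otimes>\<^bsub>weyl e r\<^esub> word e r is"
  using w
proof (induction "inversions r (win r w)" arbitrary: w rule: less_induct)
  case less
  interpret group "weyl e r" by (rule weyl_group)
  show ?case
  proof (cases "\<exists>i\<in>cox_index e r. \<not> asc r w i")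
    case True
    then obtain i where i: "i \<in> cox_index e r" "\<not> asc r w i" by blast
    let ?u = "w \<otimes>\<^bsub>weyl e r\<^esub> cox r i"
    have c: "cox r i \<in> carrier (weyl e r)" using cox_carrier[OF r i(1)] .
    have u: "?u \<in> carrier (weyl e r)" using less.prems c by simp
    have inv: "Suc (inversions r (win r ?u)) = inversions r (win r w)"
      using inversions_cox_desc[OF r i(1) less.prems i(2)] .
    then obtain z "is" where zis: "z \<in> omega_powers e r" "set is \<subseteq> cox_index e r"
      "length is \<le> inversions r (win r ?u)" "?u = z \<otimes>\<^bsub>weyl e r\<^esub> word e r is"
      using less.hyps[OF _ u] by fastforce
    note zc = omega_powers_carrier(1)[OF r zis(1)]
    have "word e r (is @ [i]) = word e r is \<otimes>\<^bsub>weyl e r\<^esub> cox r i"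
      using word_append[OF r zis(2), of "[i]"] i c by (simp add: word_Cons)
    then have "z \<otimes>\<^bsub>weyl e r\<^esub> word e r (is @ [i]) = ?u \<otimes>\<^bsub>weyl e r\<^esub> cox r i"
      using zis(4) zc c word_carrier[OF r zis(2)] by (simp add: m_assoc)
    also have "\<dots> = w" using mult_cox_cox[OF r i(1) less.prems] .
    finally show ?thesis using zis i inv by (intro bexI[of _ z] exI[of _ "is @ [i]"]) auto
  next
    case False
    then have "w \<in> omega_powers e r" using no_descent_omega_power[OF r less.prems] by blast
    then show ?thesis using less.prems by (intro bexI[of _ w] exI[of _ "[]"]) auto
  qed
qed

text \<open>Each letter changes the inversion number by at most one and powers of the rotation do
  not change it, which bounds every word from below; stripping descents attains the bound.\<close>

theorem len_eq_inversions:
  assumes r: "2 \<le> r" and w: "w \<in> carrier (weyl e r)"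
  shows "len e r w = inversions r (win r w)"
proof -
  let ?P = "\<lambda>m. \<exists>z \<in> omega_powers e r. \<exists>is. set is \<subseteq> cox_index e r \<and> length is = m \<and>
        w = z \<otimes>\<^bsub>weyl e r\<^esub> word e r is"
  have lower: "inversions r (win r w) \<le> m" if P: "?P m" for m
  proof -
    obtain z "is" where zis: "z \<in> omega_powers e r" "set is \<subseteq> cox_index e r" "length is = m"
      "w = z \<otimes>\<^bsub>weyl e r\<^esub> word e r is" using P by blast
    show ?thesis
      using inversions_omega_powers_left[OF r zis(1) word_carrier[OF r zis(2)]]
        inversions_word_le[OF r zis(2)] zis(3,4) by simp
  qed
  obtain m where m: "m \<le> inversions r (win r w)" "?P m"
    using reduced_word_exists[OF assms] by blast
  then have "?P (inversions r (win r w))" using lower[OF m(2)] by simp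
  then show ?thesis unfolding len_def using lower by (rule Least_equality)
qed

lemma len_cox_asc:
  assumes "2 \<le> r" "i \<in> cox_index e r" "w \<in> carrier (weyl e r)" "asc r w i"
  shows "len e r (w \<otimes>\<^bsub>weyl e r\<^esub> cox r i) = Suc (len e r w)"
proof -
  interpret group "weyl e r" by (rule weyl_group)
  show ?thesis using inversions_cox_asc[OF assms] cox_carrier[OF assms(1,2)] assms
    by (simp add: len_eq_inversions)
qed

lemma len_cox_desc:
  assumes "2 \<le> r" "i \<in> cox_index e r" "w \<in> carrier (weyl e r)" "\<not> asc r w i"
  shows "Suc (len e r (w \<otimes>\<^bsub>weyl e r\<^esub> cox r i)) = len e r w"
proof -
  interpret group "weyl e r" by (rule weyl_group)
  show ?thesis using inversions_cox_desc[OF assms] cox_carrier[OF assms(1,2)] assms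
    by (simp add: len_eq_inversions)
qed

lemma len_one [simp]: "2 \<le> r \<Longrightarrow> len e r \<one>\<^bsub>weyl e r\<^esub> = 0"
  using group.is_monoid[OF weyl_group]
  by (subst len_eq_inversions) (auto simp: monoid.one_closed inversions_one)

lemma asc_one: "2 \<le> r \<Longrightarrow> i < r \<Longrightarrow> asc r \<one>\<^bsub>weyl e r\<^esub> i"
  by (simp add: asc_def win_one src_def tgt_def shft_def)

lemma len_cox:
  assumes "2 \<le> r" "i \<in> cox_index e r"
  shows "len e r (cox r i) = 1"
proof -
  interpret group "weyl e r" by (rule weyl_group)
  show ?thesis
    using len_cox_asc[OF assms one_closed asc_one] cox_index_less[OF assms] cox_carrier[OF assms] assms(1)
    by simp
qed

lemma len_omega_power_left:
  assumes "2 \<le> r" "z \<in> omega_powers e r" "w \<in> carrier (weyl e r)"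
  shows "len e r (z \<otimes>\<^bsub>weyl e r\<^esub> w) = len e r w"
proof -
  interpret group "weyl e r" by (rule weyl_group)
  show ?thesis using assms omega_powers_carrier(1)[OF assms(1,2)]
    by (simp add: len_eq_inversions inversions_omega_powers_left)
qed

lemma len_omega_power:
  assumes "2 \<le> r" "z \<in> omega_powers e r"
  shows "len e r z = 0"
proof -
  interpret group "weyl e r" by (rule weyl_group)
  show ?thesis using assms len_omega_power_left[OF assms one_closed] omega_powers_carrier(1)[OF assms]
    by simp
qed

lemma inv_word:
  assumes "2 \<le> r" "set is \<subseteq> cox_index e r"
  shows "inv\<^bsub>weyl e r\<^esub> (word e r is) = word e r (rev is)"
proof -
  interpret group "weyl e r" by (rule weyl_group)
  show ?thesis using assms(2)
  proof (induction "is")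
    case (Cons i "is")
    then show ?case
      using word_append[OF assms(1), of "rev is" e "[i]"] cox_carrier[OF assms(1), of i e]
        word_carrier[OF assms(1), of "is" e] inv_cox[OF assms(1), of i e]
      by (simp add: word_Cons inv_mult_group)
  qed simp
qed

text \<open>Inversion reverses the word and moves the power of the rotation to its right, so
  invariance under right multiplication by these powers enters here.\<close>

lemma len_inv_le:
  assumes r: "2 \<le> r" and w: "w \<in> carrier (weyl e r)"
  shows "len e r (inv\<^bsub>weyl e r\<^esub> w) \<le> len e r w"
proof -
  interpret group "weyl e r" by (rule weyl_group)
  obtain z "is" where zis: "z \<in> omega_powers e r" "set is \<subseteq> cox_index e r"
      "length is \<le> inversions r (win r w)" "w = z \<otimes>\<^bsub>weyl e r\<^esub> word e r is"
    using reduced_word_exists[OF assms] by blast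
  note zc = omega_powers_carrier[OF r zis(1)]
  have wr: "word e r (rev is) \<in> carrier (weyl e r)" using zis(2) by (intro word_carrier[OF r]) simp
  have "inv\<^bsub>weyl e r\<^esub> w = word e r (rev is) \<otimes>\<^bsub>weyl e r\<^esub> inv\<^bsub>weyl e r\<^esub> z"
    using zis(4) zc(1) word_carrier[OF r zis(2)] inv_word[OF r zis(2)] by (simp add: inv_mult_group)
  then have "inversions r (win r (inv\<^bsub>weyl e r\<^esub> w)) = inversions r (win r (word e r (rev is)))"
    using inversions_omega_powers_right[OF r zc(3) wr] by simp
  also have "\<dots> \<le> length is" using inversions_word_le[OF r, of "rev is" e] zis(2) by simp
  finally show ?thesis using zis(3) w by (simp add: len_eq_inversions[OF r])
qed

lemma len_inv:
  assumes r: "2 \<le> r" and w: "w \<in> carrier (weyl e r)"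
  shows "len e r (inv\<^bsub>weyl e r\<^esub> w) = len e r w"
proof -
  interpret group "weyl e r" by (rule weyl_group)
  show ?thesis using len_inv_le[OF r w] len_inv_le[OF r inv_closed[OF w]] w by simp
qed

lemma len_cox_left:
  assumes r: "2 \<le> r" and i: "i \<in> cox_index e r" and w: "w \<in> carrier (weyl e r)"
  shows "asc r (inv\<^bsub>weyl e r\<^esub> w) i \<Longrightarrow> len e r (cox r i \<otimes>\<^bsub>weyl e r\<^esub> w) = Suc (len e r w)"
    "\<not> asc r (inv\<^bsub>weyl e r\<^esub> w) i \<Longrightarrow> Suc (len e r (cox r i \<otimes>\<^bsub>weyl e r\<^esub> w)) = len e r w"
proof -
  interpret group "weyl e r" by (rule weyl_group)
  note c = cox_carrier[OF r i]
  have "len e r (cox r i \<otimes>\<^bsub>weyl e r\<^esub> w) = len e r (inv\<^bsub>weyl e r\<^esub> w \<otimes>\<^bsub>weyl e r\<^esub> cox r i)"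
    using len_inv[OF r m_closed[OF c w]] c w inv_cox[OF r i] by (simp add: inv_mult_group)
  then show "asc r (inv\<^bsub>weyl e r\<^esub> w) i \<Longrightarrow> len e r (cox r i \<otimes>\<^bsub>weyl e r\<^esub> w) = Suc (len e r w)"
    "\<not> asc r (inv\<^bsub>weyl e r\<^esub> w) i \<Longrightarrow> Suc (len e r (cox r i \<otimes>\<^bsub>weyl e r\<^esub> w)) = len e r w"
    using len_cox_asc[OF r i inv_closed[OF w]] len_cox_desc[OF r i inv_closed[OF w]] len_inv[OF r w] by auto
qed

subsection \<open>Chains of reflections\<close>

text \<open>How much the length drops is left open. Only the sign of the root on the window is
  recorded, because this is what can be compared with beads; \<open>m = 0\<close> keeps the
  reflection in the finite group when e = \<infinity>.\<close>

definition bruhat_step :: "enat \<Rightarrow> nat \<Rightarrow> affperm \<Rightarrow> affperm \<Rightarrow> bool" where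
  "bruhat_step e r w y \<longleftrightarrow> w \<in> carrier (weyl e r) \<and> (\<exists>i j m. pos_root r i j m \<and> (e = \<infinity> \<longrightarrow> m = 0) \<and>
     win r w i > win r w j + int r * m \<and> y = w \<otimes>\<^bsub>weyl e r\<^esub> affrefl i j m)"

abbreviation bruhat_below :: "enat \<Rightarrow> nat \<Rightarrow> affperm \<Rightarrow> affperm \<Rightarrow> bool" where
  "bruhat_below e r \<equiv> (bruhat_step e r)\<^sup>+\<^sup>+"

lemma bruhat_step_carrier:
  assumes "bruhat_step e r w y"
  shows "w \<in> carrier (weyl e r)" "y \<in> carrier (weyl e r)"
proof -
  interpret group "weyl e r" by (rule weyl_group)
  show "w \<in> carrier (weyl e r)" "y \<in> carrier (weyl e r)"
    using assms by (auto simp: bruhat_step_def pos_root_def intro!: m_closed refl_carrier)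
qed

lemma bruhat_below_carrier:
  assumes "bruhat_below e r w y"
  shows "w \<in> carrier (weyl e r)" "y \<in> carrier (weyl e r)"
  using assms by (induction rule: tranclp_induct) (auto dest: bruhat_step_carrier)

lemma bruhat_step_cox:
  assumes r: "2 \<le> r" and i: "i \<in> cox_index e r" and w: "w \<in> carrier (weyl e r)" and "asc r w i"
  shows "bruhat_step e r (w \<otimes>\<^bsub>weyl e r\<^esub> cox r i) w"
proof -
  interpret group "weyl e r" by (rule weyl_group)
  note ir = cox_index_less[OF r i]
  note st = src_tgt[OF r ir]
  have "w = w \<otimes>\<^bsub>weyl e r\<^esub> cox r i \<otimes>\<^bsub>weyl e r\<^esub> affrefl (src r i) (tgt i) (shft i)"
    by (simp only: cox_refl[OF r ir, symmetric] mult_cox_cox[OF r i w])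
  moreover have "e = \<infinity> \<longrightarrow> shft i = 0"
    using i by (simp add: cox_index_def shft_def split: if_splits del: not_infinity_eq)
  ultimately show ?thesis unfolding bruhat_step_def
    using w cox_carrier[OF r i] st assms(4)
    by (intro conjI m_closed exI[of _ "src r i"] exI[of _ "tgt i"] exI[of _ "shft i"])
       (auto simp: win_cox[OF r ir] asc_def)
qed

text \<open>\<open>nu\<close> is the translation part of \<open>cox r k\<close> and corrects the
  shift when the ends of the root are exchanged. The excluded root is the one that would be sent to
  its negative.\<close>

lemma pos_root_cox:
  assumes r: "2 \<le> r" "k < r" and pos: "pos_root r i j m"
    and ne: "\<not> (i = src r k \<and> j = tgt k \<and> m = shft k)"
  defines "t \<equiv> transpose (src r k) (tgt k)"
    and "nu \<equiv> ((\<lambda>_. 0)(src r k := shft k, tgt k := - shft k) :: zseq)"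
  shows "pos_root r (t i) (t j) (m + nu (t i) - nu (t j))"
proof -
  have ij: "i \<in> {1..r}" "j \<in> {1..r}" "i \<noteq> j" "i < j \<and> m \<ge> 0 \<or> m > 0"
    using pos by (auto simp: pos_root_def)
  note st = src_tgt[OF r]
  have tr: "t i \<in> {1..r}" "t j \<in> {1..r}" "t i \<noteq> t j"
    using ij st by (auto simp: t_def transpose_def)
  have "t i < t j \<and> m + nu (t i) - nu (t j) \<ge> 0 \<or> m + nu (t i) - nu (t j) > 0"
  proof (cases "k = 0")
    case True
    have t: "t x = (if x = r then 1 else if x = 1 then r else x)" for x
      using True by (simp add: t_def src_def tgt_def transpose_def)
    have nu: "nu (t x) = (if x = r then - 1 else if x = 1 then 1 else 0)" for x
      using True r(1) by (simp add: t nu_def src_def tgt_def shft_def)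
    have "\<not> (i = r \<and> j = 1 \<and> m = 1)" using ne True by (simp add: src_def tgt_def shft_def)
    then show ?thesis using ij r(1) unfolding nu unfolding t atLeastAtMost_iff
      by (cases "i = r"; cases "j = r"; cases "i = 1"; cases "j = 1") auto
  next
    case False
    have t: "t x = (if x = k then Suc k else if x = Suc k then k else x)" for x
      using False by (simp add: t_def src_def tgt_def transpose_def)
    have nu: "nu x = 0" for x
      using False by (simp add: nu_def shft_def)
    have "\<not> (i = k \<and> j = Suc k \<and> m = 0)" using ne False by (simp add: src_def tgt_def shft_def)
    then show ?thesis using ij unfolding nu unfolding t by auto
  qed
  then show ?thesis using tr by (auto simp: pos_root_def)
qed

text \<open>A simple reflection permutes the positive roots other than its own.\<close>

lemma bruhat_step_lift:
  assumes r: "2 \<le> r" and k: "k \<in> cox_index e r" and step: "bruhat_step e r w y"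
    and ne: "y \<noteq> w \<otimes>\<^bsub>weyl e r\<^esub> cox r k"
  shows "bruhat_step e r (w \<otimes>\<^bsub>weyl e r\<^esub> cox r k) (y \<otimes>\<^bsub>weyl e r\<^esub> cox r k)"
proof -
  interpret group "weyl e r" by (rule weyl_group)
  obtain i j m where ijm: "pos_root r i j m" "e = \<infinity> \<longrightarrow> m = 0" "win r w i > win r w j + int r * m"
    "y = w \<otimes>\<^bsub>weyl e r\<^esub> affrefl i j m" using step unfolding bruhat_step_def by blast
  note w = bruhat_step_carrier(1)[OF step] and y = bruhat_step_carrier(2)[OF step]
  note kr = cox_index_less[OF r k] and c = cox_carrier[OF r k]
  note st = src_tgt[OF r kr]
  let ?p = "src r k" and ?q = "tgt k" and ?h = "shft k"
  let ?t = "transpose ?p ?q"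
  define nu where "nu = ((\<lambda>_. 0)(?p := ?h, ?q := - ?h) :: zseq)"
  define m' where "m' = m + nu (?t i) - nu (?t j)"
  have ij: "i \<noteq> j" "i \<in> {1..r}" "j \<in> {1..r}" using ijm(1) by (auto simp: pos_root_def)
  have ij': "?t i \<noteq> ?t j" using ij by (auto simp: transpose_def)
  have "affrefl i j m \<noteq> cox r k" using ne ijm(4) by auto
  then have notk: "\<not> (i = ?p \<and> j = ?q \<and> m = ?h)" by (auto simp: cox_refl[OF r kr])
  have pos: "pos_root r (?t i) (?t j) m'"
    using pos_root_cox[OF r kr ijm(1) notk] by (simp add: m'_def nu_def)
  have win: "win r (x \<otimes>\<^bsub>weyl e r\<^esub> cox r k) a = win r x (?t a) + int r * nu a" for x a
    using st by (auto simp: win_cox[OF r kr] nu_def transpose_def)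
  have inf: "e = \<infinity> \<longrightarrow> m' = 0"
  proof
    assume e: "e = \<infinity>"
    then have "shft k = 0" using k by (simp add: cox_index_def shft_def)
    then show "m' = 0" using ijm(2) e by (simp add: m'_def nu_def)
  qed
  have gt: "win r (w \<otimes>\<^bsub>weyl e r\<^esub> cox r k) (?t i) > win r (w \<otimes>\<^bsub>weyl e r\<^esub> cox r k) (?t j) + int r * m'"
    using ijm(3) by (simp add: win m'_def algebra_simps)
  have "y \<otimes>\<^bsub>weyl e r\<^esub> cox r k = w \<otimes>\<^bsub>weyl e r\<^esub> cox r k \<otimes>\<^bsub>weyl e r\<^esub> affrefl (?t i) (?t j) m'"
  proof (rule win_inj)
    show "w \<otimes>\<^bsub>weyl e r\<^esub> cox r k \<otimes>\<^bsub>weyl e r\<^esub> affrefl (?t i) (?t j) m' \<in> carrier (weyl e r)"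
      by (rule m_closed[OF m_closed[OF w c] refl_carrier[OF _ _ inf]]) (use pos in \<open>simp_all only: pos_root_def\<close>)
    fix a
    show "win r (y \<otimes>\<^bsub>weyl e r\<^esub> cox r k) a =
        win r (w \<otimes>\<^bsub>weyl e r\<^esub> cox r k \<otimes>\<^bsub>weyl e r\<^esub> affrefl (?t i) (?t j) m') a"
    proof -
      have ta: "?t a = i \<longleftrightarrow> a = ?t i" "?t a = j \<longleftrightarrow> a = ?t j" by (auto simp: transpose_def)
      have tt: "?t (?t x) = x" for x by simp
      consider "a = ?t i" | "a = ?t j" | "a \<noteq> ?t i" "a \<noteq> ?t j" by blast
      then show ?thesis
        unfolding win_refl[OF ij'] win ijm(4) win_refl[OF ij(1)]
        by cases (simp_all only: ta tt fun_upd_apply if_True if_False refl ij ij' not_False_eq_True m'_def,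
          simp_all add: algebra_simps ij ij')
    qed
  qed (use y c in auto)
  then show ?thesis unfolding bruhat_step_def using m_closed[OF w c] pos inf gt by blast
qed

text \<open>The lifting property of the Bruhat order, by induction along the chain. A step is
  carried over by right multiplication with s unless it is that multiplication itself; in this case
  the chain is closed through the step from ws down to w.\<close>

lemma bruhat_below_lift:
  assumes r: "2 \<le> r" and k: "k \<in> cox_index e r" and "bruhat_below e r w y" "asc r w k"
  shows "bruhat_below e r (w \<otimes>\<^bsub>weyl e r\<^esub> cox r k) (y \<otimes>\<^bsub>weyl e r\<^esub> cox r k)"
    "bruhat_below e r (w \<otimes>\<^bsub>weyl e r\<^esub> cox r k) y"
proof -
  interpret group "weyl e r" by (rule weyl_group)
  let ?ws = "w \<otimes>\<^bsub>weyl e r\<^esub> cox r k"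
  note w = bruhat_below_carrier(1)[OF assms(3)]
  have dn: "bruhat_step e r ?ws w" using bruhat_step_cox[OF r k w assms(4)] .
  then show "bruhat_below e r ?ws y" using assms(3) by (rule tranclp_into_tranclp2)
  show "bruhat_below e r ?ws (y \<otimes>\<^bsub>weyl e r\<^esub> cox r k)" using assms(3)
  proof (induction rule: tranclp_induct)
    case (base y)
    have "y \<noteq> ?ws"
    proof
      assume y: "y = ?ws"
      obtain i j m where ijm: "pos_root r i j m" "win r w i > win r w j + int r * m"
        "w \<otimes>\<^bsub>weyl e r\<^esub> affrefl i j m = ?ws" "e = \<infinity> \<longrightarrow> m = 0" using base[unfolded y] unfolding bruhat_step_def by metis
      have ij: "i \<noteq> j" "i \<in> {1..r}" "j \<in> {1..r}" using ijm(1) by (auto simp: pos_root_def)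
      have "affrefl i j m = affrefl (src r k) (tgt k) (shft k)"
        using ijm(3) w cox_carrier[OF r k] refl_carrier[OF ij(2,3) ijm(4)]
        by (simp add: cox_refl[OF r cox_index_less[OF r k]])
      then have t: "transpose i j = transpose (src r k) (tgt k)"
        and v: "((\<lambda>_. 0)(i := m, j := -m)) = ((\<lambda>_. 0)(src r k := shft k, tgt k := - shft k) :: zseq)"
        by (auto simp: affrefl_def)
      note st = src_tgt[OF r cox_index_less[OF r k]]
      \<comment> \<open>A reflection determines its root up to sign. The ascent of w rules out the
        simple root, and positivity of (i, j, m) rules out its negative.\<close>
      have "i = src r k \<and> j = tgt k \<or> i = tgt k \<and> j = src r k"
        using fun_cong[OF t, of i] fun_cong[OF t, of j] ij(1) st(3) by (auto simp: transpose_def split: if_splits)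
      then show False
      proof
        assume e1: "i = src r k \<and> j = tgt k"
        then have "m = shft k" using fun_cong[OF v, of i] ij(1) by simp
        then show False using ijm(2) assms(4) e1 by (simp add: asc_def)
      next
        assume e1: "i = tgt k \<and> j = src r k"
        then have "m = - shft k" using fun_cong[OF v, of i] ij(1) by simp
        then show False using ijm(1) e1 by (auto simp: pos_root_def src_def tgt_def shft_def split: if_splits)
      qed
    qed
    then show ?case using bruhat_step_lift[OF r k base] by blast
  next
    case (step y y')
    show ?case
    proof (cases "y' = y \<otimes>\<^bsub>weyl e r\<^esub> cox r k")
      case False
      then show ?thesis using bruhat_step_lift[OF r k step(2)] step.IH by (meson tranclp.trancl_into_trancl)
    next
      case True
      then have "y' \<otimes>\<^bsub>weyl e r\<^esub> cox r k = y"
        using mult_cox_cox[OF r k] bruhat_step_carrier(1)[OF step(2)] by simp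
      then show ?thesis using dn step(1) by (simp add: tranclp_into_tranclp2)
    qed
  qed
qed

section \<open>The bar-involution on the Hecke algebra\<close>

lemma poly_mapping_expand:
  fixes f :: "'a \<Rightarrow>\<^sub>0 ratfun"
  assumes "finite A" "Poly_Mapping.keys f \<subseteq> A"
  shows "f = (\<Sum>a\<in>A. scale (Poly_Mapping.lookup f a) (Poly_Mapping.single a 1))"
proof (rule poly_mapping_eqI)
  fix k
  have "(\<Sum>a\<in>A. Poly_Mapping.lookup f a * (1 when a = k)) =
      (\<Sum>a\<in>A. if a = k then Poly_Mapping.lookup f a else 0)"
    by (rule sum.cong) (auto simp: when_def)
  then show "Poly_Mapping.lookup f k = Poly_Mapping.lookup
      (\<Sum>a\<in>A. scale (Poly_Mapping.lookup f a) (Poly_Mapping.single a 1)) k"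
    using assms by (auto simp: lookup_sum lookup_single in_keys_iff subset_iff)
qed

lemma in_span_singles:
  fixes f :: "'a \<Rightarrow>\<^sub>0 ratfun"
  assumes "Poly_Mapping.keys f \<subseteq> A"
  shows "f \<in> fs.span ((\<lambda>a. Poly_Mapping.single a 1) ` A)"
  using assms by (subst poly_mapping_expand[of "Poly_Mapping.keys f" f])
    (auto intro!: fs.span_sum fs.span_scale intro: fs.span_base)

lemma vq_nonzero [simp]: "vq \<noteq> 0"
  by (simp add: vq_def)

locale hecke_alg =
  fixes e :: enat and r :: nat and H :: "hecke ring"
  assumes r2: "2 \<le> r" and hecke: "hecke_algebra e r H"
begin

abbreviation W where "W \<equiv> weyl e r"

sublocale W: group W
  by (rule weyl_group)

sublocale H: ring H
  using hecke by (simp add: hecke_algebra_def)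

lemma carrier_H: "carrier H = {h. Poly_Mapping.keys h \<subseteq> carrier W}"
  using hecke by (simp add: hecke_algebra_def)

lemma add_H: "x \<oplus>\<^bsub>H\<^esub> y = x + y"
  using hecke by (simp add: hecke_algebra_def)

lemma scale_mult:
  assumes "x \<in> carrier H" "y \<in> carrier H"
  shows "scale c x \<otimes>\<^bsub>H\<^esub> y = scale c (x \<otimes>\<^bsub>H\<^esub> y)" "x \<otimes>\<^bsub>H\<^esub> scale c y = scale c (x \<otimes>\<^bsub>H\<^esub> y)"
  using hecke assms by (auto simp: hecke_algebra_def)

lemma T_mult:
  assumes "w \<in> carrier W" "w' \<in> carrier W" "len e r (w \<otimes>\<^bsub>W\<^esub> w') = len e r w + len e r w'"
  shows "T w \<otimes>\<^bsub>H\<^esub> T w' = T (w \<otimes>\<^bsub>W\<^esub> w')"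
  using hecke assms by (auto simp: hecke_algebra_def)

lemma quadratic:
  assumes "i \<in> cox_index e r"
  shows "(T (cox r i) - scale (inverse vq) \<one>\<^bsub>H\<^esub>) \<otimes>\<^bsub>H\<^esub> (T (cox r i) + scale vq \<one>\<^bsub>H\<^esub>) = 0"
  using hecke assms by (auto simp: hecke_algebra_def)

lemma T_closed [simp]: "w \<in> carrier W \<Longrightarrow> T w \<in> carrier H"
  by (simp add: carrier_H)

lemma carrier_H_span: "carrier H = fs.span (T ` carrier W)"
proof
  show "carrier H \<subseteq> fs.span (T ` carrier W)"
    using in_span_singles by (auto simp: carrier_H)
  have sub: "fs.subspace (carrier H)"
  proof (rule fs.subspaceI)
    show "x + y \<in> carrier H" if "x \<in> carrier H" "y \<in> carrier H" for x y
      using that Poly_Mapping.keys_add[of x y] unfolding carrier_H by blast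
    show "scale c x \<in> carrier H" if "x \<in> carrier H" for c x
      using that by (auto simp: carrier_H in_keys_iff)
  qed (simp add: carrier_H)
  show "fs.span (T ` carrier W) \<subseteq> carrier H"
    by (rule fs.span_minimal[OF _ sub]) auto
qed

lemma subspace_carrier: "fs.subspace (carrier H)"
  unfolding carrier_H_span by simp

lemma H_closed [simp]:
  "x \<in> carrier H \<Longrightarrow> y \<in> carrier H \<Longrightarrow> x + y \<in> carrier H"
  "x \<in> carrier H \<Longrightarrow> y \<in> carrier H \<Longrightarrow> x - y \<in> carrier H"
  "x \<in> carrier H \<Longrightarrow> scale c x \<in> carrier H"
  "0 \<in> carrier H"
  using subspace_carrier by (auto intro: fs.subspace_add fs.subspace_diff fs.subspace_scale fs.subspace_0)

lemma mult_distrib: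
  assumes "x \<in> carrier H" "y \<in> carrier H" "z \<in> carrier H"
  shows "(x + y) \<otimes>\<^bsub>H\<^esub> z = x \<otimes>\<^bsub>H\<^esub> z + y \<otimes>\<^bsub>H\<^esub> z" "z \<otimes>\<^bsub>H\<^esub> (x + y) = z \<otimes>\<^bsub>H\<^esub> x + z \<otimes>\<^bsub>H\<^esub> y"
  using H.l_distr[OF assms] H.r_distr[OF assms] by (simp_all add: add_H)

lemma mult_zero [simp]:
  assumes "x \<in> carrier H"
  shows "0 \<otimes>\<^bsub>H\<^esub> x = 0" "x \<otimes>\<^bsub>H\<^esub> 0 = 0"
  using scale_mult[of 0 x 0] scale_mult[of x 0 0] assms by auto

lemma mult_diff:
  assumes "x \<in> carrier H" "y \<in> carrier H" "z \<in> carrier H"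
  shows "(x - y) \<otimes>\<^bsub>H\<^esub> z = x \<otimes>\<^bsub>H\<^esub> z - y \<otimes>\<^bsub>H\<^esub> z" "z \<otimes>\<^bsub>H\<^esub> (x - y) = z \<otimes>\<^bsub>H\<^esub> x - z \<otimes>\<^bsub>H\<^esub> y"
  using mult_distrib[of "x - y" y z] assms by (auto simp: algebra_simps)

text \<open>Length additivity makes the left side a left unit on basis vectors, hence on
  \<open>H\<close>; evaluation at the unit of \<open>H\<close> identifies the two.\<close>

lemma T_one: "T \<one>\<^bsub>W\<^esub> = \<one>\<^bsub>H\<^esub>"
proof -
  have "h \<in> carrier H \<and> T \<one>\<^bsub>W\<^esub> \<otimes>\<^bsub>H\<^esub> h = h" if "h \<in> fs.span (T ` carrier W)" for h
    using that
  proof (induction rule: fs.span_induct_alt)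
    case base show ?case by simp
  next
    case (step c x y)
    then obtain w where w: "x = T w" "w \<in> carrier W" by auto
    have "T \<one>\<^bsub>W\<^esub> \<otimes>\<^bsub>H\<^esub> T w = T w" using w r2 by (subst T_mult) auto
    then show ?case using w step by (simp add: mult_distrib scale_mult)
  qed
  from this[of "\<one>\<^bsub>H\<^esub>"] show ?thesis by (simp flip: carrier_H_span)
qed

lemma T_cox_sq:
  assumes i: "i \<in> cox_index e r"
  shows "T (cox r i) \<otimes>\<^bsub>H\<^esub> T (cox r i) = \<one>\<^bsub>H\<^esub> + scale (inverse vq - vq) (T (cox r i))"
proof -
  let ?t = "T (cox r i)"
  have t: "?t \<in> carrier H" using cox_carrier[OF r2 i] by simp
  have "(?t - scale (inverse vq) \<one>\<^bsub>H\<^esub>) \<otimes>\<^bsub>H\<^esub> (?t + scale vq \<one>\<^bsub>H\<^esub>) =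
      (?t \<otimes>\<^bsub>H\<^esub> ?t + scale vq ?t) - (scale (inverse vq) ?t + \<one>\<^bsub>H\<^esub>)"
    using t by (simp add: mult_distrib mult_diff scale_mult fs.scale_right_distrib fs.scale_right_diff_distrib)
  then have "?t \<otimes>\<^bsub>H\<^esub> ?t + scale vq ?t = scale (inverse vq) ?t + \<one>\<^bsub>H\<^esub>"
    using quadratic[OF i] by simp
  then have "?t \<otimes>\<^bsub>H\<^esub> ?t = scale (inverse vq) ?t + \<one>\<^bsub>H\<^esub> - scale vq ?t"
    by (rule add_implies_diff)
  also have "\<dots> = \<one>\<^bsub>H\<^esub> + (scale (inverse vq) ?t - scale vq ?t)"
    unfolding add_diff_eq by (subst add.commute) (rule refl)
  finally show ?thesis unfolding fs.scale_left_diff_distrib .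
qed

text \<open>The inverse of \<open>T (cox r i)\<close>, read off from the quadratic relation.\<close>

definition inv_cox_elt :: "nat \<Rightarrow> hecke" where
  "inv_cox_elt i = T (cox r i) + scale (vq - inverse vq) \<one>\<^bsub>H\<^esub>"

lemma inv_cox_elt:
  assumes i: "i \<in> cox_index e r"
  shows "inv_cox_elt i \<in> carrier H" "T (cox r i) \<otimes>\<^bsub>H\<^esub> inv_cox_elt i = \<one>\<^bsub>H\<^esub>"
    "inv_cox_elt i \<otimes>\<^bsub>H\<^esub> T (cox r i) = \<one>\<^bsub>H\<^esub>"
proof -
  have t: "T (cox r i) \<in> carrier H" using cox_carrier[OF r2 i] by simp
  have "scale (inverse vq - vq) x + scale (vq - inverse vq) x = 0" for x :: hecke
  proof -
    have "scale (inverse vq - vq) x + scale (vq - inverse vq) x = scale (inverse vq - vq + (vq - inverse vq)) x"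
      by (rule fs.scale_left_distrib[symmetric])
    also have "inverse vq - vq + (vq - inverse vq) = 0" by simp
    finally show ?thesis by simp
  qed
  then have *: "y + scale (inverse vq - vq) x + scale (vq - inverse vq) x = y" for x y :: hecke
    by (simp add: add.assoc)
  show "inv_cox_elt i \<in> carrier H" using t by (simp add: inv_cox_elt_def)
  show "T (cox r i) \<otimes>\<^bsub>H\<^esub> inv_cox_elt i = \<one>\<^bsub>H\<^esub>" "inv_cox_elt i \<otimes>\<^bsub>H\<^esub> T (cox r i) = \<one>\<^bsub>H\<^esub>"
    using t by (simp_all add: inv_cox_elt_def mult_distrib scale_mult T_cox_sq[OF i] *)
qed

lemma T_mult_cox:
  assumes i: "i \<in> cox_index e r" and w: "w \<in> carrier W" and "asc r w i"
  shows "T w \<otimes>\<^bsub>H\<^esub> T (cox r i) = T (w \<otimes>\<^bsub>W\<^esub> cox r i)"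
  by (rule T_mult[OF w cox_carrier[OF r2 i]])
    (simp add: len_cox_asc[OF r2 i w assms(3)] len_cox[OF r2 i])

text \<open>On a descent a single basis vector results, and on an ascent the additional term is
  \<open>T w\<close> itself, so the two conclusions of the lifting property cover all terms that can
  arise.\<close>

lemma T_mult_inv_cox:
  assumes i: "i \<in> cox_index e r" and w: "w \<in> carrier W"
  shows "asc r w i \<Longrightarrow> T w \<otimes>\<^bsub>H\<^esub> inv_cox_elt i = T (w \<otimes>\<^bsub>W\<^esub> cox r i) + scale (vq - inverse vq) (T w)"
    "\<not> asc r w i \<Longrightarrow> T w \<otimes>\<^bsub>H\<^esub> inv_cox_elt i = T (w \<otimes>\<^bsub>W\<^esub> cox r i)"
proof -
  note c = cox_carrier[OF r2 i]
  show "T w \<otimes>\<^bsub>H\<^esub> inv_cox_elt i = T (w \<otimes>\<^bsub>W\<^esub> cox r i) + scale (vq - inverse vq) (T w)" if "asc r w i"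
    using T_mult_cox[OF i w that] c w by (simp add: inv_cox_elt_def mult_distrib scale_mult)
  show "T w \<otimes>\<^bsub>H\<^esub> inv_cox_elt i = T (w \<otimes>\<^bsub>W\<^esub> cox r i)" if "\<not> asc r w i"
  proof -
    let ?u = "w \<otimes>\<^bsub>W\<^esub> cox r i"
    have u: "?u \<in> carrier W" "asc r ?u i" using c w that asc_cox[OF r2 i w] by auto
    have "T w = T ?u \<otimes>\<^bsub>H\<^esub> T (cox r i)" using T_mult_cox[OF i u] mult_cox_cox[OF r2 i w] by simp
    then show ?thesis using inv_cox_elt[OF i] u(1) c by (simp add: H.m_assoc)
  qed
qed

text \<open>Invertibility is proved together with the expansion, since the inverse has a meaning
  only for units. A right descent gives w = us with u shorter; the inverse of the
  \<open>T\<close>-element of the inverse of w is then the one for u, multiplied on the right by the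
  inverse of \<open>T\<close> of s.\<close>

theorem bar_T_triangular:
  assumes "w \<in> carrier W"
  shows "T (inv\<^bsub>W\<^esub> w) \<in> Units H \<and>
    inv\<^bsub>H\<^esub> (T (inv\<^bsub>W\<^esub> w)) - T w \<in> fs.span (T ` {y. bruhat_below e r w y})"
  using assms
proof (induction "len e r w" arbitrary: w rule: less_induct)
  case less
  note w = less.prems
  show ?case
  proof (cases "\<exists>i\<in>cox_index e r. \<not> asc r w i")
    case False
    then have z: "w \<in> omega_powers e r" using no_descent_omega_power[OF r2 w] by blast
    have l: "len e r w = 0" "len e r (inv\<^bsub>W\<^esub> w) = 0"
      using len_omega_power[OF r2] z omega_powers_carrier(3)[OF r2 z] by auto
    have "T w \<otimes>\<^bsub>H\<^esub> T (inv\<^bsub>W\<^esub> w) = \<one>\<^bsub>H\<^esub>" "T (inv\<^bsub>W\<^esub> w) \<otimes>\<^bsub>H\<^esub> T w = \<one>\<^bsub>H\<^esub>"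
      using w l T_mult[of w "inv\<^bsub>W\<^esub> w"] T_mult[of "inv\<^bsub>W\<^esub> w" w] r2 by (simp_all add: T_one)
    then have "T (inv\<^bsub>W\<^esub> w) \<in> Units H" "inv\<^bsub>H\<^esub> (T (inv\<^bsub>W\<^esub> w)) = T w"
      using w by (auto simp: Units_def intro!: H.inv_char)
    then show ?thesis by (simp add: fs.span_zero)
  next
    case True
    then obtain i where i: "i \<in> cox_index e r" "\<not> asc r w i" by blast
    note c = cox_carrier[OF r2 i(1)] and ic = inv_cox_elt[OF i(1)]
    let ?u = "w \<otimes>\<^bsub>W\<^esub> cox r i"
    have u: "?u \<in> carrier W" "asc r ?u i" using c w i asc_cox[OF r2 i(1) w] by auto
    have us: "?u \<otimes>\<^bsub>W\<^esub> cox r i = w" using mult_cox_cox[OF r2 i(1) w] .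
    have lu: "Suc (len e r ?u) = len e r w" using len_cox_desc[OF r2 i(1) w i(2)] .
    let ?X = "T (inv\<^bsub>W\<^esub> ?u)" and ?S = "fs.span (T ` {y. bruhat_below e r w y})"
    have IH: "?X \<in> Units H" "inv\<^bsub>H\<^esub> ?X - T ?u \<in> fs.span (T ` {y. bruhat_below e r ?u y})"
      using less.hyps[OF _ u(1)] lu by auto
    have iX: "inv\<^bsub>H\<^esub> ?X \<in> carrier H" using IH(1) by simp
    have invw: "inv\<^bsub>W\<^esub> w = cox r i \<otimes>\<^bsub>W\<^esub> inv\<^bsub>W\<^esub> ?u"
      using W.inv_mult_group[OF u(1) c] us inv_cox[OF r2 i(1)] by simp
    have "T (cox r i) \<otimes>\<^bsub>H\<^esub> ?X = T (inv\<^bsub>W\<^esub> w)"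
      unfolding invw using u c len_inv[OF r2] lu len_cox[OF r2 i(1)] w us invw
      by (intro T_mult) (auto simp flip: invw)
    then have TX: "T (inv\<^bsub>W\<^esub> w) = T (cox r i) \<otimes>\<^bsub>H\<^esub> ?X" ..
    define Y where "Y = inv\<^bsub>H\<^esub> ?X \<otimes>\<^bsub>H\<^esub> inv_cox_elt i"
    have Y: "Y \<in> carrier H" using iX ic by (simp add: Y_def)
    have 1: "T (inv\<^bsub>W\<^esub> w) \<otimes>\<^bsub>H\<^esub> Y = \<one>\<^bsub>H\<^esub>"
    proof -
      have "T (inv\<^bsub>W\<^esub> w) \<otimes>\<^bsub>H\<^esub> Y = T (cox r i) \<otimes>\<^bsub>H\<^esub> ((?X \<otimes>\<^bsub>H\<^esub> inv\<^bsub>H\<^esub> ?X) \<otimes>\<^bsub>H\<^esub> inv_cox_elt i)"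
        unfolding TX Y_def using iX ic c u by (simp add: H.m_assoc)
      then show ?thesis using IH(1) ic by simp
    qed
    have 2: "Y \<otimes>\<^bsub>H\<^esub> T (inv\<^bsub>W\<^esub> w) = \<one>\<^bsub>H\<^esub>"
    proof -
      have "Y \<otimes>\<^bsub>H\<^esub> T (inv\<^bsub>W\<^esub> w) = inv\<^bsub>H\<^esub> ?X \<otimes>\<^bsub>H\<^esub> ((inv_cox_elt i \<otimes>\<^bsub>H\<^esub> T (cox r i)) \<otimes>\<^bsub>H\<^esub> ?X)"
        unfolding TX Y_def using iX ic(1) c u by (simp add: H.m_assoc)
      then show ?thesis using IH(1) ic u by simp
    qed
    have "T (inv\<^bsub>W\<^esub> w) \<in> carrier H" using w by simp
    then have U: "T (inv\<^bsub>W\<^esub> w) \<in> Units H" "inv\<^bsub>H\<^esub> (T (inv\<^bsub>W\<^esub> w)) = Y"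
      using 1 2 Y by (auto simp: Units_def intro!: H.inv_char)
    have lift: "h \<in> carrier H \<and> h \<otimes>\<^bsub>H\<^esub> inv_cox_elt i \<in> ?S" if "h \<in> fs.span (T ` {y. bruhat_below e r ?u y})" for h
      using that
    proof (induction rule: fs.span_induct_alt)
      case base show ?case using ic by (simp add: fs.span_zero)
    next
      case (step a x h)
      then obtain y where y: "x = T y" "bruhat_below e r ?u y" by auto
      note yc = bruhat_below_carrier(2)[OF y(2)]
      have h: "h \<in> carrier H" using step by blast
      have "bruhat_below e r w y" "bruhat_below e r w (y \<otimes>\<^bsub>W\<^esub> cox r i)"
        using bruhat_below_lift[OF r2 i(1) y(2) u(2)] us by auto
      then have "T y \<otimes>\<^bsub>H\<^esub> inv_cox_elt i \<in> ?S"
        using T_mult_inv_cox[OF i(1) yc]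
        by (cases "asc r y i") (auto intro!: fs.span_add fs.span_scale intro: fs.span_base)
      then have "scale a (T y \<otimes>\<^bsub>H\<^esub> inv_cox_elt i) + h \<otimes>\<^bsub>H\<^esub> inv_cox_elt i \<in> ?S"
        using step(2) by (intro fs.span_add fs.span_scale) blast+
      then show ?case using y yc h ic by (simp add: mult_distrib scale_mult)
    qed
    have "bruhat_below e r w ?u" using bruhat_step_cox[OF r2 i(1) u] us by auto
    then have "T ?u \<in> ?S" by (intro fs.span_base) auto
    \<comment> \<open>The leading term \<open>T ?u\<close> itself splits into \<open>T w\<close> and
      a multiple of \<open>T ?u\<close>, so \<open>T w\<close> occurs with coefficient exactly
      1.\<close>
    moreover have "Y - T w = scale (vq - inverse vq) (T ?u) + (inv\<^bsub>H\<^esub> ?X - T ?u) \<otimes>\<^bsub>H\<^esub> inv_cox_elt i"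
      using T_mult_inv_cox(1)[OF i(1) u] iX ic u us by (simp add: Y_def mult_diff)
    ultimately show ?thesis using U lift[OF IH(2)] by (auto intro: fs.span_add fs.span_scale)
  qed
qed

end

section \<open>Straightening modulo the wedge relations\<close>

text \<open>This is the difference of the eigenvalues \<open>inverse vq\<close> and
  \<open>- vq\<close> of the two characters; killing a vector with a repeated bead divides by
  it.\<close>

lemma inv_vq_plus_vq: "inverse vq + vq \<noteq> 0"
proof
  assume "inverse vq + vq = 0"
  then have "vq * (inverse vq + vq) = 0" by simp
  then have "1 + vq * vq = 0" by (simp add: distrib_left)
  then have "to_fract ([:1:] + [:0, 1:] * [:0, 1:]) = (0 :: ratfun)"
    by (simp only: vq_def to_fract_add to_fract_mult) (simp flip: one_pCons)
  then show False by simp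
qed

locale wedge = hecke_alg +
  fixes a b :: zseq
  assumes a: "a \<in> alcove e r" and e0: "e \<noteq> 0"
    and b_dec: "\<And>i j. 1 \<le> i \<Longrightarrow> i \<le> j \<Longrightarrow> j \<le> r \<Longrightarrow> b j \<le> b i"
begin

abbreviation rel :: "hecke set" where "rel \<equiv> wedge_relations e r H a b"

abbreviation beads :: "affperm \<Rightarrow> zseq" where "beads \<equiv> act e a"

text \<open>The absence of left descents in the stabilizer of a, as for a shortest element of its
  coset. Positions below r suffice: for finite \<open>e\<close> the entries of a lie between 1 and
  \<open>e\<close>, so \<open>cox r 0\<close> never fixes a.\<close>

definition left_min :: "affperm \<Rightarrow> bool" where
  "left_min w \<longleftrightarrow> (\<forall>p\<in>{1..<r}. a p = a (Suc p) \<longrightarrow> asc r (inv\<^bsub>W\<^esub> w) p)"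

definition right_min :: "affperm \<Rightarrow> bool" where
  "right_min w \<longleftrightarrow> (\<forall>i\<in>{1..<r}. b i = b (Suc i) \<longrightarrow> asc r w i)"

text \<open>Bead sequences of multipartitions decrease along each runner. Right multiplication by
  the longest block element reverses every block, so the basis vectors representing them show
  increasing blocks.\<close>

definition block_increasing :: "zseq \<Rightarrow> bool" where
  "block_increasing \<xi> \<longleftrightarrow> (\<forall>i j. 1 \<le> i \<longrightarrow> i < j \<longrightarrow> j \<le> r \<longrightarrow> b i = b j \<longrightarrow> \<xi> i < \<xi> j)"

definition block_decreasing :: "zseq \<Rightarrow> bool" where
  "block_decreasing \<xi> \<longleftrightarrow> (\<forall>i j. 1 \<le> i \<longrightarrow> i < j \<longrightarrow> j \<le> r \<longrightarrow> b i = b j \<longrightarrow> \<xi> j < \<xi> i)"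

lemma a_mono: "1 \<le> i \<Longrightarrow> i \<le> j \<Longrightarrow> j \<le> r \<Longrightarrow> a i \<le> a j"
  using a by (auto simp: alcove_def mono_on_def)

lemma a_range: "e = enat k \<Longrightarrow> i \<in> {1..r} \<Longrightarrow> a i \<in> {1..int k}"
  using a by (auto simp: alcove_def)

lemma modulus_ge: "modulus e \<ge> 0"
  by (auto simp: modulus_def split: enat.splits)

lemma e_cases:
  obtains (inf) "e = \<infinity>" "modulus e = 0" | (fin) k where "e = enat k" "k \<ge> 1" "modulus e = int k"
  using e0 by (cases e) (auto simp: modulus_def zero_enat_def)

section \<open>One-letter relations, and windows against beads\<close>

lemma asc_pos: "i \<in> {1..<r} \<Longrightarrow> asc r w i \<longleftrightarrow> win r w i < win r w (Suc i)"
  by (auto simp: asc_def src_def tgt_def shft_def)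

lemma pos_index: "i \<in> {1..<r} \<Longrightarrow> i \<in> cox_index e r"
  by (auto simp: cox_index_def)

lemma cox_pos: "i \<in> {1..<r} \<Longrightarrow> cox r i = (transpose i (Suc i), \<lambda>_. 0)"
  by (auto simp: cox_def)

lemma beads_cox: "i \<in> {1..<r} \<Longrightarrow> beads (w \<otimes>\<^bsub>W\<^esub> cox r i) = beads w \<circ> transpose i (Suc i)"
  by (auto simp: act_alt weyl_mult cox_pos)

lemma stab_cox:
  assumes "p \<in> {1..<r}" "a p = a (Suc p)"
  shows "cox r p \<in> stab e r a" "beads (cox r p \<otimes>\<^bsub>W\<^esub> w) = beads w"
proof -
  have "beads (cox r p) = a" using assms by (auto simp: cox_pos act_alt transpose_def)
  then show "cox r p \<in> stab e r a" "beads (cox r p \<otimes>\<^bsub>W\<^esub> w) = beads w"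
    using cox_carrier[OF r2 pos_index[OF assms(1)]] by (auto simp: stab_def act_mult)
qed

lemma subspace_rel: "fs.subspace rel"
  by (simp add: wedge_relations_def)

lemma rel_left:
  assumes "p \<in> {1..<r}" "a p = a (Suc p)" "h \<in> carrier H"
  shows "T (cox r p) \<otimes>\<^bsub>H\<^esub> h - scale (inverse vq) h \<in> rel"
proof -
  have "T (cox r p) \<otimes>\<^bsub>H\<^esub> h - scale (inverse vq ^ len e r (cox r p)) h \<in> rel"
    unfolding wedge_relations_def using stab_cox(1)[OF assms(1,2)] assms(3)
    by (intro fs.span_base) blast
  then show ?thesis using len_cox[OF r2 pos_index[OF assms(1)]] by simp
qed

lemma rel_right:
  assumes "i \<in> {1..<r}" "b i = b (Suc i)" "h \<in> carrier H"
  shows "h \<otimes>\<^bsub>H\<^esub> T (cox r i) - scale (- vq) h \<in> rel"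
proof -
  have "cox r i \<in> block_subgroup e r b"
    unfolding block_subgroup_def using assms by (intro generate.incl) auto
  then have "h \<otimes>\<^bsub>H\<^esub> T (cox r i) - scale ((- vq) ^ len e r (cox r i)) h \<in> rel"
    unfolding wedge_relations_def using assms(3)
    by (intro fs.span_base) blast
  then show ?thesis using len_cox[OF r2 pos_index[OF assms(1)]] by simp
qed

lemma win_inv:
  assumes "y \<in> carrier W" "k \<in> {1..r}"
  shows "win r (inv\<^bsub>W\<^esub> y) (fst y k) = int k - int r * snd y k"
  using assms fst_carrier(2)[OF assms(1)] by (simp add: weyl_inv win_def)

lemma left_min_less:
  assumes "left_min y" "y \<in> carrier W" "1 \<le> p" "p \<le> q" "q \<le> r" "a p = a q"
  shows "win r (inv\<^bsub>W\<^esub> y) p + int (q - p) \<le> win r (inv\<^bsub>W\<^esub> y) q"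
proof (rule strict_step_diff[OF _ assms(4)])
  fix k assume k: "p \<le> k" "k < q"
  then have "a k = a (Suc k)"
    using a_mono[of p k] a_mono[of k "Suc k"] a_mono[of "Suc k" q] assms by auto
  moreover have "k \<in> {1..<r}" using assms k by simp
  ultimately show "win r (inv\<^bsub>W\<^esub> y) k < win r (inv\<^bsub>W\<^esub> y) (Suc k)"
    using assms(1) asc_pos[of k "inv\<^bsub>W\<^esub> y"] unfolding left_min_def by blast
qed

text \<open>The alcove condition makes k + r m |-> a_k + e m weakly increasing: a is increasing
  inside a period, and its spread is less than \<open>e\<close>. Two entries are identified only if
  they lie in the same period and in the same constancy interval of a.\<close>

lemma window_order_beads:
  assumes y: "y \<in> carrier W" and ij: "i \<in> {1..r}" "j \<in> {1..r}" and m: "e = \<infinity> \<longrightarrow> m = 0"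
    and gt: "win r y i > win r y j + int r * m"
  shows "beads y i \<ge> beads y j + modulus e * m"
    "beads y i = beads y j + modulus e * m \<Longrightarrow>
      snd y i = m + snd y j \<and> fst y j < fst y i \<and> a (fst y i) = a (fst y j)"
proof -
  \<comment> \<open>The difference of periods of the two entries. The window inequality forces it to
    be at most 0, and a negative value outweighs any difference between entries of a.\<close>
  define d where "d = m + snd y j - snd y i"
  note fr = fst_carrier(1)[OF y ij(1)] fst_carrier(1)[OF y ij(2)]
  have *: "int (fst y i) - int (fst y j) > int r * d"
    using gt by (simp add: win_def d_def algebra_simps)
  have "d \<le> 0"
  proof (rule ccontr)
    assume "\<not> d \<le> 0"
    then have "int r * d \<ge> int r" using mult_left_mono[of 1 d "int r"] by simp
    then show False using * fr by auto
  qed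
  have diff: "beads y i - (beads y j + modulus e * m) = a (fst y i) - a (fst y j) - modulus e * d"
    by (simp add: act_alt d_def algebra_simps)
  consider "d = 0" | "d < 0" using \<open>d \<le> 0\<close> by linarith
  then have "beads y i \<ge> beads y j + modulus e * m \<and>
    (beads y i = beads y j + modulus e * m \<longrightarrow>
      snd y i = m + snd y j \<and> fst y j < fst y i \<and> a (fst y i) = a (fst y j))"
  proof cases
    case 1
    then have "fst y j < fst y i" using * by simp
    then have "a (fst y j) \<le> a (fst y i)" using fr by (intro a_mono) auto
    then show ?thesis using 1 diff \<open>fst y j < fst y i\<close> by (auto simp: d_def)
  next
    case 2
    show ?thesis
    proof (cases rule: e_cases)
      case inf
      then have "snd y = (\<lambda>_. 0)" "m = 0" using y m by (simp_all add: weyl_carrier)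
      then show ?thesis using 2 by (simp add: d_def)
    next
      case (fin k)
      have "a (fst y i) - a (fst y j) > - int k" using a_range[OF fin(1) fr(1)] a_range[OF fin(1) fr(2)] by auto
      moreover have "modulus e * d \<le> - int k" using mult_left_mono[of d "-1" "int k"] 2 fin by simp
      ultimately show ?thesis using diff by simp
    qed
  qed
  then show "beads y i \<ge> beads y j + modulus e * m"
    "beads y i = beads y j + modulus e * m \<Longrightarrow>
      snd y i = m + snd y j \<and> fst y j < fst y i \<and> a (fst y i) = a (fst y j)" by auto
qed

lemma block_increasing_adjacent:
  assumes "\<And>i. i \<in> {1..<r} \<Longrightarrow> b i = b (Suc i) \<Longrightarrow> \<xi> i < \<xi> (Suc i)"
  shows "block_increasing \<xi>"
  unfolding block_increasing_def
proof (intro allI impI)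
  fix i j assume ij: "1 \<le> i" "i < j" "j \<le> r" "b i = b j"
  have "\<xi> i + int (j - i) \<le> \<xi> j"
  proof (rule strict_step_diff)
    fix k assume k: "i \<le> k" "k < j"
    then have "b k = b (Suc k)" using b_dec[of i k] b_dec[of k "Suc k"] b_dec[of "Suc k" j] ij by auto
    then show "\<xi> k < \<xi> (Suc k)" using k ij assms by auto
  qed (use ij in simp)
  then show "\<xi> i < \<xi> j" using ij by simp
qed

text \<open>If two equal beads of a block meet, then \<open>y s\<^sub>i = s\<^sub>p y\<close>, and the two characters disagree.\<close>

lemma repeated_bead_rel:
  assumes y: "y \<in> carrier W" and lm: "left_min y" and rm: "right_min y"
    and i: "i \<in> {1..<r}" "b i = b (Suc i)" "beads y (Suc i) \<le> beads y i"
  shows "T y \<in> rel"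
proof -
  have asc: "asc r y i" using rm i by (auto simp: right_min_def)
  then have lt: "win r y (Suc i) > win r y i + int r * 0" using asc_pos[OF i(1)] by simp
  have ii: "Suc i \<in> {1..r}" "i \<in> {1..r}" using i by auto
  have eq: "snd y (Suc i) = snd y i" "fst y i < fst y (Suc i)" "a (fst y (Suc i)) = a (fst y i)"
    using window_order_beads[OF y ii _ lt] i(3) by auto
  define p where "p = fst y i"
  have p: "p \<in> {1..r}" "fst y (Suc i) \<in> {1..r}" unfolding p_def using fst_carrier(1)[OF y] ii by auto
  have "win r (inv\<^bsub>W\<^esub> y) p + int (fst y (Suc i) - p) \<le> win r (inv\<^bsub>W\<^esub> y) (fst y (Suc i))"
    using left_min_less[OF lm y] p eq by (simp add: p_def)
  \<comment> \<open>The inverse window gains at least 1 per index from p up to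
    \<open>fst y (Suc i)\<close>, whereas its values at these two ends differ by exactly 1.\<close>
  then have q: "fst y (Suc i) = Suc p"
    using win_inv[OF y ii(1)] win_inv[OF y ii(2)] eq by (auto simp: p_def)
  have pr: "p \<in> {1..<r}" "a p = a (Suc p)" using p q eq by (auto simp: p_def)
  have inj: "fst y x = fst y z \<longleftrightarrow> x = z" for x z using fst_carrier(2)[OF y] by (auto dest: injD)
  have comm: "y \<otimes>\<^bsub>W\<^esub> cox r i = cox r p \<otimes>\<^bsub>W\<^esub> y"
  proof -
    have f1: "fst y (transpose i (Suc i) x) = transpose p (Suc p) (fst y x)" for x
      using inj[of x i] inj[of x "Suc i"] q by (auto simp: transpose_def p_def)
    have f2: "snd y (transpose i (Suc i) x) = snd y x" for x
      using eq(1) by (auto simp: transpose_def)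
    show ?thesis by (simp add: weyl_mult cox_pos[OF i(1)] cox_pos[OF pr(1)] fun_eq_iff f1 f2)
  qed
  have "asc r (inv\<^bsub>W\<^esub> y) p" using lm pr by (auto simp: left_min_def)
  then have "T (cox r p) \<otimes>\<^bsub>H\<^esub> T y = T (cox r p \<otimes>\<^bsub>W\<^esub> y)"
    using len_cox_left(1)[OF r2 pos_index[OF pr(1)] y] len_cox[OF r2 pos_index[OF pr(1)]]
    by (intro T_mult cox_carrier[OF r2 pos_index[OF pr(1)]] y) simp
  then have eqT: "T (cox r p) \<otimes>\<^bsub>H\<^esub> T y = T y \<otimes>\<^bsub>H\<^esub> T (cox r i)"
    using T_mult_cox[OF pos_index[OF i(1)] y asc] comm by simp
  have "(T y \<otimes>\<^bsub>H\<^esub> T (cox r i) - scale (- vq) (T y)) - (T (cox r p) \<otimes>\<^bsub>H\<^esub> T y - scale (inverse vq) (T y)) \<in> rel"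
    by (rule fs.subspace_diff[OF subspace_rel rel_right[OF i(1,2) T_closed[OF y]] rel_left[OF pr T_closed[OF y]]])
  then have "scale (inverse vq + vq) (T y) \<in> rel"
    unfolding eqT by (simp add: fs.scale_left_distrib add.commute)
  then have "scale (inverse (inverse vq + vq)) (scale (inverse vq + vq) (T y)) \<in> rel"
    by (rule fs.subspace_scale[OF subspace_rel])
  then show ?thesis using inv_vq_plus_vq by simp
qed

text \<open>A descent in one of the two parabolic subgroups allows a shorter vector: on the right it
  costs the factor -v and permutes beads within a runner, on the left it costs 1/v and keeps all
  beads. Without such descents, either the blocks increase strictly or two neighbours coincide. The
  permutation \<open>\<rho>\<close> records that each runner keeps its beads.\<close>

lemma straighten:
  assumes "y \<in> carrier W"
  shows "T y \<in> rel \<or> (\<exists>y'\<in>carrier W. \<exists>c \<rho>. left_min y' \<and> block_increasing (beads y') \<and>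
    \<rho> permutes {1..r} \<and> (\<forall>k\<in>{1..r}. b (\<rho> k) = b k) \<and> beads y' = beads y \<circ> \<rho> \<and>
    T y - scale c (T y') \<in> rel)"
  using assms
proof (induction "len e r y" arbitrary: y rule: less_induct)
  case less
  note y = less.prems
  have pass: ?case if u: "u \<in> carrier W" "len e r u < len e r y" and c: "T y - scale c (T u) \<in> rel"
    and \<rho>: "\<rho> permutes {1..r}" "\<forall>k\<in>{1..r}. b (\<rho> k) = b k" "beads u = beads y \<circ> \<rho>" for u c \<rho>
  proof -
    consider "T u \<in> rel" | y' c' \<rho>' where "y' \<in> carrier W" "left_min y'" "block_increasing (beads y')"
      "\<rho>' permutes {1..r}" "\<forall>k\<in>{1..r}. b (\<rho>' k) = b k" "beads y' = beads u \<circ> \<rho>'"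
      "T u - scale c' (T y') \<in> rel"
      using less.hyps[OF u(2,1)] by blast
    then show ?thesis
    proof cases
      case 1
      then have "(T y - scale c (T u)) + scale c (T u) \<in> rel"
        using c by (intro fs.subspace_add[OF subspace_rel] fs.subspace_scale[OF subspace_rel])
      then show ?thesis by simp
    next
      case (2 y' c' \<rho>')
      have "(T y - scale c (T u)) + scale c (T u - scale c' (T y')) \<in> rel"
        using c 2 by (intro fs.subspace_add[OF subspace_rel] fs.subspace_scale[OF subspace_rel])
      then have "T y - scale (c * c') (T y') \<in> rel" by (simp add: fs.scale_right_diff_distrib)
      moreover have "(\<rho> \<circ> \<rho>') permutes {1..r}" using permutes_compose[OF 2(4) \<rho>(1)] .
      moreover have "\<forall>k\<in>{1..r}. b ((\<rho> \<circ> \<rho>') k) = b k"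
        using 2(4,5) \<rho>(2) permutes_in_image[OF 2(4)] by (auto simp del: atLeastAtMost_iff)
      moreover have "beads y' = beads y \<circ> (\<rho> \<circ> \<rho>')" using 2(6) \<rho>(3) by (simp add: o_assoc)
      ultimately show ?thesis using 2(1-3) by blast
    qed
  qed
  show ?case
  proof (cases "right_min y")
    case False
    then obtain i where i: "i \<in> {1..<r}" "b i = b (Suc i)" "\<not> asc r y i" by (auto simp: right_min_def)
    note ic = pos_index[OF i(1)]
    let ?u = "y \<otimes>\<^bsub>W\<^esub> cox r i"
    have u: "?u \<in> carrier W" using y cox_carrier[OF r2 ic] by simp
    have "T ?u \<otimes>\<^bsub>H\<^esub> T (cox r i) = T y"
      using T_mult_cox[OF ic u] asc_cox[OF r2 ic y] i(3) mult_cox_cox[OF r2 ic y] by simp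
    then have "T y - scale (- vq) (T ?u) \<in> rel" using rel_right[OF i(1,2) T_closed[OF u]] by simp
    then show ?thesis
    proof (rule pass[OF u _ _, rotated, where \<rho> = "transpose i (Suc i)"])
      show "len e r ?u < len e r y" using len_cox_desc[OF r2 ic y i(3)] by simp
      show "transpose i (Suc i) permutes {1..r}" using i by (intro permutes_swap_id) auto
      show "\<forall>k\<in>{1..r}. b (transpose i (Suc i) k) = b k" using i by (auto simp: transpose_def)
      show "beads ?u = beads y \<circ> transpose i (Suc i)" using beads_cox[OF i(1)] .
    qed
  next
    case rm: True
    show ?thesis
    proof (cases "left_min y")
      case False
      then obtain p where p: "p \<in> {1..<r}" "a p = a (Suc p)" "\<not> asc r (inv\<^bsub>W\<^esub> y) p" by (auto simp: left_min_def)
      note pc = pos_index[OF p(1)] and c = cox_carrier[OF r2 pos_index[OF p(1)]]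
      let ?u = "cox r p \<otimes>\<^bsub>W\<^esub> y"
      have u: "?u \<in> carrier W" using y c by simp
      have l: "Suc (len e r ?u) = len e r y" using len_cox_left(2)[OF r2 pc y p(3)] .
      have uy: "cox r p \<otimes>\<^bsub>W\<^esub> ?u = y"
        using y c cox_cox[OF r2, of p e] p(1) by (simp flip: W.m_assoc)
      have "T (cox r p) \<otimes>\<^bsub>H\<^esub> T ?u = T y"
        using T_mult[OF c u] l len_cox[OF r2 pc] unfolding uy by simp
      then have "T y - scale (inverse vq) (T ?u) \<in> rel" using rel_left[OF p(1,2) T_closed[OF u]] by simp
      then show ?thesis
        by (rule pass[OF u _ _, rotated, where \<rho> = id]) (use l stab_cox(2)[OF p(1,2)] in \<open>auto simp: permutes_id\<close>)
    next
      case lm: True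
      show ?thesis
      proof (cases "block_increasing (beads y)")
        case True
        have "T y - scale 1 (T y) \<in> rel" using fs.subspace_0[OF subspace_rel] by simp
        then show ?thesis using True y lm permutes_id[of "{1..r}"]
          by (intro disjI2 bexI[of _ y] exI[of _ 1] exI[of _ id]) auto
      next
        case False
        then obtain i where "i \<in> {1..<r}" "b i = b (Suc i)" "beads y (Suc i) \<le> beads y i"
          using block_increasing_adjacent[of "beads y"] by (meson linorder_not_less)
        then show ?thesis using repeated_bead_rel[OF y lm rm] by blast
      qed
    qed
  qed
qed

text \<open>The quotient u of the two elements fixes a, and uniqueness of residues removes its
  translation part. Minimality of both elements makes the remaining permutation increasing, so it is
  the identity.\<close>

lemma left_min_unique:
  assumes y: "y \<in> carrier W" "left_min y" and y': "y' \<in> carrier W" "left_min y'"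
    and eq: "beads y = beads y'"
  shows "y = y'"
proof -
  define u where "u = y' \<otimes>\<^bsub>W\<^esub> inv\<^bsub>W\<^esub> y"
  have u: "u \<in> carrier W" using y y' by (simp add: u_def)
  have uy: "u \<otimes>\<^bsub>W\<^esub> y = y'" using y y' by (simp add: u_def W.m_assoc)
  have "beads u = act e (beads y) (inv\<^bsub>W\<^esub> y)" by (simp add: u_def act_mult eq)
  also have "\<dots> = beads (y \<otimes>\<^bsub>W\<^esub> inv\<^bsub>W\<^esub> y)" by (simp add: act_mult)
  also have "\<dots> = a" using y by simp
  finally have ua: "beads u = a" .
  have stab: "a (fst u p) = a p \<and> snd u p = 0" if p: "p \<in> {1..r}" for p
  proof -
    have h: "a (fst u p) + modulus e * snd u p = a p" using ua by (simp add: act_alt fun_eq_iff)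
    show ?thesis
    proof (cases rule: e_cases)
      case inf then show ?thesis using h u by (auto simp: weyl_carrier)
    next
      case (fin k)
      then show ?thesis
        using h residue_unique[of "a (fst u p)" k "a p" "snd u p" 0] a_range[OF fin(1)]
          fst_carrier(1)[OF u p] p by auto
    qed
  qed
  \<comment> \<open>The permutation part of u carries the inverse window of y to that of y', so both
    minimality conditions can be played against each other inside a constancy interval of a.\<close>
  have kap: "win r (inv\<^bsub>W\<^esub> y') (fst u p) = win r (inv\<^bsub>W\<^esub> y) p" if p: "p \<in> {1..r}" for p
  proof -
    have "fst y permutes {1..r}" using y by (simp add: weyl_carrier)
    then obtain k where k: "k \<in> {1..r}" "p = fst y k" using p by (metis permutes_image image_iff)
    have "fst y' k = fst u p" "snd y' k = snd y k" using stab[OF p] k by (auto simp: weyl_mult simp flip: uy)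
    then show ?thesis using win_inv[OF y(1) k(1)] win_inv[OF y'(1) k(1)] k(2) by simp
  qed
  have inc: "fst u p < fst u q" if "p \<in> {1..r}" "q \<in> {1..r}" "p < q" for p q
  proof (rule ccontr)
    assume "\<not> fst u p < fst u q"
    moreover have "fst u p \<noteq> fst u q" using fst_carrier(2)[OF u] that by (auto dest: injD)
    ultimately have gt: "fst u q < fst u p" by simp
    note fr = fst_carrier(1)[OF u that(1)] fst_carrier(1)[OF u that(2)]
    have "a (fst u q) \<le> a (fst u p)" using gt fr by (intro a_mono) auto
    then have aeq: "a p = a q" using stab that a_mono[of p q] by auto
    have "win r (inv\<^bsub>W\<^esub> y') (fst u q) < win r (inv\<^bsub>W\<^esub> y') (fst u p)"
      using left_min_less[OF y'(2,1), of "fst u q" "fst u p"] gt fr stab that aeq by auto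
    moreover have "win r (inv\<^bsub>W\<^esub> y) p < win r (inv\<^bsub>W\<^esub> y) q"
      using left_min_less[OF y(2,1), of p q] that aeq by auto
    ultimately show False using kap that by simp
  qed
  have r1: "1 \<in> {1..r}" "r \<in> {1..r}" using r2 by auto
  have shift: "int (fst u k) = int (fst u 1) + int k - 1" if "k \<in> {1..r}" for k
    by (rule consecutive[where f = "\<lambda>k. int (fst u k)" and r = r])
      (use that inc fst_carrier(1)[OF u r1(1)] fst_carrier(1)[OF u r1(2)] in auto)
  have u1: "fst u 1 = 1" using shift[OF r1(2)] fst_carrier(1)[OF u r1(1)] fst_carrier(1)[OF u r1(2)] by auto
  have "u = \<one>\<^bsub>W\<^esub>"
    by (rule win_inj[OF u W.one_closed]) (use u1 stab shift in \<open>auto simp: win_def weyl_one\<close>)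
  then show ?thesis using uy y by simp
qed

subsection \<open>The canonical representatives\<close>

text \<open>A left descent in the stabilizer would produce a shorter element with the same
  beads.\<close>

lemma min_rep_props:
  assumes "w \<in> carrier W" "beads w = \<zeta>"
  shows "min_rep e r a \<zeta> \<in> carrier W" "beads (min_rep e r a \<zeta>) = \<zeta>" "left_min (min_rep e r a \<zeta>)"
proof -
  let ?x = "min_rep e r a \<zeta>"
  let ?P = "\<lambda>w. w \<in> carrier W \<and> beads w = \<zeta>"
  have P: "?P ?x" unfolding min_rep_def using assms by (intro arg_min_natI[of ?P w]) auto
  then show x: "?x \<in> carrier W" "beads ?x = \<zeta>" by auto
  show "left_min ?x" unfolding left_min_def
  proof (intro ballI impI, rule ccontr)
    fix p assume p: "p \<in> {1..<r}" "a p = a (Suc p)" "\<not> asc r (inv\<^bsub>W\<^esub> ?x) p"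
    note pc = pos_index[OF p(1)]
    have "?P (cox r p \<otimes>\<^bsub>W\<^esub> ?x)" using x stab_cox(2)[OF p(1,2)] cox_carrier[OF r2 pc] by simp
    then have "len e r ?x \<le> len e r (cox r p \<otimes>\<^bsub>W\<^esub> ?x)"
      unfolding min_rep_def by (intro arg_min_nat_le[of ?P])
    then show False using len_cox_left(2)[OF r2 pc x(1) p(3)] by simp
  qed
qed

abbreviation wb :: affperm where "wb \<equiv> block_longest e r b"

lemma block_subgroup_props:
  assumes "w \<in> block_subgroup e r b"
  shows "w \<in> carrier W \<and> snd w = (\<lambda>_. 0) \<and> (\<forall>k\<in>{1..r}. b (fst w k) = b k)"
  using assms unfolding block_subgroup_def
proof (induction rule: generate.induct)
  case one
  have "\<one>\<^bsub>W\<^esub> \<in> carrier W" by simp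
  then show ?case by (simp add: weyl_one)
next
  case (incl h)
  then show ?case using cox_carrier[OF r2 pos_index] by (auto simp: cox_pos transpose_def)
next
  case (inv h)
  then obtain i where i: "i \<in> {1..<r}" "b i = b (Suc i)" "h = cox r i" by auto
  then show ?case using inv_cox[OF r2 pos_index[OF i(1)]] cox_carrier[OF r2 pos_index[OF i(1)]]
    by (auto simp: cox_pos transpose_def)
next
  case (eng h1 h2)
  have "h1 \<otimes>\<^bsub>W\<^esub> h2 \<in> carrier W" using eng by simp
  then show ?case using eng fst_carrier(1)[of h2 e r] by (auto simp: weyl_mult simp del: atLeastAtMost_iff)
qed

text \<open>A maximum exists because an element without translation part has at most one inversion
  per pair. Maximality forbids ascents inside a block, so the longest element reverses each
  block.\<close>

lemma wb_props: "wb \<in> carrier W" "snd wb = (\<lambda>_. 0)" "fst wb permutes {1..r}"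
  "\<And>k. k \<in> {1..r} \<Longrightarrow> b (fst wb k) = b k"
  "\<And>i j. 1 \<le> i \<Longrightarrow> i < j \<Longrightarrow> j \<le> r \<Longrightarrow> b i = b j \<Longrightarrow> fst wb j < fst wb i"
proof -
  let ?G = "block_subgroup e r b"
  have one: "\<one>\<^bsub>W\<^esub> \<in> ?G" by (simp add: block_subgroup_def generate.one)
  have bound: "len e r w < Suc (card (pairs r))" if "w \<in> ?G" for w
  proof -
    note w = block_subgroup_props[OF that]
    have "nat \<bar>(win r w j - win r w i) div int r\<bar> \<le> 1" if "(i, j) \<in> pairs r" for i j
    proof -
      have "fst w i \<in> {1..r}" "fst w j \<in> {1..r}"
        using w fst_carrier(1)[of w e r] that by (auto simp: pairs_def)
      then have d: "- int r \<le> win r w j - win r w i" "win r w j - win r w i < int r"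
        using w by (auto simp: win_def)
      have "(win r w j - win r w i) div int r \<ge> -1"
        using zdiv_mono1[OF d(1), of "int r"] r2
          nonzero_mult_div_cancel_right[of "int r" "-1"] by simp
      moreover have "\<not> 0 < (win r w j - win r w i) div int r"
        using d(2) r2 pos_imp_zdiv_pos_iff[of "int r"] by simp
      ultimately show ?thesis by auto
    qed
    then have "inversions r (win r w) \<le> (\<Sum>p\<in>pairs r. 1)"
      unfolding inversions_def by (intro sum_mono) auto
    then show ?thesis using w len_eq_inversions[OF r2, of w e] by simp
  qed
  have wbG: "wb \<in> ?G" unfolding block_longest_def
    using arg_max_natI[of "\<lambda>w. w \<in> ?G", OF one] bound by blast
  have longest: "len e r w \<le> len e r wb" if "w \<in> ?G" for w unfolding block_longest_def
    using arg_max_nat_le[of "\<lambda>w. w \<in> ?G", OF that] bound by blast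
  note p = block_subgroup_props[OF wbG]
  then show wc: "wb \<in> carrier W" and s0: "snd wb = (\<lambda>_. 0)" and "fst wb permutes {1..r}"
    and "\<And>k. k \<in> {1..r} \<Longrightarrow> b (fst wb k) = b k" by (auto simp: weyl_carrier)
  \<comment> \<open>Negation turns a decreasing block into the increasing form for which adjacent
    comparisons suffice.\<close>
  have "block_increasing (\<lambda>k. - int (fst wb k))"
  proof (rule block_increasing_adjacent)
    fix i assume i: "i \<in> {1..<r}" "b i = b (Suc i)"
    note ic = pos_index[OF i(1)]
    have "wb \<otimes>\<^bsub>W\<^esub> cox r i \<in> ?G"
      using wbG i unfolding block_subgroup_def by (intro generate.eng[OF _ generate.incl]) auto
    then have "len e r (wb \<otimes>\<^bsub>W\<^esub> cox r i) \<le> len e r wb" by (rule longest)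
    then have "\<not> asc r wb i" using len_cox_asc[OF r2 ic wc] by auto
    moreover have "fst wb i \<noteq> fst wb (Suc i)" using inj_eq[OF fst_carrier(2)[OF wc]] by simp
    ultimately show "- int (fst wb i) < - int (fst wb (Suc i))"
      using asc_pos[OF i(1), of wb] by (simp add: win_def s0)
  qed
  then show "fst wb j < fst wb i" if "1 \<le> i" "i < j" "j \<le> r" "b i = b j" for i j
    using that by (auto simp: block_increasing_def)
qed

lemma beads_wb: "beads (x \<otimes>\<^bsub>W\<^esub> wb) = beads x \<circ> fst wb"
  unfolding act_mult by (simp add: act_alt wb_props(2) comp_def)

definition canon :: "zseq \<Rightarrow> affperm" where
  "canon \<zeta> = min_rep e r a \<zeta> \<otimes>\<^bsub>W\<^esub> wb"

text \<open>Reversing blocks keeps left minimality. If the entries concerned lie in different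
  periods, moving places inside 1..r cannot change their order. In the same period the two beads are
  equal, hence on different runners, and the order of different blocks is respected by the longest
  element.\<close>

lemma canon_props:
  assumes w: "w \<in> carrier W" "beads w = \<zeta>" and dec: "block_decreasing \<zeta>"
  shows "canon \<zeta> \<in> carrier W" "beads (canon \<zeta>) = \<zeta> \<circ> fst wb" "left_min (canon \<zeta>)"
    "block_increasing (\<zeta> \<circ> fst wb)"
proof -
  let ?x = "min_rep e r a \<zeta>"
  note x = min_rep_props[OF w]
  show cc: "canon \<zeta> \<in> carrier W" using x wb_props(1) by (simp add: canon_def)
  show "beads (canon \<zeta>) = \<zeta> \<circ> fst wb" using x by (simp add: canon_def beads_wb)
  have wbr: "fst wb k \<in> {1..r}" if "k \<in> {1..r}" for k using fst_carrier(1)[OF wb_props(1) that] .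
  show "block_increasing (\<zeta> \<circ> fst wb)"
    unfolding block_increasing_def
  proof (intro allI impI)
    fix i j assume ij: "1 \<le> i" "i < j" "j \<le> r" "b i = b j"
    have "fst wb i \<in> {1..r}" "fst wb j \<in> {1..r}" using wbr ij by auto
    then show "(\<zeta> \<circ> fst wb) i < (\<zeta> \<circ> fst wb) j"
      using dec wb_props(5)[OF ij] wb_props(4)[of i] wb_props(4)[of j] ij
      by (auto simp: block_decreasing_def)
  qed
  show "left_min (canon \<zeta>)" unfolding left_min_def
  proof (intro ballI impI)
    fix p assume p: "p \<in> {1..<r}" "a p = a (Suc p)"
    have wp: "fst (canon \<zeta>) permutes {1..r}" using cc by (simp add: weyl_carrier)
    obtain k where k: "k \<in> {1..r}" "fst (canon \<zeta>) k = p"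
      using p wp by (metis permutes_image image_iff atLeastAtMost_iff atLeastLessThan_iff less_imp_le)
    obtain l where l: "l \<in> {1..r}" "fst (canon \<zeta>) l = Suc p"
      using p wp by (metis permutes_image image_iff atLeastAtMost_iff atLeastLessThan_iff Suc_leI le_SucI)
    let ?k = "fst wb k" and ?l = "fst wb l"
    have kl: "?k \<in> {1..r}" "?l \<in> {1..r}" using wbr k l by auto
    have fx: "fst ?x ?k = p" "fst ?x ?l = Suc p" using k l by (auto simp: canon_def weyl_mult)
    have sw: "snd (canon \<zeta>) k = snd ?x ?k" "snd (canon \<zeta>) l = snd ?x ?l"
      by (auto simp: canon_def weyl_mult wb_props(2))
    have "asc r (inv\<^bsub>W\<^esub> ?x) p" using x(3) p by (auto simp: left_min_def)
    then have lt: "int ?k - int r * snd ?x ?k < int ?l - int r * snd ?x ?l"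
      unfolding asc_pos[OF p(1)]
      using win_inv[OF x(1) kl(1), unfolded fx] win_inv[OF x(1) kl(2), unfolded fx] by simp
    have "int k - int r * snd ?x ?k < int l - int r * snd ?x ?l"
    proof (rule linorder_cases[of "snd ?x ?k" "snd ?x ?l"])
      assume "snd ?x ?k < snd ?x ?l"
      then have "int r * (snd ?x ?k + 1) \<le> int r * snd ?x ?l" by (intro mult_left_mono) auto
      then show ?thesis using lt kl by (auto simp: algebra_simps)
    next
      assume "snd ?x ?k > snd ?x ?l"
      then have "int r * (snd ?x ?l + 1) \<le> int r * snd ?x ?k" by (intro mult_left_mono) auto
      then show ?thesis using k l by (auto simp: algebra_simps)
    next
      assume eq: "snd ?x ?k = snd ?x ?l"
      then have less: "?k < ?l" using lt by simp
      have "\<zeta> ?k = \<zeta> ?l" using fun_cong[OF x(2), of ?k] fun_cong[OF x(2), of ?l] eq fx p(2)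
        by (simp add: act_alt)
      moreover have "\<zeta> ?l < \<zeta> ?k" if "b ?k = b ?l"
        using dec[unfolded block_decreasing_def, rule_format, of ?k ?l] that less kl by simp
      ultimately have "b ?k \<noteq> b ?l" by auto
      moreover have "b ?l \<le> b ?k" using less kl by (intro b_dec) auto
      ultimately have "b l < b k" using wb_props(4)[OF k(1)] wb_props(4)[OF l(1)] by linarith
      then have "k < l" using b_dec[of l k] k l by (meson atLeastAtMost_iff linorder_not_less)
      then show ?thesis using eq by simp
    qed
    then show "asc r (inv\<^bsub>W\<^esub> (canon \<zeta>)) p"
      unfolding asc_pos[OF p(1)]
      using win_inv[OF cc k(1), unfolded k(2) sw(1)] win_inv[OF cc l(1), unfolded l(2) sw(2)] by simp
  qed
qed

lemma canon_eqI:
  assumes y: "y \<in> carrier W" "left_min y" "block_increasing (beads y)"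
  obtains \<zeta> where "block_decreasing \<zeta>" "\<zeta> = beads y \<circ> Hilbert_Choice.inv (fst wb)"
    "beads (y \<otimes>\<^bsub>W\<^esub> inv\<^bsub>W\<^esub> wb) = \<zeta>" "y = canon \<zeta>"
proof -
  let ?i = "Hilbert_Choice.inv (fst wb)"
  define \<zeta> where "\<zeta> = beads y \<circ> ?i"
  have ip: "?i permutes {1..r}" using wb_props(3) by (rule permutes_inv)
  have bz: "beads (y \<otimes>\<^bsub>W\<^esub> inv\<^bsub>W\<^esub> wb) = \<zeta>"
    using wb_props(1,2) by (auto simp: \<zeta>_def act_mult weyl_inv) (auto simp: act_alt)
  have fi: "fst wb (?i k) = k" for k using permutes_inverses(1)[OF wb_props(3)] .
  have ir: "?i k \<in> {1..r}" if "k \<in> {1..r}" for k using that permutes_in_image[OF ip] by blast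
  have bi: "b (?i k) = b k" if "k \<in> {1..r}" for k using wb_props(4)[OF ir[OF that]] fi by simp
  have dec: "block_decreasing \<zeta>"
    unfolding block_decreasing_def
  proof (intro allI impI)
    fix i j assume ij: "1 \<le> i" "i < j" "j \<le> r" "b i = b j"
    then have r: "?i i \<in> {1..r}" "?i j \<in> {1..r}" using ir by auto
    have eqb: "b (?i i) = b (?i j)" using bi[of i] bi[of j] ij by auto
    have "?i j < ?i i"
    proof (rule ccontr)
      assume "\<not> ?i j < ?i i"
      moreover have "?i i \<noteq> ?i j" using ij fi by (metis less_irrefl)
      ultimately have "j < i" using wb_props(5)[of "?i i" "?i j"] r eqb fi by auto
      then show False using ij by simp
    qed
    then show "\<zeta> j < \<zeta> i" using y(3) r eqb by (auto simp: block_increasing_def \<zeta>_def)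
  qed
  have yw: "y \<otimes>\<^bsub>W\<^esub> inv\<^bsub>W\<^esub> wb \<in> carrier W" using y wb_props(1) by simp
  note c = canon_props[OF yw bz dec]
  have "beads y = beads (canon \<zeta>)"
    unfolding c(2) using permutes_inverses(2)[OF wb_props(3)] by (simp add: \<zeta>_def fun_eq_iff)
  then have "y = canon \<zeta>" by (rule left_min_unique[OF y(1,2) c(1,3)])
  then show ?thesis by (rule that[OF dec \<zeta>_def bz])
qed

end

section \<open>Dominance along chains of reflections\<close>

text \<open>Convexity of x |-> \<open>max (x - t) 0\<close>: with the sum fixed, moving a pair
  inwards cannot raise the total.\<close>

lemma inner_pair_excess:
  fixes p q p' q' t :: rat
  assumes "q \<le> p'" "p' \<le> p" "p' + q' = p + q"
  shows "max (p' - t) 0 + max (q' - t) 0 \<le> max (p - t) 0 + max (q - t) 0"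
  using assms by (auto simp: max_def)

text \<open>The loss is exactly 2 (p - p') (p' - q), which also shows when it is strict.\<close>

lemma inner_pair_squares:
  fixes p q p' q' :: rat
  assumes "p' + q' = p + q"
  shows "q \<le> p' \<Longrightarrow> p' \<le> p \<Longrightarrow> p'\<^sup>2 + q'\<^sup>2 \<le> p\<^sup>2 + q\<^sup>2"
    "q < p' \<Longrightarrow> p' < p \<Longrightarrow> p'\<^sup>2 + q'\<^sup>2 < p\<^sup>2 + q\<^sup>2"
proof -
  have q': "q' = p + q - p'" using assms by simp
  have *: "p\<^sup>2 + q\<^sup>2 - (p'\<^sup>2 + q'\<^sup>2) = 2 * ((p - p') * (p' - q))"
    unfolding q' by (simp add: power2_eq_square algebra_simps)
  show "p'\<^sup>2 + q'\<^sup>2 \<le> p\<^sup>2 + q\<^sup>2" if "q \<le> p'" "p' \<le> p"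
    using * mult_nonneg_nonneg[of "p - p'" "p' - q"] that by linarith
  show "p'\<^sup>2 + q'\<^sup>2 < p\<^sup>2 + q\<^sup>2" if "q < p'" "p' < p"
    using * mult_pos_pos[of "p - p'" "p' - q"] that by linarith
qed

lemma sum_two_updates:
  fixes g :: "nat \<Rightarrow> int \<Rightarrow> 'c :: ab_group_add"
  assumes "finite A" "i \<in> A" "j \<in> A" "i \<noteq> j"
  shows "(\<Sum>k\<in>A. g k ((\<xi>(i := x, j := y)) k)) - (\<Sum>k\<in>A. g k (\<xi> k)) =
    (g i x + g j y) - (g i (\<xi> i) + g j (\<xi> j))"
proof -
  have *: "(\<Sum>k\<in>A. f k) = f i + f j + (\<Sum>k\<in>A - {i} - {j}. f k)" for f :: "nat \<Rightarrow> 'c"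
    using assms by (subst sum.remove[of A i], simp, simp, subst sum.remove[of "A - {i}" j]) (auto simp: add.assoc)
  have "(\<Sum>k\<in>A - {i} - {j}. g k ((\<xi>(i := x, j := y)) k)) = (\<Sum>k\<in>A - {i} - {j}. g k (\<xi> k))"
    by (rule sum.cong) auto
  then show ?thesis using assms(4)
    unfolding *[of "\<lambda>k. g k ((\<xi>(i := x, j := y)) k)"] *[of "\<lambda>k. g k (\<xi> k)"] by simp
qed

locale weighted_wedge = wedge +
  fixes wt :: "int \<Rightarrow> rat"
  assumes wt_range: "\<And>k. k \<in> {1..r} \<Longrightarrow> 0 < wt (b k) \<and> wt (b k) < 1"
    and wt_less: "\<And>i j. i \<in> {1..r} \<Longrightarrow> j \<in> {1..r} \<Longrightarrow> b j < b i \<Longrightarrow> wt (b i) < wt (b j)"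
begin

definition val :: "nat \<Rightarrow> int \<Rightarrow> rat" where "val k x = of_int x - wt (b k)"

definition excess :: "rat \<Rightarrow> zseq \<Rightarrow> rat" where
  "excess t \<xi> = (\<Sum>k\<in>{1..r}. max (val k (\<xi> k) - t) 0)"

definition squares :: "zseq \<Rightarrow> rat" where
  "squares \<xi> = (\<Sum>k\<in>{1..r}. (val k (\<xi> k))\<^sup>2)"

text \<open>The last two clauses serve the way back to multipartitions: the total of the beads fixes
  the rank, and a lower bound keeps every bead above -N.\<close>

definition dom :: "zseq \<Rightarrow> zseq \<Rightarrow> bool" where
  "dom \<xi> \<eta> \<longleftrightarrow> (\<forall>t. excess t \<eta> \<le> excess t \<xi>) \<and> squares \<eta> \<le> squares \<xi> \<and>
     (\<Sum>k\<in>{1..r}. \<eta> k) = (\<Sum>k\<in>{1..r}. \<xi> k) \<and>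
     (\<forall>c. (\<forall>k\<in>{1..r}. c < \<xi> k) \<longrightarrow> (\<forall>k\<in>{1..r}. c < \<eta> k))"

lemma dom_trans: "dom \<xi> \<eta> \<Longrightarrow> dom \<eta> \<theta> \<Longrightarrow> dom \<xi> \<theta>"
  unfolding dom_def by (metis order_trans)

text \<open>The bead at i moves to place j and becomes \<open>?P'\<close>, the bead at j moves to
  place i and becomes \<open>?Q'\<close>. Since the sums agree, the inequalities Q \<le> P' \<le> P
  suffice; the first comes from the window order, the second from the weights. For strictness, left
  minimality excludes equal beads and increasing blocks exclude an exchange within one
  runner.\<close>

lemma bruhat_step_dom:
  assumes "bruhat_step e r w y"
  shows "dom (beads w) (beads y)"
    "left_min w \<Longrightarrow> block_increasing (beads w) \<Longrightarrow> squares (beads y) < squares (beads w)"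
proof -
  obtain i j m where w: "w \<in> carrier W" and pr: "pos_root r i j m" and m: "e = \<infinity> \<longrightarrow> m = 0"
    and gt: "win r w i > win r w j + int r * m" and y: "y = w \<otimes>\<^bsub>W\<^esub> affrefl i j m"
    using assms unfolding bruhat_step_def by blast
  have ij: "i \<in> {1..r}" "j \<in> {1..r}" "i \<noteq> j" and m0: "m \<ge> 0" and ijm: "i < j \<or> m > 0"
    using pr by (auto simp: pos_root_def)
  let ?x = "beads w"
  define E where "E = modulus e * m"
  have E0: "E \<ge> 0" unfolding E_def using modulus_ge m0 by simp
  have by': "beads y = ?x(i := ?x j + E, j := ?x i - E)"
    unfolding y act_mult E_def using act_refl[OF ij(3)] .
  note order = window_order_beads[OF w ij(1,2) m gt, folded E_def]
  have Epos: "E \<ge> 1" if "m > 0"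
  proof (cases rule: e_cases)
    case inf then show ?thesis using m that by (simp add: E_def)
  next
    case (fin k)
    then show ?thesis using that mult_mono[of 1 "int k" 1 m] by (simp add: E_def)
  qed
  let ?P = "val i (?x i)" and ?Q = "val j (?x j)" and ?P' = "val j (?x i - E)" and ?Q' = "val i (?x j + E)"
  have sum: "?P' + ?Q' = ?P + ?Q" by (simp add: val_def)
  have "(of_int (?x j + E) :: rat) \<le> of_int (?x i)" using order(1) by (simp only: of_int_le_iff)
  then have 1: "?Q \<le> ?P'" by (simp add: val_def)
  \<comment> \<open>For m = 0 the root has i < j, so place i belongs to the same or a higher runner
    number, whose weight is no larger. For m > 0 the shift E \<ge> 1 exceeds any difference of
    weights.\<close>
  have wts: "wt (b i) \<le> wt (b j)" if "m = 0"
    using that ijm b_dec[of i j] wt_less[OF ij(1,2)] ij by (cases "b i = b j") auto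
  have 2: "?P' \<le> ?P"
  proof (cases "m = 0")
    case True then show ?thesis using wts by (simp add: val_def E_def)
  next
    case False
    then have "(1 :: rat) \<le> of_int E" using m0 Epos by simp
    then show ?thesis using wt_range[OF ij(1)] wt_range[OF ij(2)] by (simp add: val_def)
  qed
  have upd: "(\<Sum>k\<in>{1..r}. g k (beads y k)) - (\<Sum>k\<in>{1..r}. g k (?x k)) =
      (g i (?x j + E) + g j (?x i - E)) - (g i (?x i) + g j (?x j))" for g :: "nat \<Rightarrow> int \<Rightarrow> 'c :: ab_group_add"
    unfolding by' using ij by (intro sum_two_updates) auto
  have "excess t (beads y) \<le> excess t ?x" for t
    using upd[of "\<lambda>k x. max (val k x - t) 0"] inner_pair_excess[OF 1 2 sum, of t]
    by (simp add: excess_def)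
  moreover have sq: "squares (beads y) - squares ?x = (?P'\<^sup>2 + ?Q'\<^sup>2) - (?P\<^sup>2 + ?Q\<^sup>2)"
    using upd[of "\<lambda>k x. (val k x)\<^sup>2"] by (simp add: squares_def)
  moreover have "squares (beads y) \<le> squares ?x"
    using sq inner_pair_squares(1)[OF sum 1 2] by simp
  moreover have "(\<Sum>k\<in>{1..r}. beads y k) = (\<Sum>k\<in>{1..r}. ?x k)"
    using upd[of "\<lambda>k x. x"] by simp
  moreover have "\<forall>k\<in>{1..r}. c < beads y k" if "\<forall>k\<in>{1..r}. c < ?x k" for c
  proof -
    have "c < ?x j + E" "c < ?x i - E" using bspec[OF that ij(2)] order(1) E0 by linarith+
    then show ?thesis using that unfolding by' by simp
  qed
  ultimately show "dom ?x (beads y)" by (simp add: dom_def)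
  show "squares (beads y) < squares ?x" if lm: "left_min w" and bi: "block_increasing ?x"
  proof -
    \<comment> \<open>Equal beads would lie in one constancy interval of a. There left minimality
      orders the places as j + r m < i, against positivity of the root.\<close>
    have "?x i \<noteq> ?x j + E"
    proof
      assume "?x i = ?x j + E"
      from order(2)[OF this] have s: "snd w i = m + snd w j" "fst w j < fst w i" "a (fst w i) = a (fst w j)"
        by blast+
      have "win r (inv\<^bsub>W\<^esub> w) (fst w j) + int (fst w i - fst w j) \<le> win r (inv\<^bsub>W\<^esub> w) (fst w i)"
        by (rule left_min_less[OF lm w])
          (use s(2,3) fst_carrier(1)[OF w ij(1)] fst_carrier(1)[OF w ij(2)] in simp_all)
      then have "int j - int r * snd w j < int i - int r * snd w i"
        unfolding win_inv[OF w ij(1)] win_inv[OF w ij(2)] using s(2) by linarith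
      then have "int j + int r * m < int i" unfolding s(1) by (simp add: algebra_simps)
      moreover have "i < j \<or> int r * m \<ge> int r" using ijm mult_left_mono[of 1 m "int r"] by auto
      moreover have "int r * m \<ge> 0" using m0 by simp
      ultimately show False using ij by auto
    qed
    then have "(of_int (?x j + E) :: rat) < of_int (?x i)" using order(1) by (simp only: of_int_less_iff)
    then have lt: "?Q < ?P'" by (simp add: val_def)
    have "?P' < ?P"
    proof (cases "m = 0")
      case True
      then have less: "i < j" using ijm by simp
      have "b i \<noteq> b j"
      proof
        assume "b i = b j"
        then have "?x i < ?x j" using bi less ij by (auto simp: block_increasing_def)
        then show False using order(1) E0 by simp
      qed
      then have "b j < b i" using b_dec[of i j] less ij by auto
      then show ?thesis using wt_less[OF ij(1,2)] True by (simp add: val_def E_def)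
    next
      case False
      then have "(1 :: rat) \<le> of_int E" using m0 Epos by simp
      then show ?thesis using wt_range[OF ij(1)] wt_range[OF ij(2)] by (simp add: val_def)
    qed
    then show ?thesis using sq inner_pair_squares(2)[OF sum lt] by simp
  qed
qed

text \<open>Only the first step starts from an element known to be left minimal with increasing
  blocks; it supplies strictness, and the later steps merely do not undo it.\<close>

lemma bruhat_below_dom:
  assumes "bruhat_below e r w y" "left_min w" "block_increasing (beads w)"
  shows "dom (beads w) (beads y) \<and> squares (beads y) < squares (beads w)"
  using assms(1)
proof (induction rule: tranclp_induct)
  case (base y)
  then show ?case using bruhat_step_dom[OF base] assms by blast
next
  case (step y z)
  have d: "dom (beads y) (beads z)" using bruhat_step_dom(1)[OF step(2)] .
  then have "squares (beads z) \<le> squares (beads y)" by (simp only: dom_def)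
  then show ?case using step.IH dom_trans[OF _ d] by (meson order_le_less_trans)
qed

lemma dom_permute:
  assumes "\<rho> permutes {1..r}" "\<And>k. k \<in> {1..r} \<Longrightarrow> b (\<rho> k) = b k"
  shows "dom \<xi> (\<xi> \<circ> \<rho>)" "squares (\<xi> \<circ> \<rho>) = squares \<xi>"
proof -
  have *: "(\<Sum>k\<in>{1..r}. g (b k) ((\<xi> \<circ> \<rho>) k)) = (\<Sum>k\<in>{1..r}. g (b k) (\<xi> k))"
    for g :: "int \<Rightarrow> int \<Rightarrow> 'c :: comm_monoid_add"
  proof -
    have "(\<Sum>k\<in>{1..r}. g (b k) (\<xi> k)) = (\<Sum>k\<in>{1..r}. g (b (\<rho> k)) (\<xi> (\<rho> k)))"
      using sum.permute[OF assms(1), of "\<lambda>k. g (b k) (\<xi> k)"] by (simp only: comp_def)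
    also have "\<dots> = (\<Sum>k\<in>{1..r}. g (b k) (\<xi> (\<rho> k)))"
      by (rule sum.cong[OF refl]) (simp only: assms(2))
    finally show ?thesis by (simp only: comp_def)
  qed
  show sq: "squares (\<xi> \<circ> \<rho>) = squares \<xi>"
    using *[of "\<lambda>c x. (of_int x - wt c)\<^sup>2"] by (simp add: squares_def val_def)
  have "excess t (\<xi> \<circ> \<rho>) = excess t \<xi>" for t
    using *[of "\<lambda>c x. max (of_int x - wt c - t) 0"] by (simp add: excess_def val_def)
  moreover have "(\<Sum>k\<in>{1..r}. (\<xi> \<circ> \<rho>) k) = (\<Sum>k\<in>{1..r}. \<xi> k)"
    using *[of "\<lambda>c x. x"] by simp
  moreover have "\<rho> k \<in> {1..r}" if "k \<in> {1..r}" for k using that permutes_in_image[OF assms(1)] by blast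
  ultimately show "dom \<xi> (\<xi> \<circ> \<rho>)" using sq by (auto simp: dom_def)
qed

text \<open>The chains start from block-reversed beads. Permutations within runners preserve every
  quantity in \<open>dom\<close>, so the comparison passes to the decreasing sequences and survives
  the straightening of each term.\<close>

theorem bar_canon:
  assumes w0: "w0 \<in> carrier W" "beads w0 = \<zeta>0" and dec: "block_decreasing \<zeta>0"
  defines "Z \<equiv> {\<zeta>. block_decreasing \<zeta> \<and> (\<exists>w\<in>carrier W. beads w = \<zeta>) \<and> dom \<zeta>0 \<zeta> \<and> squares \<zeta> < squares \<zeta>0}"
  shows "\<exists>h\<in>fs.span ((\<lambda>\<zeta>. T (canon \<zeta>)) ` Z).
    inv\<^bsub>H\<^esub> (T (inv\<^bsub>W\<^esub> (canon \<zeta>0))) - T (canon \<zeta>0) - h \<in> rel"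
proof -
  let ?w = "canon \<zeta>0" and ?S = "fs.span ((\<lambda>\<zeta>. T (canon \<zeta>)) ` Z)"
  note c = canon_props[OF w0 dec]
  have "inv\<^bsub>H\<^esub> (T (inv\<^bsub>W\<^esub> ?w)) - T ?w \<in> fs.span (T ` {y. bruhat_below e r ?w y})"
    using bar_T_triangular[OF c(1)] by blast
  then show ?thesis
  proof (induction rule: fs.span_induct_alt)
    case base
    show ?case using fs.subspace_0[OF subspace_rel] by (intro bexI[of _ 0]) (auto simp: fs.span_zero)
  next
    case (step k x h)
    then obtain y where y: "x = T y" "bruhat_below e r ?w y" by blast
    from step obtain g where g: "g \<in> ?S" "h - g \<in> rel" by blast
    note yc = bruhat_below_carrier(2)[OF y(2)]
    have dy: "dom (beads ?w) (beads y)" "squares (beads y) < squares (beads ?w)"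
      using bruhat_below_dom[OF y(2) c(3)] c(2,4) by auto
    have dw: "dom \<zeta>0 (beads ?w)" "squares (beads ?w) = squares \<zeta>0"
      using dom_permute[OF wb_props(3,4)] c(2) by auto
    consider "T y \<in> rel" | y' d \<rho> where "y' \<in> carrier W" "left_min y'" "block_increasing (beads y')"
      "\<rho> permutes {1..r}" "\<forall>k\<in>{1..r}. b (\<rho> k) = b k" "beads y' = beads y \<circ> \<rho>"
      "T y - scale d (T y') \<in> rel"
      using straighten[OF yc] by blast
    then show ?case
    proof cases
      case 1
      have "scale k (T y) + (h - g) \<in> rel"
        using 1 g(2) by (intro fs.subspace_add[OF subspace_rel] fs.subspace_scale[OF subspace_rel])
      then have "scale k x + h - g \<in> rel" using y(1) by (simp add: algebra_simps)
      then show ?thesis using g(1) by blast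
    next
      case (2 y' d \<rho>)
      obtain \<zeta> where z: "block_decreasing \<zeta>" "\<zeta> = beads y' \<circ> Hilbert_Choice.inv (fst wb)"
        "beads (y' \<otimes>\<^bsub>W\<^esub> inv\<^bsub>W\<^esub> wb) = \<zeta>" "y' = canon \<zeta>"
        using canon_eqI[OF 2(1-3)] .
      have ip: "Hilbert_Choice.inv (fst wb) permutes {1..r}" using wb_props(3) by (rule permutes_inv)
      have ib: "b (Hilbert_Choice.inv (fst wb) k) = b k" if "k \<in> {1..r}" for k
        using wb_props(4)[of "Hilbert_Choice.inv (fst wb) k"] permutes_in_image[OF ip, of k] that
          permutes_inverses(1)[OF wb_props(3)] by auto
      have "dom (beads y) (beads y')" "squares (beads y') = squares (beads y)"
        using dom_permute[OF 2(4), of "beads y"] 2(5,6) by auto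
      moreover have "dom (beads y') \<zeta>" "squares \<zeta> = squares (beads y')"
        using dom_permute[OF ip ib] z(2) by auto
      ultimately have "dom \<zeta>0 \<zeta>" "squares \<zeta> < squares \<zeta>0"
        using dy dw by (auto intro: dom_trans)
      moreover have "y' \<otimes>\<^bsub>W\<^esub> inv\<^bsub>W\<^esub> wb \<in> carrier W" using 2(1) wb_props(1) by simp
      ultimately have "\<zeta> \<in> Z" using z(1,3) by (auto simp: Z_def)
      then have "T y' \<in> ?S" unfolding z(4) by (intro fs.span_base) blast
      then have S: "scale k (scale d (T y')) + g \<in> ?S" using g(1) by (intro fs.span_add fs.span_scale)
      have "scale k (T y - scale d (T y')) + (h - g) \<in> rel"
        using 2(7) g(2) by (intro fs.subspace_add[OF subspace_rel] fs.subspace_scale[OF subspace_rel])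
      then have "scale k x + h - (scale k (scale d (T y')) + g) \<in> rel"
        using y(1) by (simp add: fs.scale_right_diff_distrib diff_add_eq add_diff_eq diff_diff_eq)
      then show ?thesis using S by blast
    qed
  qed
qed

end

section \<open>Bead sequences\<close>

text \<open>The common enumeration of (runner, part index) behind \<open>bead_seq\<close> and
  \<open>runner_seq\<close>; both are images of this list, so sums over places become double sums
  over runners and parts.\<close>

definition bead_index :: "nat \<Rightarrow> (nat \<Rightarrow> int) \<Rightarrow> nat \<Rightarrow> (nat \<times> nat) list" where
  "bead_index l s N = concat (map (\<lambda>d. map (Pair d) [1..<Suc (nat (s d + int N))]) (rev [1..<Suc l]))"

lemma bead_index_0 [simp]: "bead_index 0 s N = []"
  by (simp add: bead_index_def)

lemma bead_index_Suc:
  "bead_index (Suc l) s N = map (Pair (Suc l)) [1..<Suc (nat (s (Suc l) + int N))] @ bead_index l s N"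
  by (simp add: bead_index_def)

lemma set_bead_index: "set (bead_index l s N) = (SIGMA d:{1..l}. {1..nat (s d + int N)})"
  unfolding bead_index_def by (auto simp: image_iff simp del: upt_Suc)

lemma length_bead_index: "length (bead_index l s N) = num_beads l s N"
  by (induction l) (auto simp: bead_index_Suc num_beads_def)

lemma sorted_bead_index:
  "sorted_wrt (\<lambda>p q. fst q < fst p \<or> fst p = fst q \<and> snd p < snd q) (bead_index l s N)"
proof (induction l)
  case (Suc l)
  have "sorted_wrt (\<lambda>p q. fst q < fst p \<or> fst p = fst q \<and> snd p < snd q)
      (map (Pair (Suc l)) [1..<Suc (nat (s (Suc l) + int N))])"
    by (simp add: sorted_wrt_map strict_sorted_iff del: upt_Suc)
  then show ?case using Suc
    by (auto simp: bead_index_Suc sorted_wrt_append set_bead_index simp del: upt_Suc)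
qed simp

lemma bead_index_less:
  assumes "m < m'" "m' < num_beads l s N"
  defines "I \<equiv> bead_index l s N"
  shows "fst (I ! m') < fst (I ! m) \<or> fst (I ! m) = fst (I ! m') \<and> snd (I ! m) < snd (I ! m')"
  using sorted_wrt_nth_less[OF sorted_bead_index assms(1)] assms(2)
  by (simp add: I_def length_bead_index)

lemma distinct_bead_index: "distinct (bead_index l s N)"
  unfolding distinct_conv_nth length_bead_index
proof (intro allI impI)
  fix i j assume "i < num_beads l s N" "j < num_beads l s N" "i \<noteq> j"
  then show "bead_index l s N ! i \<noteq> bead_index l s N ! j"
    using bead_index_less[of i j l s N] bead_index_less[of j i l s N] by (cases "i < j") auto
qed

definition bead :: "(nat \<Rightarrow> int) \<Rightarrow> multipartition \<Rightarrow> nat \<times> nat \<Rightarrow> int" where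
  "bead s lam p = int (part lam (fst p) (snd p)) + s (fst p) + 1 - int (snd p)"

lemma bead_seq_alt: "bead_seq l s N lam = zseq_of_list (map (bead s lam) (bead_index l s N))"
  unfolding bead_seq_def bead_index_def map_concat by (simp add: comp_def bead_def)

lemma runner_seq_alt: "runner_seq l s N = zseq_of_list (map (\<lambda>p. int (fst p)) (bead_index l s N))"
proof -
  have "replicate n x = map (\<lambda>i. x) [1..<Suc n]" for n and x :: int
    by (simp add: map_replicate_const del: upt_Suc)
  then show ?thesis
    unfolding runner_seq_def bead_index_def map_concat by (simp add: comp_def del: upt_Suc)
qed

lemma bead_seq_nth: "m < num_beads l s N \<Longrightarrow> bead_seq l s N lam (Suc m) = bead s lam (bead_index l s N ! m)"
  by (simp add: bead_seq_alt zseq_of_list_def length_bead_index)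

lemma runner_seq_nth: "m < num_beads l s N \<Longrightarrow> runner_seq l s N (Suc m) = int (fst (bead_index l s N ! m))"
  by (simp add: runner_seq_alt zseq_of_list_def length_bead_index)

lemma sum_positions:
  fixes g :: "nat \<times> nat \<Rightarrow> 'c :: comm_monoid_add"
  shows "(\<Sum>k\<in>{1..num_beads l s N}. g (bead_index l s N ! (k - 1))) =
    (\<Sum>d\<in>{1..l}. \<Sum>i\<in>{1..nat (s d + int N)}. g (d, i))"
proof -
  let ?I = "bead_index l s N"
  have "(\<Sum>k\<in>{1..num_beads l s N}. g (?I ! (k - 1))) = (\<Sum>m<length ?I. g (?I ! m))"
    by (rule sum.reindex_bij_witness[where i = Suc and j = "\<lambda>k. k - 1"]) (auto simp: length_bead_index)
  also have "\<dots> = sum g (set ?I)"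
    by (simp add: sum.distinct_set_conv_list[OF distinct_bead_index] sum_list_sum_nth lessThan_atLeast0)
  also have "\<dots> = (\<Sum>d\<in>{1..l}. \<Sum>i\<in>{1..nat (s d + int N)}. g (d, i))"
    unfolding set_bead_index by (subst sum.Sigma) (auto intro: sum.cong)
  finally show ?thesis .
qed

lemma sum_bead_seq:
  fixes g :: "int \<Rightarrow> int \<Rightarrow> 'c :: comm_monoid_add"
  shows "(\<Sum>k\<in>{1..num_beads l s N}. g (runner_seq l s N k) (bead_seq l s N lam k)) =
    (\<Sum>d\<in>{1..l}. \<Sum>i\<in>{1..nat (s d + int N)}. g (int d) (int (part lam d i) + s d + 1 - int i))"
proof -
  have "(\<Sum>k\<in>{1..num_beads l s N}. g (runner_seq l s N k) (bead_seq l s N lam k)) =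
    (\<Sum>k\<in>{1..num_beads l s N}. (\<lambda>p. g (int (fst p)) (bead s lam p)) (bead_index l s N ! (k - 1)))"
  proof (rule sum.cong[OF refl])
    fix k assume "k \<in> {1..num_beads l s N}"
    then have "k - 1 < num_beads l s N" "Suc (k - 1) = k" by auto
    then show "g (runner_seq l s N k) (bead_seq l s N lam k) =
        (\<lambda>p. g (int (fst p)) (bead s lam p)) (bead_index l s N ! (k - 1))"
      using bead_seq_nth[of "k - 1" l s N lam] runner_seq_nth[of "k - 1" l s N] by simp
  qed
  then show ?thesis using sum_positions[of "\<lambda>p. g (int (fst p)) (bead s lam p)" l s N]
    by (simp add: bead_def)
qed

lemma runner_seq_dec:
  assumes "1 \<le> i" "i \<le> j" "j \<le> num_beads l s N"
  shows "runner_seq l s N j \<le> runner_seq l s N i"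
proof (cases "i = j")
  case False
  then have m: "i - 1 < j - 1" "i - 1 < num_beads l s N" "j - 1 < num_beads l s N"
    "Suc (i - 1) = i" "Suc (j - 1) = j" using assms by auto
  show ?thesis
    using bead_index_less[OF m(1,3)] runner_seq_nth[OF m(2)] runner_seq_nth[OF m(3)] m(4,5) by auto
qed simp

lemma runner_seq_range:
  assumes "k \<in> {1..num_beads l s N}"
  obtains d where "d \<in> {1..l}" "runner_seq l s N k = int d"
proof -
  have "k - 1 < length (bead_index l s N)" using assms by (auto simp: length_bead_index)
  then have "bead_index l s N ! (k - 1) \<in> set (bead_index l s N)" by (rule nth_mem)
  then show ?thesis
    using runner_seq_nth[of "k - 1" l s N] assms that[of "fst (bead_index l s N ! (k - 1))"]
    by (auto simp: set_bead_index)
qed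

section \<open>Multipartitions recovered from their beads\<close>

lemma multipartition_nth:
  assumes "lam \<in> multipartitions l" "d \<in> {1..l}"
  shows "sorted_wrt (\<ge>) (lam ! (d - 1))" "0 \<notin> set (lam ! (d - 1))"
  using assms nth_mem[of "d - 1" lam] by (auto simp: multipartitions_def)

lemma part_mono:
  assumes "lam \<in> multipartitions l" "d \<in> {1..l}" "1 \<le> i" "i \<le> j"
  shows "part lam d j \<le> part lam d i"
  using multipartition_nth(1)[OF assms(1,2)] assms(3,4)
  by (cases "i = j") (auto simp: part_def Let_def sorted_wrt_iff_nth_less)

lemma length_le_rank:
  assumes "lam \<in> multipartitions l" "d \<in> {1..l}"
  shows "length (lam ! (d - 1)) \<le> rank lam"
proof -
  let ?p = "lam ! (d - 1)"
  have l: "length xs \<le> sum_list xs" if "0 \<notin> set xs" for xs :: "nat list"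
    using that by (induction xs) auto
  have "?p \<in> set lam" using assms by (auto simp: multipartitions_def)
  then have "sum_list ?p \<le> rank lam" unfolding rank_def
    by (intro member_le_sum_list) auto
  then show ?thesis using l[OF multipartition_nth(2)[OF assms]] by simp
qed

lemma sum_parts:
  assumes "length (lam ! (d - 1)) \<le> c"
  shows "(\<Sum>i\<in>{1..c}. part lam d i) = sum_list (lam ! (d - 1))"
proof -
  let ?p = "lam ! (d - 1)"
  have "(\<Sum>i\<in>{1..c}. part lam d i) = (\<Sum>m<c. if m < length ?p then ?p ! m else 0)"
    by (rule sum.reindex_bij_witness[where i = Suc and j = "\<lambda>k. k - 1"]) (auto simp: part_def Let_def)
  also have "\<dots> = (\<Sum>m<length ?p. ?p ! m)"
    using assms by (intro sum.mono_neutral_cong_right) auto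
  finally show ?thesis by (simp add: sum_list_sum_nth atLeast0LessThan)
qed

lemma rank_alt: "length lam = l \<Longrightarrow> rank lam = (\<Sum>d\<in>{1..l}. sum_list (lam ! (d - 1)))"
  unfolding rank_def sum_list_sum_nth
  by (rule sum.reindex_bij_witness[where j = Suc and i = "\<lambda>k. k - 1"]) auto

text \<open>In a decreasing list the zeros stand at the end, so deleting them shifts no
  index.\<close>

lemma nth_filter_nonzero:
  fixes xs :: "nat list"
  assumes "sorted_wrt (\<ge>) xs" "i < length xs"
  shows "(let p = filter (\<lambda>x. x \<noteq> 0) xs in if i < length p then p ! i else 0) = xs ! i"
  using assms
proof (induction xs arbitrary: i)
  case (Cons x xs)
  show ?case
  proof (cases "x = 0")
    case True
    then have z: "y = 0" if "y \<in> set xs" for y using Cons.prems(1) that by auto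
    then have "filter (\<lambda>x. x \<noteq> 0) xs = []" by (auto simp: filter_empty_conv)
    moreover have "(x # xs) ! i = 0" using z Cons.prems(2) True by (cases i) auto
    ultimately show ?thesis using True by simp
  next
    case False
    show ?thesis
    proof (cases i)
      case 0 then show ?thesis using False by simp
    next
      case (Suc j)
      have "(let p = filter (\<lambda>x. x \<noteq> 0) xs in if j < length p then p ! j else 0) = xs ! j"
        using Cons.prems Suc by (intro Cons.IH) auto
      then show ?thesis using False Suc by (auto simp: Let_def split: if_splits)
    qed
  qed
qed simp

lemma bead_seq_outside: "k \<notin> {1..num_beads l s N} \<Longrightarrow> bead_seq l s N lam k = 0"
  by (auto simp: bead_seq_alt zseq_of_list_def length_bead_index)

lemma sum_bead_seq_rank:
  assumes "length lam = l" "\<And>d. d \<in> {1..l} \<Longrightarrow> length (lam ! (d - 1)) \<le> nat (s d + int N)"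
  shows "(\<Sum>k\<in>{1..num_beads l s N}. bead_seq l s N lam k) =
    int (rank lam) + (\<Sum>d\<in>{1..l}. \<Sum>i\<in>{1..nat (s d + int N)}. s d + 1 - int i)"
proof -
  have "(\<Sum>k\<in>{1..num_beads l s N}. bead_seq l s N lam k) =
    (\<Sum>d\<in>{1..l}. \<Sum>i\<in>{1..nat (s d + int N)}. int (part lam d i) + (s d + 1 - int i))"
    using sum_bead_seq[where g = "\<lambda>c x. x" and l = l and s = s and N = N and lam = lam]
    by (simp add: algebra_simps)
  also have "\<dots> = (\<Sum>d\<in>{1..l}. int (\<Sum>i\<in>{1..nat (s d + int N)}. part lam d i)) +
     (\<Sum>d\<in>{1..l}. \<Sum>i\<in>{1..nat (s d + int N)}. s d + 1 - int i)"
    by (simp add: sum.distrib)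
  also have "(\<Sum>d\<in>{1..l}. int (\<Sum>i\<in>{1..nat (s d + int N)}. part lam d i)) =
      (\<Sum>d\<in>{1..l}. int (sum_list (lam ! (d - 1))))"
    by (rule sum.cong) (simp_all only: sum_parts[OF assms(2)])
  also have "\<dots> = int (rank lam)" by (simp add: rank_alt[OF assms(1)])
  finally show ?thesis .
qed

text \<open>A runner with c strictly decreasing integers above -N lies entrywise above the beads of
  the empty partition; the excesses are decreasing and form the partition once its zeros are
  dropped.\<close>

lemma bead_seq_surj:
  assumes out: "\<And>k. k \<notin> {1..num_beads l s N} \<Longrightarrow> \<zeta> k = 0"
    and dec: "\<And>i j. 1 \<le> i \<Longrightarrow> i < j \<Longrightarrow> j \<le> num_beads l s N \<Longrightarrow>
      runner_seq l s N i = runner_seq l s N j \<Longrightarrow> \<zeta> j < \<zeta> i"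
    and low: "\<And>k. k \<in> {1..num_beads l s N} \<Longrightarrow> - int N < \<zeta> k"
  obtains \<mu> where "\<mu> \<in> multipartitions l" "bead_seq l s N \<mu> = \<zeta>"
    "\<And>d. d \<in> {1..l} \<Longrightarrow> length (\<mu> ! (d - 1)) \<le> nat (s d + int N)"
proof -
  let ?I = "bead_index l s N" and ?r = "num_beads l s N"
  define c where "c d = nat (s d + int N)" for d
  define pos where "pos p = (LEAST m. m < ?r \<and> ?I ! m = p)" for p
  have pos: "pos p < ?r \<and> ?I ! pos p = p" if p: "p \<in> set ?I" for p
  proof -
    obtain m where "m < ?r \<and> ?I ! m = p"
      using p unfolding in_set_conv_nth length_bead_index by blast
    then show ?thesis unfolding pos_def by (rule LeastI)
  qed
  have pos_nth: "pos (?I ! m) = m" if "m < ?r" for m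
    using pos[of "?I ! m"] that nth_eq_iff_index_eq[OF distinct_bead_index, of "pos (?I ! m)" l s N m]
    by (auto simp: length_bead_index)
  define z where "z d i = \<zeta> (Suc (pos (d, i)))" for d i
  have inI: "(d, i) \<in> set ?I \<longleftrightarrow> d \<in> {1..l} \<and> i \<in> {1..c d}" for d i by (auto simp: set_bead_index c_def)
  have zdec: "z d (Suc i) < z d i" if "d \<in> {1..l}" "1 \<le> i" "Suc i \<le> c d" for d i
  proof -
    have p: "pos (d, i) < ?r" "?I ! pos (d, i) = (d, i)" "pos (d, Suc i) < ?r" "?I ! pos (d, Suc i) = (d, Suc i)"
      using that pos[of "(d, i)"] pos[of "(d, Suc i)"] by (auto simp: inI)
    have "pos (d, i) \<noteq> pos (d, Suc i)" using p by auto
    moreover have "\<not> pos (d, Suc i) < pos (d, i)"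
      using bead_index_less[of "pos (d, Suc i)" "pos (d, i)" l s N] p by auto
    ultimately have "pos (d, i) < pos (d, Suc i)" by simp
    then show ?thesis unfolding z_def using p runner_seq_nth[OF p(1)] runner_seq_nth[OF p(3)]
      by (intro dec) auto
  qed
  \<comment> \<open>Below the i-th bead there are \<open>c d - i\<close> more, all above -N, and
    \<open>c d\<close> equals \<open>s d + int N\<close>.\<close>
  have zlow: "s d + 1 - int i \<le> z d i" if "d \<in> {1..l}" "i \<in> {1..c d}" for d i
  proof -
    have "- z d i + int (c d - i) \<le> - z d (c d)"
      by (rule strict_step_diff) (use zdec that in auto)
    moreover have "- int N < z d (c d)"
      unfolding z_def using pos[of "(d, c d)"] that by (intro low) (auto simp: inI)
    moreover have "int (c d) = s d + int N" using that by (auto simp: c_def)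
    ultimately show ?thesis using that by (auto simp: of_nat_diff)
  qed
  define q where "q d i = nat (z d i - s d - 1 + int i)" for d i
  have qz: "int (q d i) = z d i - s d - 1 + int i" if "d \<in> {1..l}" "i \<in> {1..c d}" for d i
    using zlow[OF that] by (simp add: q_def)
  have qdec: "q d (Suc i) \<le> q d i" if "d \<in> {1..l}" "1 \<le> i" "Suc i \<le> c d" for d i
    using zdec[OF that] by (simp add: q_def)
  define Q where "Q d = map (q d) [1..<Suc (c d)]" for d
  define \<mu> where "\<mu> = map (\<lambda>d. filter (\<lambda>x. x \<noteq> 0) (Q d)) [1..<Suc l]"
  have nth: "\<mu> ! (d - 1) = filter (\<lambda>x. x \<noteq> 0) (Q d)" if "d \<in> {1..l}" for d
    using that by (auto simp: \<mu>_def nth_map simp del: upt_Suc)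
  have sorted: "sorted_wrt (\<ge>) (Q d)" if "d \<in> {1..l}" for d
  proof -
    have "q d j \<le> q d i" if ij: "1 \<le> i" "i \<le> j" "j \<le> c d" for i j
      using ij(2,3)
    proof (induction j rule: dec_induct)
      case (step n) then show ?case using qdec[OF \<open>d \<in> {1..l}\<close>, of n] ij(1) by simp
    qed simp
    then show ?thesis unfolding Q_def
      by (auto simp: sorted_wrt_iff_nth_less simp del: upt_Suc)
  qed
  have "\<mu> \<in> multipartitions l"
    using sorted by (auto simp: multipartitions_def \<mu>_def sorted_wrt_filter simp del: upt_Suc)
  moreover have part: "part \<mu> d i = q d i" if "d \<in> {1..l}" "i \<in> {1..c d}" for d i
  proof -
    have "part \<mu> d i = Q d ! (i - 1)"
      unfolding part_def nth[OF that(1)] using that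
      by (intro nth_filter_nonzero[OF sorted]) (auto simp: Q_def)
    then show ?thesis using that by (auto simp: Q_def simp del: upt_Suc)
  qed
  have "bead_seq l s N \<mu> k = \<zeta> k" for k
  proof (cases "k \<in> {1..?r}")
    case True
    define m where "m = k - 1"
    have m: "m < ?r" "k = Suc m" using True by (auto simp: m_def)
    obtain d i where di: "?I ! m = (d, i)" by fastforce
    have mem: "(d, i) \<in> set ?I" using m di nth_mem[of m ?I] by (simp add: length_bead_index)
    have "\<zeta> k = z d i" using pos_nth[OF m(1)] m di by (simp add: z_def)
    then show ?thesis
      using bead_seq_nth[OF m(1), of \<mu>] m(2) di mem part[of d i] qz[of d i] by (simp add: bead_def inI)
  next
    case False then show ?thesis using out bead_seq_outside by simp
  qed
  moreover have "length (\<mu> ! (d - 1)) \<le> nat (s d + int N)" if "d \<in> {1..l}" for d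
  proof -
    have "length (Q d) = nat (s d + int N)" by (simp add: Q_def c_def)
    then show ?thesis unfolding nth[OF that] using length_filter_le[of "\<lambda>x. x \<noteq> 0" "Q d"] by simp
  qed
  ultimately show ?thesis using that by blast
qed

lemma bead_seq_decreasing:
  assumes "lam \<in> multipartitions l" "1 \<le> i" "i < j" "j \<le> num_beads l s N"
    "runner_seq l s N i = runner_seq l s N j"
  shows "bead_seq l s N lam j < bead_seq l s N lam i"
proof -
  let ?I = "bead_index l s N"
  have m: "i - 1 < num_beads l s N" "j - 1 < num_beads l s N" "Suc (i - 1) = i" "Suc (j - 1) = j"
    using assms by auto
  obtain d p d' q where dp: "?I ! (i - 1) = (d, p)" "?I ! (j - 1) = (d', q)" by fastforce
  have "d = d'" using assms(5) runner_seq_nth[OF m(1)] runner_seq_nth[OF m(2)] dp m by simp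
  then have "p < q" using bead_index_less[of "i - 1" "j - 1" l s N] assms dp by auto
  have "(d, p) \<in> set ?I" using dp nth_mem[of "i - 1" ?I] m by (simp add: length_bead_index)
  then have "d \<in> {1..l}" "1 \<le> p" by (auto simp: set_bead_index)
  then have "part lam d q \<le> part lam d p" using part_mono[OF assms(1)] \<open>p < q\<close> by simp
  then show ?thesis
    using bead_seq_nth[OF m(1)] bead_seq_nth[OF m(2)] dp m \<open>d = d'\<close> \<open>p < q\<close> by (simp add: bead_def)
qed

lemma bead_seq_lower:
  assumes "k \<in> {1..num_beads l s N}"
  shows "- int N < bead_seq l s N lam k"
proof -
  let ?I = "bead_index l s N"
  have m: "k - 1 < num_beads l s N" "Suc (k - 1) = k" using assms by auto
  obtain d p where dp: "?I ! (k - 1) = (d, p)" by fastforce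
  have "(d, p) \<in> set ?I" using dp nth_mem[of "k - 1" ?I] m by (simp add: length_bead_index)
  then have "int p \<le> s d + int N" by (auto simp: set_bead_index)
  then show ?thesis using bead_seq_nth[OF m(1)] dp m(2) by (simp add: bead_def)
qed

section \<open>The dominance order\<close>

definition content_sum ::
  "nat \<Rightarrow> (nat \<Rightarrow> int) \<Rightarrow> (nat \<Rightarrow> rat) \<Rightarrow> int \<Rightarrow> (rat \<Rightarrow> rat) \<Rightarrow> multipartition \<Rightarrow> rat" where
  "content_sum l s \<alpha> K g lam =
    (\<Sum>d\<in>{1..l}. \<Sum>j\<in>{1..nat (K + s d)}. g (of_nat (part lam d j) - of_nat j + of_int (s d) - \<alpha> d))"

definition admissible :: "nat \<Rightarrow> (nat \<Rightarrow> int) \<Rightarrow> nat \<Rightarrow> int \<Rightarrow> bool" where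
  "admissible l s n K \<longleftrightarrow> K \<ge> int n \<and> (\<forall>i\<in>{1..l}. K + s i \<ge> int n)"

text \<open>A weighted bead exceeds the corresponding entry of \<open>gamma\<close> by 1, which
  accounts for \<open>x + 1\<close> in the square; in the first clause the threshold absorbs the
  shift.\<close>

definition dom_at :: "nat \<Rightarrow> (nat \<Rightarrow> int) \<Rightarrow> (nat \<Rightarrow> rat) \<Rightarrow> int \<Rightarrow> multipartition \<Rightarrow> multipartition \<Rightarrow> bool" where
  "dom_at l s \<alpha> K lam \<mu> \<longleftrightarrow>
    (\<forall>t. content_sum l s \<alpha> K (\<lambda>x. max (x - t) 0) \<mu> \<le> content_sum l s \<alpha> K (\<lambda>x. max (x - t) 0) lam) \<and>
    content_sum l s \<alpha> K (\<lambda>x. (x + 1)\<^sup>2) \<mu> < content_sum l s \<alpha> K (\<lambda>x. (x + 1)\<^sup>2) lam"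

text \<open>
  Top-\<open>m\<close> sums of a multiset are governed by its threshold functions \<open>\<Sum>max (x - t) 0\<close>; the sum of
  squares makes the order strict.
\<close>

definition mp_above :: "nat \<Rightarrow> (nat \<Rightarrow> int) \<Rightarrow> (nat \<Rightarrow> rat) \<Rightarrow> multipartition \<Rightarrow> multipartition \<Rightarrow> bool" where
  "mp_above l s \<alpha> lam \<mu> \<longleftrightarrow> rank lam = rank \<mu> \<and> (\<forall>K. admissible l s (rank lam) K \<longrightarrow> dom_at l s \<alpha> K lam \<mu>)"

text \<open>Without an admissible K the comparison over all such K would be vacuous; existence is
  what makes the order irreflexive.\<close>

lemma admissible_exists: "\<exists>N0. \<forall>K\<ge>N0. admissible l s n K"
proof (intro exI allI impI)
  fix K assume K: "K \<ge> int n + (\<Sum>d\<in>{1..l}. \<bar>s d\<bar>)"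
  have "\<bar>s i\<bar> \<le> (\<Sum>d\<in>{1..l}. \<bar>s d\<bar>)" if "i \<in> {1..l}" for i
    using that by (intro member_le_sum) auto
  then have "K + s i \<ge> int n" if "i \<in> {1..l}" for i using K that by force
  moreover have "(\<Sum>d\<in>{1..l}. \<bar>s d\<bar>) \<ge> 0" by (rule sum_nonneg) simp
  then have "K \<ge> int n" using K by linarith
  ultimately show "admissible l s n K" unfolding admissible_def by blast
qed

lemma dom_at_trans: "dom_at l s \<alpha> K x y \<Longrightarrow> dom_at l s \<alpha> K y z \<Longrightarrow> dom_at l s \<alpha> K x z"
  unfolding dom_at_def by (blast intro: order_trans less_trans)

lemma mp_above_trans: "mp_above l s \<alpha> x y \<Longrightarrow> mp_above l s \<alpha> y z \<Longrightarrow> mp_above l s \<alpha> x z"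
  unfolding mp_above_def using dom_at_trans by metis

lemma mp_above_irrefl: "\<not> mp_above l s \<alpha> x x"
  using admissible_exists[of l s "rank x"] by (auto simp: mp_above_def dom_at_def)

section \<open>From threshold functions to dominance of sorted sequences\<close>

lemma sum_list_gamma:
  "sum_list (map g (gamma l s \<alpha> K lam)) = content_sum l s \<alpha> K g lam"
proof -
  let ?xs = "concat (map (\<lambda>i. map (\<lambda>j. of_nat (part lam i j) - of_nat j + of_int (s i) - \<alpha> i)
                  [1..<Suc (nat (K + s i))]) [1..<Suc l])"
  have mset: "sum_list (map g xs) = sum_list (map g ys)" if "mset xs = mset ys" for xs ys
    unfolding sum_mset_sum_list[symmetric] mset_map that by (rule refl)
  have "sum_list (map g (gamma l s \<alpha> K lam)) = sum_list (map g ?xs)"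
    by (rule mset) (simp add: gamma_def del: upt_Suc)
  also have "\<dots> = content_sum l s \<alpha> K g lam"
  proof -
    have "sum_list (map g (concat (map f xs))) = (\<Sum>x\<leftarrow>xs. sum_list (map g (f x)))"
      for f :: "nat \<Rightarrow> rat list" and xs by (induction xs) auto
    then show ?thesis unfolding content_sum_def
      by (simp add: comp_def interv_sum_list_conv_sum_set_nat atLeastLessThanSuc_atLeastAtMost
        del: upt_Suc)
  qed
  finally show ?thesis .
qed

lemma length_gamma: "length (gamma l s \<alpha> K lam) = (\<Sum>d\<in>{1..l}. nat (K + s d))"
  by (simp add: gamma_def length_concat comp_def interv_sum_list_conv_sum_set_nat atLeastLessThanSuc_atLeastAtMost
      del: upt_Suc)

lemma sorted_gamma: "sorted_wrt (\<ge>) (gamma l s \<alpha> K lam)"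
  by (simp add: gamma_def sorted_wrt_rev)

text \<open>Take t to be the m-th entry of the sorted list u. Then the first m entries of u sum to
  exactly m t plus the total excess over t, while the first m entries of any list sum to at most m t
  plus its own excess.\<close>

lemma top_sums:
  fixes u w :: "rat list"
  assumes len: "length u = length w" and u: "sorted_wrt (\<ge>) u" and m: "1 \<le> m" "m \<le> length u"
    and le: "\<And>t. sum_list (map (\<lambda>x. max (x - t) 0) w) \<le> sum_list (map (\<lambda>x. max (x - t) 0) u)"
  shows "sum_list (take m w) \<le> sum_list (take m u)"
proof -
  define t where "t = u ! (m - 1)"
  have split: "sum_list (map f xs) = (\<Sum>k<m. f (xs ! k)) + (\<Sum>k\<in>{m..<length xs}. f (xs ! k))"
    if "m \<le> length xs" for f :: "rat \<Rightarrow> rat" and xs :: "rat list"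
    using that by (simp add: sum_list_sum_nth sum.atLeastLessThan_concat lessThan_atLeast0)
  have tk: "sum_list (take m xs) = of_nat m * t + (\<Sum>k<m. xs ! k - t)" if "m \<le> length xs" for xs :: "rat list"
    using that by (simp add: sum_list_sum_nth sum_subtractf lessThan_atLeast0 min_def)
  have u1: "t \<le> u ! k" if "k < m" for k
    using that m u by (cases "k = m - 1") (auto simp: t_def sorted_wrt_iff_nth_less)
  have u2: "u ! k \<le> t" if "m \<le> k" "k < length u" for k
    using that m u by (auto simp: t_def sorted_wrt_iff_nth_less)
  have "(\<Sum>k<m. w ! k - t) \<le> (\<Sum>k<m. max (w ! k - t) 0)" by (rule sum_mono) simp
  also have "\<dots> \<le> sum_list (map (\<lambda>x. max (x - t) 0) w)"
    using m len by (subst split) (auto intro: sum_nonneg)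
  also have "\<dots> \<le> sum_list (map (\<lambda>x. max (x - t) 0) u)" by (rule le)
  also have "\<dots> = (\<Sum>k<m. max (u ! k - t) 0) + (\<Sum>k\<in>{m..<length u}. max (u ! k - t) 0)"
    using m by (intro split)
  also have "(\<Sum>k<m. max (u ! k - t) 0) = (\<Sum>k<m. u ! k - t)"
    using u1 by (intro sum.cong) auto
  also have "(\<Sum>k\<in>{m..<length u}. max (u ! k - t) 0) = 0"
    using u2 by (intro sum.neutral) auto
  finally show ?thesis using m len by (simp add: tk)
qed

lemma mp_above_imp_greater:
  assumes "mp_above l s \<alpha> lam \<mu>"
  shows "mp_greater l s \<alpha> lam \<mu>"
  unfolding mp_greater_def
proof (intro conjI allI impI)
  show "rank lam = rank \<mu>" using assms by (simp add: mp_above_def)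
  fix K assume "int (rank lam) \<le> K \<and> (\<forall>i\<in>{1..l}. int (rank lam) \<le> K + s i)"
  then have d: "dom_at l s \<alpha> K lam \<mu>" using assms by (simp add: mp_above_def admissible_def)
  show "gamma l s \<alpha> K lam \<rhd> gamma l s \<alpha> K \<mu>"
    unfolding dominates_def
  proof (intro conjI ballI)
    show len: "length (gamma l s \<alpha> K lam) = length (gamma l s \<alpha> K \<mu>)" by (simp add: length_gamma)
    show "gamma l s \<alpha> K lam \<noteq> gamma l s \<alpha> K \<mu>"
      using d by (auto simp: dom_at_def simp flip: sum_list_gamma)
    fix m assume "m \<in> {1..length (gamma l s \<alpha> K lam)}"
    then show "sum_list (take m (gamma l s \<alpha> K \<mu>)) \<le> sum_list (take m (gamma l s \<alpha> K lam))"
      using d by (intro top_sums[OF len sorted_gamma]) (auto simp: dom_at_def sum_list_gamma)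
  qed
qed

text \<open>Beyond an admissible K all parts are zero, so the additional terms coincide on both
  sides and cancel. This transports the comparison from a large N to any admissible K below
  it.\<close>

lemma content_sum_extend:
  assumes lam: "lam \<in> multipartitions l" and mu: "\<mu> \<in> multipartitions l"
    and K: "admissible l s (rank lam) K" "rank \<mu> = rank lam" "K \<le> K'"
  shows "content_sum l s \<alpha> K' g lam - content_sum l s \<alpha> K' g \<mu> =
    content_sum l s \<alpha> K g lam - content_sum l s \<alpha> K g \<mu>"
proof -
  let ?f = "\<lambda>lam d j. g (of_nat (part lam d j) - of_nat j + of_int (s d) - \<alpha> d)"
  have "(\<Sum>j\<in>{1..nat (K' + s d)}. ?f lam d j - ?f \<mu> d j) = (\<Sum>j\<in>{1..nat (K + s d)}. ?f lam d j - ?f \<mu> d j)"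
    if d: "d \<in> {1..l}" for d
  proof (rule sum.mono_neutral_right)
    show "\<forall>j\<in>{1..nat (K' + s d)} - {1..nat (K + s d)}. ?f lam d j - ?f \<mu> d j = 0"
    proof
      fix j assume "j \<in> {1..nat (K' + s d)} - {1..nat (K + s d)}"
      then have "j > nat (K + s d)" by auto
      moreover have "int (rank lam) \<le> K + s d" using K(1) d by (simp add: admissible_def)
      ultimately have "j > rank lam" by linarith
      then have "part lam d j = 0" "part \<mu> d j = 0"
        using length_le_rank[OF lam d] length_le_rank[OF mu d] K(2) by (auto simp: part_def Let_def)
      then show "?f lam d j - ?f \<mu> d j = 0" by simp
    qed
  qed (use K(3) in auto)
  then show ?thesis by (simp add: content_sum_def flip: sum_subtractf)
qed

lemma dom_at_restrict:
  assumes "lam \<in> multipartitions l" "\<mu> \<in> multipartitions l"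
    "admissible l s (rank lam) K" "rank \<mu> = rank lam" "K \<le> K'" "dom_at l s \<alpha> K' lam \<mu>"
  shows "dom_at l s \<alpha> K lam \<mu>"
proof -
  have *: "content_sum l s \<alpha> K g \<mu> \<le> content_sum l s \<alpha> K g lam \<longleftrightarrow>
      content_sum l s \<alpha> K' g \<mu> \<le> content_sum l s \<alpha> K' g lam"
    "content_sum l s \<alpha> K g \<mu> < content_sum l s \<alpha> K g lam \<longleftrightarrow>
      content_sum l s \<alpha> K' g \<mu> < content_sum l s \<alpha> K' g lam" for g
    using content_sum_extend[OF assms(1-5), of \<alpha> g] by linarith+
  show ?thesis using assms(6) unfolding dom_at_def * .
qed

section \<open>The ring of integral scalars\<close>

lemma map_poly_of_int:
  fixes p q :: "int poly"
  shows "map_poly (of_int :: int \<Rightarrow> rat) (p + q) = map_poly of_int p + map_poly of_int q"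
    "map_poly (of_int :: int \<Rightarrow> rat) (p * q) = map_poly of_int p * map_poly of_int q"
    "map_poly (of_int :: int \<Rightarrow> rat) (- p) = - map_poly of_int p"
  by (auto intro!: poly_eqI simp: coeff_map_poly coeff_mult)

lemma Zv_closed:
  "0 \<in> Zv" "1 \<in> Zv" "x \<in> Zv \<Longrightarrow> y \<in> Zv \<Longrightarrow> x + y \<in> Zv" "x \<in> Zv \<Longrightarrow> y \<in> Zv \<Longrightarrow> x * y \<in> Zv"
  "x \<in> Zv \<Longrightarrow> - x \<in> Zv" "vq \<in> Zv"
proof -
  let ?f = "\<lambda>p :: int poly. to_fract (map_poly rat_of_int p)"
  have "?f 0 = 0" "?f 1 = 1" by (simp_all add: map_poly_1')
  then show "0 \<in> Zv" "1 \<in> Zv"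
    unfolding Zv_def using rangeI[of ?f 0] rangeI[of ?f 1] by simp_all
  have f: "?f p + ?f q = ?f (p + q)" "?f p * ?f q = ?f (p * q)" "- ?f p = ?f (- p)" for p q
    by (simp_all add: map_poly_of_int)
  show "x + y \<in> Zv" if xy: "x \<in> Zv" "y \<in> Zv"
  proof -
    obtain p q where "x = ?f p" "y = ?f q" using xy unfolding Zv_def by blast
    then have "x + y = ?f (p + q)" by (simp only: f)
    then show ?thesis unfolding Zv_def by (rule range_eqI)
  qed
  show "x * y \<in> Zv" if xy: "x \<in> Zv" "y \<in> Zv"
  proof -
    obtain p q where "x = ?f p" "y = ?f q" using xy unfolding Zv_def by blast
    then have "x * y = ?f (p * q)" by (simp only: f)
    then show ?thesis unfolding Zv_def by (rule range_eqI)
  qed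
  show "- x \<in> Zv" if xy: "x \<in> Zv"
  proof -
    obtain p where "x = ?f p" using xy unfolding Zv_def by blast
    then have "- x = ?f (- p)" by (simp only: f)
    then show ?thesis unfolding Zv_def by (rule range_eqI)
  qed
  have "vq = ?f [:0, 1:]" by (simp add: vq_def map_poly_pCons)
  then show "vq \<in> Zv" unfolding Zv_def by blast
qed

lemma eval_inv_one: "eval_inv 1 = 1"
proof -
  have "to_fract [:1 :: rat:] = 1" by (simp flip: one_pCons)
  then show ?thesis by (simp add: eval_inv_def map_poly_1')
qed

lemma bar_scalar_to_fract: "bar_scalar (to_fract p) = eval_inv p"
  by (simp add: bar_scalar_def eval_inv_one)

lemma bar_scalar_one [simp]: "bar_scalar 1 = 1"
  using bar_scalar_to_fract[of 1] by (simp add: eval_inv_one)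

lemma to_fract_sum: "to_fract (\<Sum>i\<in>A. f i) = (\<Sum>i\<in>A. to_fract (f i))"
  by (induction A rule: infinite_finite_induct) auto

lemma to_fract_power: "to_fract (x ^ n) = to_fract x ^ n"
  by (induction n) auto

text \<open>Let q be nonzero of degree n. Invariance gives v^n q(v) = v^n q(1/v), where the left
  side has degree 2n and the right side, the polynomial \<open>R\<close>, at most n. Hence q is
  constant, but its constant term is 0.\<close>

lemma bar_fixed_zero:
  assumes x: "x \<in> (*) vq ` Zv" and bar: "bar_scalar x = x"
  shows "x = 0"
proof -
  obtain p :: "int poly" where "x = vq * to_fract (map_poly of_int p)"
    using x by (auto simp: Zv_def)
  then obtain q :: "rat poly" where q: "x = to_fract q" "coeff q 0 = 0"
    using that by (auto simp: vq_def simp flip: to_fract_mult)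
  define n where "n = degree q"
  define R where "R = (\<Sum>i\<le>n. [:coeff q i:] * [:0, 1:] ^ (n - i))"
  have "to_fract q = (\<Sum>i\<le>n. to_fract [:coeff q i:] * inverse vq ^ i)"
    using bar unfolding q bar_scalar_to_fract eval_inv_def
    by (simp add: poly_altdef degree_map_poly coeff_map_poly n_def)
  then have "vq ^ n * to_fract q = (\<Sum>i\<le>n. to_fract [:coeff q i:] * (vq ^ n * inverse vq ^ i))"
    by (simp add: sum_distrib_left mult_ac)
  also have "\<dots> = (\<Sum>i\<le>n. to_fract [:coeff q i:] * vq ^ (n - i))"
    by (intro sum.cong refl) (simp add: power_diff power_inverse divide_inverse)
  also have "\<dots> = to_fract R"
    unfolding R_def to_fract_sum to_fract_mult to_fract_power vq_def ..
  finally have "to_fract ([:0, 1:] ^ n * q) = to_fract R"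
    by (simp add: to_fract_power vq_def)
  then have eq: "[:0, 1:] ^ n * q = R" by (simp only: to_fract_eq_iff)
  have "degree R \<le> n" unfolding R_def
    by (intro degree_sum_le) (auto intro!: order_trans[OF degree_mult_le] simp: degree_power_eq)
  moreover have "degree ([:0, 1:] ^ n * q) = n + n" if "q \<noteq> 0"
    using that by (simp add: degree_mult_eq degree_power_eq n_def)
  ultimately have "q \<noteq> 0 \<Longrightarrow> n = 0" using eq by simp
  then have "q = 0" using q(2) by (metis n_def degree_eq_zeroE coeff_pCons_0 pCons_0_0)
  then show ?thesis using q by simp
qed

section \<open>Triangularity of the bar-involution on Fock space\<close>

lemma sorted_permutation_eq:
  fixes f :: "nat \<Rightarrow> int"
  assumes "mono_on {1..r} f" "mono_on {1..r} (f \<circ> \<rho>)" "\<rho> permutes {1..r}" "k \<in> {1..r}"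
  shows "f (\<rho> k) = f k"
proof -
  have sorted: "sorted (map g [1..<Suc r])" if "mono_on {1..r} g" for g :: "nat \<Rightarrow> int"
    using that by (auto simp: sorted_map mono_on_def sorted_wrt_iff_nth_less simp del: upt_Suc)
  have "image_mset \<rho> (mset_set {1..r}) = mset_set {1..r}"
    using assms(3) by (simp add: image_mset_mset_set permutes_image permutes_inj_on)
  then have "mset (map (f \<circ> \<rho>) [1..<Suc r]) = mset (map f [1..<Suc r])"
    by (simp add: atLeastLessThanSuc_atLeastAtMost del: upt_Suc flip: multiset.map_comp)
  then have "map (f \<circ> \<rho>) [1..<Suc r] = map f [1..<Suc r]"
    using sorted[OF assms(1)] sorted[OF assms(2)] by (metis properties_for_sort)
  then have "\<forall>x\<in>set [1..<Suc r]. (f \<circ> \<rho>) x = f x" unfolding map_eq_conv .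
  then show ?thesis using assms(4) by (simp del: upt_Suc)
qed

text \<open>An element taking a to a' has no effective translation, by uniqueness of residues modulo
  \<open>e\<close>, and two increasing rearrangements of one sequence are equal.\<close>

lemma alcove_unique:
  assumes "e \<noteq> 0" "a \<in> alcove e r" "a' \<in> alcove e r" "w \<in> carrier (weyl e r)" "w' \<in> carrier (weyl e r)"
    and eq: "act e a w = act e a' w'"
  shows "a = a'"
proof -
  interpret group "weyl e r" by (rule weyl_group)
  define u where "u = w \<otimes>\<^bsub>weyl e r\<^esub> inv\<^bsub>weyl e r\<^esub> w'"
  have u: "u \<in> carrier (weyl e r)" using assms by (simp add: u_def)
  have "act e a u = act e (act e a' w') (inv\<^bsub>weyl e r\<^esub> w')" unfolding u_def act_mult eq ..
  also have "\<dots> = act e a' (w' \<otimes>\<^bsub>weyl e r\<^esub> inv\<^bsub>weyl e r\<^esub> w')" by (simp only: act_mult)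
  also have "\<dots> = a'" using assms(5) by simp
  finally have ua: "act e a u = a'" .
  have val: "a (fst u p) = a' p" if p: "p \<in> {1..r}" for p
  proof (cases e)
    case (enat k)
    have "a (fst u p) + int k * snd u p = a' p" using fun_cong[OF ua, of p] enat by (simp add: act_def)
    then show ?thesis
      using residue_unique[of "a (fst u p)" k "a' p" "snd u p" 0] assms(2,3) enat p fst_carrier(1)[OF u p]
      by (auto simp: alcove_def)
  next
    case infinity
    then show ?thesis using fun_cong[OF ua, of p] by (simp add: act_def)
  qed
  have perm: "fst u permutes {1..r}" using u by (simp add: weyl_carrier)
  have m: "mono_on {1..r} a" "mono_on {1..r} a'" using assms(2,3) by (auto simp: alcove_def)
  have "mono_on {1..r} (a \<circ> fst u)" using m(2) val by (auto simp: mono_on_def)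
  then have "a p = a' p" if "p \<in> {1..r}" for p
    using sorted_permutation_eq[OF m(1) _ perm that] val[OF that] by simp
  moreover have "a p = a' p" if "p \<notin> {1..r}" for p using that assms(2,3) by (simp add: alcove_def)
  ultimately show ?thesis by blast
qed

section \<open>Fock space by rank and its linear passage to wedges\<close>

lemma fock_space_rank_closed:
  "f \<in> fock_space_of_rank l n \<Longrightarrow> g \<in> fock_space_of_rank l n \<Longrightarrow> f + g \<in> fock_space_of_rank l n"
  "f \<in> fock_space_of_rank l n \<Longrightarrow> g \<in> fock_space_of_rank l n \<Longrightarrow> f - g \<in> fock_space_of_rank l n"
  "f \<in> fock_space_of_rank l n \<Longrightarrow> scale c f \<in> fock_space_of_rank l n"
  "0 \<in> fock_space_of_rank l n"
  unfolding fock_space_of_rank_def using Poly_Mapping.keys_add[of f g] keys_diff[of f g]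
  by (auto simp: in_keys_iff)

lemma fock_space_closed:
  "f \<in> fock_space l \<Longrightarrow> g \<in> fock_space l \<Longrightarrow> f + g \<in> fock_space l"
  "f \<in> fock_space l \<Longrightarrow> g \<in> fock_space l \<Longrightarrow> f - g \<in> fock_space l"
  "f \<in> fock_space l \<Longrightarrow> scale c f \<in> fock_space l"
  "0 \<in> fock_space l"
  "lam \<in> multipartitions l \<Longrightarrow> ket lam \<in> fock_space l"
  unfolding fock_space_def using Poly_Mapping.keys_add[of f g] keys_diff[of f g]
  by (auto simp: in_keys_iff)

definition wedge_ket :: "enat \<Rightarrow> nat \<Rightarrow> (nat \<Rightarrow> int) \<Rightarrow> nat \<Rightarrow> zseq \<Rightarrow> multipartition \<Rightarrow> hecke" where
  "wedge_ket e l s N a lam =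
     (let r = num_beads l s N; W = weyl e r; wb = block_longest e r (runner_seq l s N) in
      if \<exists>w \<in> carrier W. act e a w = bead_seq l s N lam
      then T (min_rep e r a (bead_seq l s N lam) \<otimes>\<^bsub>W\<^esub> wb) else 0)"

lemma wedge_component_sum:
  assumes "finite A" "Poly_Mapping.keys f \<subseteq> A"
  shows "wedge_component e l s N a f = (\<Sum>lam\<in>A. scale (Poly_Mapping.lookup f lam) (wedge_ket e l s N a lam))"
proof -
  have "wedge_component e l s N a f =
      (\<Sum>lam\<in>Poly_Mapping.keys f. scale (Poly_Mapping.lookup f lam) (wedge_ket e l s N a lam))"
    unfolding wedge_component_def Let_def
    by (rule sum.mono_neutral_cong_left) (auto simp: wedge_ket_def Let_def)
  also have "\<dots> = (\<Sum>lam\<in>A. scale (Poly_Mapping.lookup f lam) (wedge_ket e l s N a lam))"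
    using assms by (intro sum.mono_neutral_left) (auto simp: in_keys_iff)
  finally show ?thesis .
qed

lemma wedge_component_linear:
  "wedge_component e l s N a (f + g) = wedge_component e l s N a f + wedge_component e l s N a g"
  "wedge_component e l s N a (f - g) = wedge_component e l s N a f - wedge_component e l s N a g"
  "wedge_component e l s N a (scale c f) = scale c (wedge_component e l s N a f)"
  "wedge_component e l s N a (ket lam) = wedge_ket e l s N a lam"
  "wedge_component e l s N a 0 = 0"
proof -
  let ?A = "Poly_Mapping.keys f \<union> Poly_Mapping.keys g"
  have fin: "finite ?A" by simp
  note * = wedge_component_sum[OF fin]
  show "wedge_component e l s N a (f + g) = wedge_component e l s N a f + wedge_component e l s N a g"
    using Poly_Mapping.keys_add[of f g]
    by (simp add: * lookup_add fs.scale_left_distrib sum.distrib)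
  show "wedge_component e l s N a (f - g) = wedge_component e l s N a f - wedge_component e l s N a g"
    using keys_diff[of f g]
    by (simp add: * lookup_minus fs.scale_left_diff_distrib sum_subtractf)
  have "Poly_Mapping.keys (scale c f) \<subseteq> ?A" by (auto simp: in_keys_iff)
  then show "wedge_component e l s N a (scale c f) = scale c (wedge_component e l s N a f)"
    by (simp add: * fs.scale_sum_right)
  show "wedge_component e l s N a (ket lam) = wedge_ket e l s N a lam"
    by (subst wedge_component_sum[of "{lam}"]) auto
  show "wedge_component e l s N a 0 = 0" by (simp add: wedge_component_def)
qed

text \<open>The finite-level clause of \<open>is_bar_involution\<close> for one rank and one N, with
  the Hecke algebra made explicit so that it can be chosen once.\<close>

definition wedge_model ::
  "enat \<Rightarrow> nat \<Rightarrow> (nat \<Rightarrow> int) \<Rightarrow> (fock \<Rightarrow> fock) \<Rightarrow> nat \<Rightarrow> nat \<Rightarrow> hecke ring \<Rightarrow> bool" where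
  "wedge_model e l s \<beta> n N H \<longleftrightarrow>
     hecke_algebra e (num_beads l s N) H \<and>
     (\<forall>f \<in> fock_space_of_rank l n.
        (\<forall>a \<in> alcove e (num_beads l s N). wedge_component e l s N a f
          \<in> wedge_relations e (num_beads l s N) H a (runner_seq l s N)) \<longrightarrow> f = 0) \<and>
     (\<forall>f \<in> fock_space_of_rank l n.
        \<beta> f \<in> fock_space_of_rank l n \<and>
        (\<forall>a \<in> alcove e (num_beads l s N).
           wedge_component e l s N a (\<beta> f) -
             hecke_bar e (num_beads l s N) H (wedge_component e l s N a f)
           \<in> wedge_relations e (num_beads l s N) H a (runner_seq l s N)))"

lemma wedge_model_exists:
  assumes "is_bar_involution e l s \<beta>"
  shows "\<exists>N0. \<forall>N\<ge>N0. (\<forall>k. e = enat k \<longrightarrow> k dvd N) \<longrightarrow> (\<exists>H. wedge_model e l s \<beta> n N H)"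
  using assms unfolding is_bar_involution_def wedge_model_def Let_def by (elim conjE) (erule spec)

text \<open>The vector \<open>ket lam\<close> lives in the single component a whose orbit contains
  its beads. The straightened bar expansion there is lifted to a Fock vector g supported on smaller
  multipartitions; \<open>\<beta> (ket lam) - ket lam - g\<close> then vanishes in every component
  and so is zero.\<close>

lemma bar_ket_dom_at:
  assumes bar: "is_bar_involution e l s \<beta>" and e0: "e \<noteq> 0" and l: "l \<ge> 1"
    and \<alpha>: "\<forall>i \<in> {1..l}. 0 < \<alpha> i \<and> \<alpha> i < 1" "\<forall>i \<in> {1..l}. \<forall>j \<in> {1..l}. i < j \<longrightarrow> \<alpha> j < \<alpha> i"
    and lam: "lam \<in> multipartitions l" and K: "admissible l s (rank lam) K"
    and \<mu>: "Poly_Mapping.lookup (\<beta> (ket lam) - ket lam) \<mu> \<noteq> 0"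
  shows "\<mu> \<in> multipartitions_of_rank l (rank lam) \<and> dom_at l s \<alpha> K lam \<mu>"
proof -
  define n where "n = rank lam"
  obtain N0 where N0: "\<forall>N\<ge>N0. (\<forall>k. e = enat k \<longrightarrow> k dvd N) \<longrightarrow> (\<exists>H. wedge_model e l s \<beta> n N H)"
    using wedge_model_exists[OF bar] by blast
  \<comment> \<open>The surplus 2 guarantees at least two beads, as the description of the
    generators by affine roots requires.\<close>
  obtain N1 where N1: "\<forall>K\<ge>N1. admissible l s (n + 2) K" using admissible_exists by blast
  define k where "k = (case e of enat k \<Rightarrow> k | \<infinity> \<Rightarrow> 1)"
  have k1: "k \<ge> 1" using e0 by (auto simp: k_def zero_enat_def split: enat.splits)
  \<comment> \<open>A multiple of \<open>e\<close>, or of 1 in the infinite case, that passes all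
    three bounds at once because k \<ge> 1.\<close>
  define N where "N = k * (N0 + nat \<bar>N1\<bar> + nat \<bar>K\<bar>)"
  have "N \<ge> 1 * (N0 + nat \<bar>N1\<bar> + nat \<bar>K\<bar>)" unfolding N_def using k1 by (rule mult_le_mono1)
  then have "N \<ge> N0 + nat \<bar>N1\<bar> + nat \<bar>K\<bar>" by simp
  then have N: "N \<ge> N0" "int N \<ge> N1" "int N \<ge> K" by auto
  have dvd: "\<forall>k. e = enat k \<longrightarrow> k dvd N" by (auto simp: N_def k_def)
  have adm2: "admissible l s (n + 2) (int N)" using N1 N by blast
  then have cnt: "int n + 2 \<le> s d + int N" if "d \<in> {1..l}" for d
    using that by (simp add: admissible_def add.commute)
  have admN: "admissible l s n (int N)" using adm2 by (force simp: admissible_def)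
  define r where "r = num_beads l s N"
  define b where "b = runner_seq l s N"
  obtain H where model: "wedge_model e l s \<beta> n N H" using N0 N(1) dvd by blast
  have H: "hecke_algebra e r H" using model by (simp add: wedge_model_def r_def)
  have inj: "f = 0" if "f \<in> fock_space_of_rank l n"
    "\<And>a. a \<in> alcove e r \<Longrightarrow> wedge_component e l s N a f \<in> wedge_relations e r H a b" for f
    using model that unfolding wedge_model_def r_def b_def by blast
  have \<beta>: "\<beta> f \<in> fock_space_of_rank l n" if "f \<in> fock_space_of_rank l n" for f
    using model that unfolding wedge_model_def by blast
  have \<beta>bar: "wedge_component e l s N a (\<beta> f) - hecke_bar e r H (wedge_component e l s N a f)
      \<in> wedge_relations e r H a b" if "f \<in> fock_space_of_rank l n" "a \<in> alcove e r" for f a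
    using model that unfolding wedge_model_def r_def b_def by blast
  have r2: "2 \<le> r"
  proof -
    have "2 \<le> nat (s 1 + int N)" using cnt[of 1] l by simp
    also have "\<dots> \<le> (\<Sum>d\<in>{1..l}. nat (s d + int N))" using l by (intro member_le_sum) auto
    finally show ?thesis by (simp add: r_def num_beads_def)
  qed
  define wt where "wt = (\<lambda>x. \<alpha> (nat x))"
  have loc: "weighted_wedge e r H a b wt" if "a \<in> alcove e r" for a
  proof
    show "2 \<le> r" "hecke_algebra e r H" "a \<in> alcove e r" "e \<noteq> 0" by fact+
    show "b j \<le> b i" if "1 \<le> i" "i \<le> j" "j \<le> r" for i j
      using runner_seq_dec that unfolding b_def r_def by blast
    fix i assume i: "i \<in> {1..r}"
    obtain d where d: "d \<in> {1..l}" "b i = int d" using runner_seq_range i unfolding b_def r_def by blast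
    then show "0 < wt (b i) \<and> wt (b i) < 1" using \<alpha>(1) by (simp add: wt_def)
    fix j assume j: "j \<in> {1..r}" "b j < b i"
    obtain d' where d': "d' \<in> {1..l}" "b j = int d'" using runner_seq_range j unfolding b_def r_def by blast
    then show "wt (b i) < wt (b j)" using \<alpha>(2) d j by (simp add: wt_def)
  qed
  define \<zeta>0 where "\<zeta>0 = bead_seq l s N lam"
  have lamn: "lam \<in> multipartitions_of_rank l n" using lam by (simp add: multipartitions_of_rank_def n_def)
  then have ketn: "ket lam \<in> fock_space_of_rank l n" by (simp add: fock_space_of_rank_def)
  \<comment> \<open>Beads outside every alcove orbit would give \<open>ket lam\<close> zero
    components everywhere, against injectivity.\<close>
  have "\<exists>a\<in>alcove e r. \<exists>w\<in>carrier (weyl e r). act e a w = \<zeta>0"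
  proof (rule ccontr)
    assume no: "\<not> ?thesis"
    have "ket lam = 0"
    proof (rule inj[OF ketn])
      fix a assume a: "a \<in> alcove e r"
      interpret weighted_wedge e r H a b wt using loc[OF a] .
      have "wedge_component e l s N a (ket lam) = 0"
        using no a by (auto simp: wedge_component_linear wedge_ket_def Let_def \<zeta>0_def r_def)
      then show "wedge_component e l s N a (ket lam) \<in> rel" using fs.subspace_0[OF subspace_rel] by simp
    qed
    then have "Poly_Mapping.lookup (ket lam) lam = 0" by simp
    then show False by simp
  qed
  then obtain a w0 where a: "a \<in> alcove e r" and w0: "w0 \<in> carrier (weyl e r)" "act e a w0 = \<zeta>0" by blast
  interpret weighted_wedge e r H a b wt using loc[OF a] .
  have dec0: "block_decreasing \<zeta>0"
    unfolding block_decreasing_def unfolding \<zeta>0_def b_def r_def using bead_seq_decreasing[OF lam] by blast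
  define Z where "Z = {\<zeta>. block_decreasing \<zeta> \<and> (\<exists>w\<in>carrier W. beads w = \<zeta>) \<and> dom \<zeta>0 \<zeta> \<and> squares \<zeta> < squares \<zeta>0}"
  define M where "M = {\<mu> \<in> multipartitions_of_rank l n. dom_at l s \<alpha> (int N) lam \<mu> \<and> (\<exists>w\<in>carrier W. beads w = bead_seq l s N \<mu>)}"
  have content: "(\<Sum>k\<in>{1..r}. g (val k (bead_seq l s N x k))) = content_sum l s \<alpha> (int N) (\<lambda>y. g (y + 1)) x"
    for g :: "rat \<Rightarrow> rat" and x
  proof -
    have "(\<Sum>k\<in>{1..r}. g (val k (bead_seq l s N x k))) =
       (\<Sum>k\<in>{1..r}. (\<lambda>c z. g (of_int z - wt c)) (b k) (bead_seq l s N x k))"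
      by (simp add: val_def)
    also have "\<dots> = (\<Sum>d\<in>{1..l}. \<Sum>i\<in>{1..nat (s d + int N)}.
        g (of_int (int (part x d i) + s d + 1 - int i) - wt (int d)))"
      unfolding b_def r_def by (rule sum_bead_seq)
    also have "\<dots> = content_sum l s \<alpha> (int N) (\<lambda>y. g (y + 1)) x"
      unfolding content_sum_def by (simp add: wt_def algebra_simps)
    finally show ?thesis .
  qed
  \<comment> \<open>Beads exceed the entries of \<open>gamma\<close> by 1, so the threshold becomes
    t - 1.\<close>
  have ex: "excess t (bead_seq l s N x) = content_sum l s \<alpha> (int N) (\<lambda>y. max (y - (t - 1)) 0) x" for t x
    unfolding excess_def content[of "\<lambda>y. max (y - t) 0"] by (simp add: algebra_simps)
  have sq: "squares (bead_seq l s N x) = content_sum l s \<alpha> (int N) (\<lambda>y. (y + 1)\<^sup>2) x" for x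
    unfolding squares_def content[of "\<lambda>y. y\<^sup>2"] ..
  \<comment> \<open>The total and the lower bound kept in \<open>dom\<close>, together with
    decreasing blocks, lead from sequences back to multipartitions of the same rank.\<close>
  have ZM: "\<exists>\<mu>\<in>M. bead_seq l s N \<mu> = \<zeta>" if z: "\<zeta> \<in> Z" for \<zeta>
  proof -
    obtain w where w: "w \<in> carrier W" "beads w = \<zeta>" using z by (auto simp: Z_def)
    have d: "dom \<zeta>0 \<zeta>" "block_decreasing \<zeta>" "squares \<zeta> < squares \<zeta>0" using z by (auto simp: Z_def)
    have out: "\<zeta> k = 0" if "k \<notin> {1..num_beads l s N}" for k
    proof -
      have "fst w k = k" "snd w k = 0" "a k = 0"
        using w(1) a that unfolding r_def[symmetric]
        by (auto simp: weyl_carrier alcove_def permutes_not_in simp del: atLeastAtMost_iff)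
      then show ?thesis unfolding w(2)[symmetric] by (simp add: act_alt)
    qed
    have low: "- int N < \<zeta> k" if "k \<in> {1..num_beads l s N}" for k
      using d(1) that bead_seq_lower unfolding dom_def unfolding \<zeta>0_def r_def by blast
    have dec: "\<zeta> j < \<zeta> i" if "1 \<le> i" "i < j" "j \<le> num_beads l s N"
        "runner_seq l s N i = runner_seq l s N j" for i j
      using d(2) that unfolding block_decreasing_def unfolding r_def b_def by blast
    obtain \<mu> where \<mu>: "\<mu> \<in> multipartitions l" "bead_seq l s N \<mu> = \<zeta>"
      "\<And>d. d \<in> {1..l} \<Longrightarrow> length (\<mu> ! (d - 1)) \<le> nat (s d + int N)"
      by (rule bead_seq_surj[OF out dec low]) blast+
    have "(\<Sum>k\<in>{1..num_beads l s N}. bead_seq l s N lam k) = (\<Sum>k\<in>{1..num_beads l s N}. bead_seq l s N \<mu> k)"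
      using d(1) unfolding dom_def unfolding \<mu>(2) \<zeta>0_def r_def by simp
    moreover have "length (lam ! (d - 1)) \<le> nat (s d + int N)" if "d \<in> {1..l}" for d
      using length_le_rank[OF lam that] cnt[OF that] by (simp add: n_def)
    ultimately have "rank lam = rank \<mu>"
      using sum_bead_seq_rank[of lam l s N] sum_bead_seq_rank[of \<mu> l s N] \<mu>(1,3) lam
      by (simp add: multipartitions_def)
    moreover have "dom_at l s \<alpha> (int N) lam \<mu>"
      unfolding dom_at_def
    proof (intro conjI allI)
      fix t
      have "excess (t + 1) \<zeta> \<le> excess (t + 1) \<zeta>0" using d(1) by (simp add: dom_def)
      then show "content_sum l s \<alpha> (int N) (\<lambda>x. max (x - t) 0) \<mu> \<le> content_sum l s \<alpha> (int N) (\<lambda>x. max (x - t) 0) lam"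
        unfolding \<zeta>0_def \<mu>(2)[symmetric] ex by simp
      show "content_sum l s \<alpha> (int N) (\<lambda>x. (x + 1)\<^sup>2) \<mu> < content_sum l s \<alpha> (int N) (\<lambda>x. (x + 1)\<^sup>2) lam"
        using d(3) unfolding \<zeta>0_def \<mu>(2)[symmetric] sq .
    qed
    ultimately have "\<mu> \<in> M" using \<mu>(1,2) w by (auto simp: M_def multipartitions_of_rank_def n_def)
    then show ?thesis using \<mu>(2) by blast
  qed
  have wedge_ket: "wedge_ket e l s N a x = T (canon (bead_seq l s N x))"
    if "\<exists>w\<in>carrier W. beads w = bead_seq l s N x" for x
    using that unfolding canon_def
    by (simp add: wedge_ket_def Let_def flip: r_def b_def)
  obtain h where h: "h \<in> fs.span ((\<lambda>\<zeta>. T (canon \<zeta>)) ` Z)"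
    "inv\<^bsub>H\<^esub> (T (inv\<^bsub>W\<^esub> (canon \<zeta>0))) - T (canon \<zeta>0) - h \<in> rel"
    using bar_canon[OF w0 dec0] unfolding Z_def by blast
  have "\<exists>g. Poly_Mapping.keys g \<subseteq> M \<and> wedge_component e l s N a g = h"
    using h(1)
  proof (induction rule: fs.span_induct_alt)
    case base show ?case by (rule exI[of _ 0]) (simp add: wedge_component_linear)
  next
    case (step c x y)
    obtain \<zeta> where z: "\<zeta> \<in> Z" "x = T (canon \<zeta>)" using step(1) by blast
    obtain \<nu> where \<nu>: "\<nu> \<in> M" "bead_seq l s N \<nu> = \<zeta>" using ZM[OF z(1)] by blast
    obtain g where g: "Poly_Mapping.keys g \<subseteq> M" "wedge_component e l s N a g = y" using step(2) by blast
    have "x = wedge_ket e l s N a \<nu>" using wedge_ket[of \<nu>] \<nu> z(2) by (auto simp: M_def)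
    then have "wedge_component e l s N a (scale c (ket \<nu>) + g) = scale c x + y"
      using g(2) by (simp add: wedge_component_linear)
    moreover have "Poly_Mapping.keys (scale c (ket \<nu>) + g) \<subseteq> M"
      using Poly_Mapping.keys_add[of "scale c (ket \<nu>)" g] g(1) \<nu>(1)
      by (auto simp: in_keys_iff lookup_add lookup_single when_def split: if_splits)
    ultimately show ?case by blast
  qed
  then obtain g where g: "Poly_Mapping.keys g \<subseteq> M" "wedge_component e l s N a g = h" by blast
  have gn: "g \<in> fock_space_of_rank l n" using g(1) by (auto simp: fock_space_of_rank_def M_def)
  define f where "f = \<beta> (ket lam) - ket lam - g"
  have "f = 0"
  proof (rule inj)
    show "f \<in> fock_space_of_rank l n"
      unfolding f_def by (intro fock_space_rank_closed \<beta> ketn gn)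
    fix a' assume a': "a' \<in> alcove e r"
    show "wedge_component e l s N a' f \<in> wedge_relations e r H a' b"
    proof (cases "a' = a")
      case True
      have orb: "\<exists>w\<in>carrier W. beads w = bead_seq l s N lam" using w0 by (auto simp: \<zeta>0_def)
      have wk: "wedge_component e l s N a (ket lam) = T (canon \<zeta>0)"
        using wedge_ket[OF orb] by (simp add: wedge_component_linear \<zeta>0_def)
      have hb: "hecke_bar e r H (T (canon \<zeta>0)) = inv\<^bsub>H\<^esub> (T (inv\<^bsub>W\<^esub> (canon \<zeta>0)))"
        by (simp add: hecke_bar_def)
      have "(wedge_component e l s N a (\<beta> (ket lam)) - inv\<^bsub>H\<^esub> (T (inv\<^bsub>W\<^esub> (canon \<zeta>0)))) +
          (inv\<^bsub>H\<^esub> (T (inv\<^bsub>W\<^esub> (canon \<zeta>0))) - T (canon \<zeta>0) - h) \<in> rel"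
        using \<beta>bar[OF ketn a] h(2) unfolding wk hb by (intro fs.subspace_add[OF subspace_rel])
      then show ?thesis unfolding True f_def wedge_component_linear(2) wk g(2)
        by (simp only: add_diff_eq diff_add_cancel)
    next
      case False
      interpret a': weighted_wedge e r H a' b wt using loc[OF a'] .
      \<comment> \<open>Orbits of different alcove points are disjoint, so \<open>ket lam\<close>
        and g have zero component at a', and the bar of 0 is 0.\<close>
      have no: "\<not> (\<exists>w\<in>carrier W. act e a' w = bead_seq l s N x)"
        if "\<exists>w\<in>carrier W. beads w = bead_seq l s N x" for x
        using that alcove_unique[OF e0 a' a] False by metis
      have wk: "wedge_ket e l s N a' x = 0" if "\<exists>w\<in>carrier W. beads w = bead_seq l s N x" for x
        using no[OF that] by (simp add: wedge_ket_def r_def)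
      have "wedge_component e l s N a' g = 0"
        unfolding wedge_component_sum[OF finite_keys order_refl]
        using g(1) wk by (intro sum.neutral) (auto simp: M_def)
      moreover have "wedge_component e l s N a' (ket lam) = 0"
        using wk[of lam] w0 by (auto simp: wedge_component_linear \<zeta>0_def)
      ultimately show ?thesis
        using \<beta>bar[OF ketn a'] by (simp add: f_def wedge_component_linear(2) hecke_bar_def)
    qed
  qed
  then have "\<beta> (ket lam) - ket lam = g" by (simp add: f_def)
  then have "\<mu> \<in> M" using \<mu> g(1) by (auto simp: in_keys_iff)
  then have m: "\<mu> \<in> multipartitions l" "rank \<mu> = rank lam" "dom_at l s \<alpha> (int N) lam \<mu>"
    by (auto simp: M_def multipartitions_of_rank_def n_def)
  then show ?thesis
    using dom_at_restrict[OF lam m(1) K m(2) N(3) m(3)] by (simp add: multipartitions_of_rank_def)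
qed

section \<open>Bar-invariant vectors are unitriangular\<close>

locale bar_setup =
  fixes e :: enat and l :: nat and s :: "nat \<Rightarrow> int" and \<alpha> :: "nat \<Rightarrow> rat" and \<beta> :: "fock \<Rightarrow> fock"
  assumes bar: "is_bar_involution e l s \<beta>" and e0: "e \<noteq> 0" and l: "l \<ge> 1"
    and \<alpha>: "\<forall>i \<in> {1..l}. 0 < \<alpha> i \<and> \<alpha> i < 1" "\<forall>i \<in> {1..l}. \<forall>j \<in> {1..l}. i < j \<longrightarrow> \<alpha> j < \<alpha> i"
begin

lemma bar_add: "f \<in> fock_space l \<Longrightarrow> g \<in> fock_space l \<Longrightarrow> \<beta> (f + g) = \<beta> f + \<beta> g"
  and bar_scale: "f \<in> fock_space l \<Longrightarrow> \<beta> (scale c f) = scale (bar_scalar c) (\<beta> f)"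
  using bar unfolding is_bar_involution_def by blast+

lemma bar_zero: "\<beta> 0 = 0"
  using bar_add[of 0 0] fock_space_closed(4) by simp

lemma bar_sum:
  assumes "finite A" "A \<subseteq> multipartitions l"
  shows "(\<Sum>\<mu>\<in>A. scale (c \<mu>) (ket \<mu>)) \<in> fock_space l \<and>
    \<beta> (\<Sum>\<mu>\<in>A. scale (c \<mu>) (ket \<mu>)) = (\<Sum>\<mu>\<in>A. scale (bar_scalar (c \<mu>)) (\<beta> (ket \<mu>)))"
  using assms
proof (induction A rule: finite_induct)
  case empty
  show ?case by (simp add: bar_zero fock_space_closed(4))
next
  case (insert x A)
  then show ?case by (auto simp: bar_add bar_scale fock_space_closed)
qed

text \<open>Dominance is obtained for each admissible K separately, while membership and rank are
  taken from one such K, which has to exist.\<close>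

lemma bar_ket_triangular:
  assumes "lam \<in> multipartitions l" "Poly_Mapping.lookup (\<beta> (ket lam) - ket lam) \<mu> \<noteq> 0"
  shows "\<mu> \<in> multipartitions l \<and> mp_above l s \<alpha> lam \<mu>"
proof -
  have *: "\<mu> \<in> multipartitions_of_rank l (rank lam) \<and> dom_at l s \<alpha> K lam \<mu>"
    if "admissible l s (rank lam) K" for K
    using bar_ket_dom_at[OF bar e0 l \<alpha> assms(1) that assms(2)] .
  obtain K where "admissible l s (rank lam) K" using admissible_exists by blast
  then show ?thesis using * by (auto simp: mp_above_def multipartitions_of_rank_def)
qed

text \<open>
  At a maximal element of the support of \<open>g - ket lam\<close> not below \<open>lam\<close>, the coefficient is
  fixed by the bar-involution although it lies in \<open>v\<int>[v]\<close>.
\<close>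

lemma bar_fixed_triangular:
  assumes lam: "lam \<in> multipartitions l" and fix_g: "\<beta> g = g"
    and g: "g - ket lam \<in> scale vq ` fock_lattice l"
    and \<mu>: "Poly_Mapping.lookup (g - ket lam) \<mu> \<noteq> 0"
  shows "\<mu> \<in> multipartitions l \<and> mp_above l s \<alpha> lam \<mu> \<and> Poly_Mapping.lookup (g - ket lam) \<mu> \<in> (*) vq ` Zv"
proof -
  define D where "D = g - ket lam"
  let ?c = "Poly_Mapping.lookup D"
  let ?A = "Poly_Mapping.keys D"
  obtain D' where D': "D = scale vq D'" "D' \<in> fock_lattice l" using g unfolding D_def by blast
  have coef: "?c \<nu> \<in> (*) vq ` Zv" for \<nu> using D' by (auto simp: fock_lattice_def)
  have "D \<in> fock_space l" using D' fock_space_closed(3) by (auto simp: fock_lattice_def)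
  then have A: "finite ?A" "?A \<subseteq> multipartitions l" by (auto simp: fock_space_def)
  have D: "D = (\<Sum>\<nu>\<in>?A. scale (?c \<nu>) (ket \<nu>))" by (rule poly_mapping_expand) auto
  have "g = ket lam + D" by (simp add: D_def)
  then have "\<beta> g = \<beta> (ket lam) + \<beta> D"
    using bar_add fock_space_closed(5)[OF lam] \<open>D \<in> fock_space l\<close> by simp
  also have "\<beta> D = (\<Sum>\<nu>\<in>?A. scale (bar_scalar (?c \<nu>)) (\<beta> (ket \<nu>)))"
    using bar_sum[OF A, of ?c] D by simp
  finally have eq: "ket lam + D = \<beta> (ket lam) + (\<Sum>\<nu>\<in>?A. scale (bar_scalar (?c \<nu>)) (\<beta> (ket \<nu>)))"
    using fix_g \<open>g = ket lam + D\<close> by simp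
  have off: "Poly_Mapping.lookup (\<beta> (ket \<nu>)) \<kappa> = Poly_Mapping.lookup (ket \<nu>) \<kappa>"
    if "\<nu> \<in> multipartitions l" "\<not> mp_above l s \<alpha> \<nu> \<kappa>" for \<nu> \<kappa>
    using bar_ket_triangular[OF that(1), of \<kappa>] that(2) by (auto simp: lookup_minus)
  define S where "S = {\<nu> \<in> ?A. \<not> mp_above l s \<alpha> lam \<nu>}"
  have "S = {}"
  proof (rule ccontr)
    assume "S \<noteq> {}"
    moreover have "finite S" by (simp add: S_def)
    moreover have "asymp_on S (mp_above l s \<alpha>)"
      using mp_above_trans mp_above_irrefl by (intro asymp_onI) blast
    moreover have "transp_on S (mp_above l s \<alpha>)" using mp_above_trans by (intro transp_onI) blast
    \<comment> \<open>A minimal element for the relation \<open>mp_above\<close> has nothing of S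
      above it, so it is maximal in the order on multipartitions.\<close>
    ultimately obtain \<kappa> where \<kappa>: "\<kappa> \<in> S" "\<forall>\<nu>\<in>S. \<nu> \<noteq> \<kappa> \<longrightarrow> \<not> mp_above l s \<alpha> \<nu> \<kappa>"
      using Finite_Set.bex_min_element[of S "mp_above l s \<alpha>"] by blast
    have kA: "\<kappa> \<in> ?A" "\<not> mp_above l s \<alpha> lam \<kappa>" using \<kappa>(1) by (auto simp: S_def)
    have no: "\<not> mp_above l s \<alpha> \<nu> \<kappa>" if "\<nu> \<in> ?A" for \<nu>
    proof
      assume ab: "mp_above l s \<alpha> \<nu> \<kappa>"
      then have "\<nu> \<noteq> \<kappa>" using mp_above_irrefl by blast
      then have "mp_above l s \<alpha> lam \<nu>" using \<kappa>(2) that ab by (auto simp: S_def)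
      then show False using mp_above_trans[OF _ ab] kA(2) by blast
    qed
    have "Poly_Mapping.lookup (\<Sum>\<nu>\<in>?A. scale (bar_scalar (?c \<nu>)) (\<beta> (ket \<nu>))) \<kappa> =
        (\<Sum>\<nu>\<in>?A. bar_scalar (?c \<nu>) * Poly_Mapping.lookup (ket \<nu>) \<kappa>)"
      unfolding lookup_sum lookup_scale using off no A(2) by (intro sum.cong) auto
    also have "\<dots> = (\<Sum>\<nu>\<in>?A. if \<nu> = \<kappa> then bar_scalar (?c \<nu>) else 0)"
      by (intro sum.cong) (auto simp: lookup_single when_def)
    also have "\<dots> = bar_scalar (?c \<kappa>)" using kA(1) by simp
    finally have "bar_scalar (?c \<kappa>) = ?c \<kappa>"
      using arg_cong[OF eq, of "\<lambda>f. Poly_Mapping.lookup f \<kappa>"] off[OF lam kA(2)] by (simp add: lookup_add)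
    then have "?c \<kappa> = 0" by (rule bar_fixed_zero[OF coef])
    then show False using kA(1) by (simp add: in_keys_iff)
  qed
  moreover have "\<mu> \<in> ?A" using \<mu> by (simp add: D_def in_keys_iff)
  ultimately show ?thesis using A(2) coef[of \<mu>] by (auto simp: S_def D_def)
qed

end

lemma canonical_basis_triangular:
  assumes "is_plus_canonical_basis e l s G" "e \<noteq> 0" "l \<ge> 1"
    and "\<forall>i \<in> {1..l}. 0 < \<alpha> i \<and> \<alpha> i < 1" "\<forall>i \<in> {1..l}. \<forall>j \<in> {1..l}. i < j \<longrightarrow> \<alpha> j < \<alpha> i"
    and lam: "lam \<in> multipartitions l" and "Poly_Mapping.lookup (G lam - ket lam) \<mu> \<noteq> 0"
  shows "\<mu> \<in> multipartitions l \<and> mp_above l s \<alpha> lam \<mu> \<and> Poly_Mapping.lookup (G lam - ket lam) \<mu> \<in> (*) vq ` Zv"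
proof -
  obtain \<beta> where b: "is_bar_involution e l s \<beta>"
    and G: "\<forall>lam \<in> multipartitions l. \<beta> (G lam) = G lam \<and> G lam - ket lam \<in> scale vq ` fock_lattice l"
    using assms(1) unfolding is_plus_canonical_basis_def by blast
  interpret bar_setup e l s \<alpha> \<beta> using b assms(2-5) by unfold_locales
  show ?thesis using bar_fixed_triangular[OF lam] G lam assms(7) by blast
qed

section \<open>Inverting a unitriangular family\<close>

lemma finite_multipartitions_of_rank: "finite (multipartitions_of_rank l n)"
proof (rule finite_subset)
  let ?P = "{ys :: nat list. set ys \<subseteq> {0..n} \<and> length ys \<le> n}"
  show "multipartitions_of_rank l n \<subseteq> {xs. set xs \<subseteq> ?P \<and> length xs = l}"
  proof
    fix lam assume "lam \<in> multipartitions_of_rank l n"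
    then have lam: "lam \<in> multipartitions l" "rank lam = n" by (auto simp: multipartitions_of_rank_def)
    have "p \<in> ?P" if p: "p \<in> set lam" for p
    proof -
      obtain m where m: "m < length lam" "p = lam ! m" using p by (auto simp: in_set_conv_nth)
      have "sum_list p \<le> rank lam" unfolding rank_def by (intro member_le_sum_list) (use p in auto)
      then have "sum_list p \<le> n" using lam(2) by simp
      then have "x \<le> n" if "x \<in> set p" for x using member_le_sum_list[OF that] by linarith
      moreover have "length p \<le> n"
        using length_le_rank[OF lam(1), of "Suc m"] m lam by (auto simp: multipartitions_def)
      ultimately show ?thesis by auto
    qed
    then show "lam \<in> {xs. set xs \<subseteq> ?P \<and> length xs = l}" using lam(1) by (auto simp: multipartitions_def)
  qed
  have "finite ?P" by (rule finite_lists_length_le) simp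
  then show "finite {xs. set xs \<subseteq> ?P \<and> length xs = l}" by (rule finite_lists_length_eq)
qed

text \<open>Coefficients range over all smaller multipartitions, zeros included, so that
  combinations add termwise and can be extended to a larger index.\<close>

definition lower_span ::
  "nat \<Rightarrow> (nat \<Rightarrow> int) \<Rightarrow> (nat \<Rightarrow> rat) \<Rightarrow> (multipartition \<Rightarrow> fock) \<Rightarrow> multipartition \<Rightarrow> fock set" where
  "lower_span l s \<alpha> G lam = {\<Sum>\<mu>\<in>{\<mu> \<in> multipartitions l. mp_above l s \<alpha> lam \<mu>}. scale (vq * c \<mu>) (G \<mu>) |c. range c \<subseteq> Zv}"

lemma lower_spanI:
  assumes "f = (\<Sum>\<mu>\<in>{\<mu> \<in> multipartitions l. mp_above l s \<alpha> lam \<mu>}. scale (vq * c \<mu>) (G \<mu>))" "range c \<subseteq> Zv"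
  shows "f \<in> lower_span l s \<alpha> G lam"
  using assms unfolding lower_span_def by blast

lemma finite_below: "finite {\<mu> \<in> multipartitions l. mp_above l s \<alpha> lam \<mu>}"
  by (rule finite_subset[OF _ finite_multipartitions_of_rank[of l "rank lam"]])
    (auto simp: multipartitions_of_rank_def mp_above_def)

lemma lower_span_closed:
  assumes "f \<in> lower_span l s \<alpha> G lam"
  shows "g \<in> lower_span l s \<alpha> G lam \<Longrightarrow> f + g \<in> lower_span l s \<alpha> G lam"
    "z \<in> Zv \<Longrightarrow> scale z f \<in> lower_span l s \<alpha> G lam"
    "mp_above l s \<alpha> \<kappa> lam \<Longrightarrow> f \<in> lower_span l s \<alpha> G \<kappa>"
proof -
  let ?B = "\<lambda>lam. {\<mu> \<in> multipartitions l. mp_above l s \<alpha> lam \<mu>}"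
  obtain c where c: "f = (\<Sum>\<mu>\<in>?B lam. scale (vq * c \<mu>) (G \<mu>))" "range c \<subseteq> Zv"
    using assms unfolding lower_span_def by blast
  show "f + g \<in> lower_span l s \<alpha> G lam" if g: "g \<in> lower_span l s \<alpha> G lam"
  proof -
    obtain d where d: "g = (\<Sum>\<mu>\<in>?B lam. scale (vq * d \<mu>) (G \<mu>))" "range d \<subseteq> Zv"
      using g unfolding lower_span_def by blast
    have "f + g = (\<Sum>\<mu>\<in>?B lam. scale (vq * (c \<mu> + d \<mu>)) (G \<mu>))"
      unfolding c d by (simp add: sum.distrib fs.scale_left_distrib distrib_left)
    moreover have "range (\<lambda>\<mu>. c \<mu> + d \<mu>) \<subseteq> Zv" using c(2) d(2) by (auto simp: image_subset_iff intro: Zv_closed(3))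
    ultimately show ?thesis by (rule lower_spanI)
  qed
  show "scale z f \<in> lower_span l s \<alpha> G lam" if "z \<in> Zv"
  proof -
    have "scale z f = (\<Sum>\<mu>\<in>?B lam. scale (vq * (z * c \<mu>)) (G \<mu>))"
      unfolding c(1) fs.scale_sum_right fs.scale_scale by (simp only: mult.left_commute)
    moreover have "range (\<lambda>\<mu>. z * c \<mu>) \<subseteq> Zv" using c(2) that by (auto simp: image_subset_iff intro: Zv_closed(4))
    ultimately show ?thesis by (rule lower_spanI)
  qed
  show "f \<in> lower_span l s \<alpha> G \<kappa>" if "mp_above l s \<alpha> \<kappa> lam"
  proof -
    let ?d = "\<lambda>\<mu>. if mp_above l s \<alpha> lam \<mu> then c \<mu> else 0"
    have "f = (\<Sum>\<mu>\<in>?B \<kappa>. scale (vq * ?d \<mu>) (G \<mu>))"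
      unfolding c using mp_above_trans[OF that]
      by (intro sum.mono_neutral_cong_left finite_below) auto
    moreover have "range ?d \<subseteq> Zv" using c(2) Zv_closed(1) by auto
    ultimately show ?thesis by (rule lower_spanI)
  qed
qed

lemma lower_span_zero: "0 \<in> lower_span l s \<alpha> G lam"
proof -
  have "0 = (\<Sum>\<mu>\<in>{\<mu> \<in> multipartitions l. mp_above l s \<alpha> lam \<mu>}. scale (vq * 0) (G \<mu>))" by simp
  moreover have "range (\<lambda>\<mu> :: multipartition. 0) \<subseteq> Zv" using Zv_closed(1) by auto
  ultimately show ?thesis by (rule lower_spanI)
qed

lemma lower_span_sum:
  "(\<And>\<mu>. \<mu> \<in> A \<Longrightarrow> f \<mu> \<in> lower_span l s \<alpha> G lam) \<Longrightarrow> (\<Sum>\<mu>\<in>A. f \<mu>) \<in> lower_span l s \<alpha> G lam"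
  by (induction A rule: infinite_finite_induct) (auto simp: lower_span_zero lower_span_closed(1))

lemma lower_span_base:
  assumes "\<mu> \<in> multipartitions l" "mp_above l s \<alpha> lam \<mu>" "z \<in> (*) vq ` Zv"
  shows "scale z (G \<mu>) \<in> lower_span l s \<alpha> G lam"
proof -
  obtain y where y: "y \<in> Zv" "z = vq * y" using assms(3) by blast
  let ?c = "\<lambda>\<nu>. if \<nu> = \<mu> then y else 0"
  have "(\<Sum>\<nu>\<in>{\<nu> \<in> multipartitions l. mp_above l s \<alpha> lam \<nu>}. scale (vq * ?c \<nu>) (G \<nu>)) = scale z (G \<mu>)"
    using assms(1,2) y finite_below[of l s \<alpha> lam]
    by (subst sum.remove[of _ \<mu>]) (auto intro!: sum.neutral)
  moreover have "range ?c \<subseteq> Zv" using y Zv_closed(1) by auto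
  ultimately show ?thesis by (intro lower_spanI[where c = ?c]) auto
qed

text \<open>Substituting the expansions of smaller basis vectors keeps all coefficients in
  v\<int>[v], because this is an ideal of \<int>[v]. The local fact \<open>expand\<close> is used
  twice: inside the induction with its hypothesis, and afterwards for arbitrary f.\<close>

lemma unitriangular_inverse:
  assumes G: "\<And>lam \<mu>. lam \<in> multipartitions l \<Longrightarrow> Poly_Mapping.lookup (G lam - ket lam) \<mu> \<noteq> 0 \<Longrightarrow>
      \<mu> \<in> multipartitions l \<and> mp_above l s \<alpha> lam \<mu> \<and> Poly_Mapping.lookup (G lam - ket lam) \<mu> \<in> (*) vq ` Zv"
  shows ket_lower: "lam \<in> multipartitions l \<Longrightarrow> ket lam - G lam \<in> lower_span l s \<alpha> G lam"
    and expand_lower: "(\<And>\<mu>. Poly_Mapping.lookup f \<mu> \<noteq> 0 \<Longrightarrow> \<mu> \<in> multipartitions l \<and>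
      mp_above l s \<alpha> lam \<mu> \<and> Poly_Mapping.lookup f \<mu> \<in> (*) vq ` Zv) \<Longrightarrow> f \<in> lower_span l s \<alpha> G lam"
proof -
  have expand: "f \<in> lower_span l s \<alpha> G lam"
    if f: "\<And>\<mu>. Poly_Mapping.lookup f \<mu> \<noteq> 0 \<Longrightarrow> \<mu> \<in> multipartitions l \<and>
        mp_above l s \<alpha> lam \<mu> \<and> Poly_Mapping.lookup f \<mu> \<in> (*) vq ` Zv"
      and IH: "\<And>\<mu>. \<mu> \<in> multipartitions l \<Longrightarrow> mp_above l s \<alpha> lam \<mu> \<Longrightarrow> ket \<mu> - G \<mu> \<in> lower_span l s \<alpha> G \<mu>"
    for f lam
  proof -
    have "f = (\<Sum>\<mu>\<in>Poly_Mapping.keys f. scale (Poly_Mapping.lookup f \<mu>) (ket \<mu>))"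
      by (rule poly_mapping_expand) auto
    also have "\<dots> = (\<Sum>\<mu>\<in>Poly_Mapping.keys f. scale (Poly_Mapping.lookup f \<mu>) (G \<mu>) +
        scale (Poly_Mapping.lookup f \<mu>) (ket \<mu> - G \<mu>))"
      by (simp flip: fs.scale_right_distrib)
    also have "\<dots> \<in> lower_span l s \<alpha> G lam"
    proof (rule lower_span_sum)
      fix \<mu> assume "\<mu> \<in> Poly_Mapping.keys f"
      then have m: "\<mu> \<in> multipartitions l" "mp_above l s \<alpha> lam \<mu>" "Poly_Mapping.lookup f \<mu> \<in> (*) vq ` Zv"
        using f[of \<mu>] by (auto simp: in_keys_iff)
      have "Poly_Mapping.lookup f \<mu> \<in> Zv" using m(3) Zv_closed(4,6) by auto
      then have "scale (Poly_Mapping.lookup f \<mu>) (ket \<mu> - G \<mu>) \<in> lower_span l s \<alpha> G lam"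
        using lower_span_closed(2,3) IH[OF m(1,2)] m(2) by blast
      then show "scale (Poly_Mapping.lookup f \<mu>) (G \<mu>) + scale (Poly_Mapping.lookup f \<mu>) (ket \<mu> - G \<mu>)
          \<in> lower_span l s \<alpha> G lam"
        using lower_span_closed(1)[OF lower_span_base[OF m]] by blast
    qed
    finally show ?thesis .
  qed
  have ket: "ket lam - G lam \<in> lower_span l s \<alpha> G lam" if "lam \<in> multipartitions l" for lam
    using that
  \<comment> \<open>Only finitely many multipartitions share a rank, so the number of smaller ones
    is a legitimate induction measure.\<close>
  proof (induction "card {\<mu> \<in> multipartitions l. mp_above l s \<alpha> lam \<mu>}" arbitrary: lam rule: less_induct)
    case less
    have "ket \<mu> - G \<mu> \<in> lower_span l s \<alpha> G \<mu>" if m: "\<mu> \<in> multipartitions l" "mp_above l s \<alpha> lam \<mu>" for \<mu>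
    proof (rule less.hyps[OF _ m(1)])
      have "{\<nu> \<in> multipartitions l. mp_above l s \<alpha> \<mu> \<nu>} \<subset> {\<nu> \<in> multipartitions l. mp_above l s \<alpha> lam \<nu>}"
        using m mp_above_trans[OF m(2)] mp_above_irrefl by blast
      then show "card {\<nu> \<in> multipartitions l. mp_above l s \<alpha> \<mu> \<nu>} < card {\<nu> \<in> multipartitions l. mp_above l s \<alpha> lam \<nu>}"
        by (rule psubset_card_mono[OF finite_below])
    qed
    then have "G lam - ket lam \<in> lower_span l s \<alpha> G lam"
      using expand[OF G[OF less.prems]] by blast
    then have "scale (- 1) (G lam - ket lam) \<in> lower_span l s \<alpha> G lam"
      using lower_span_closed(2) Zv_closed(2,5) by blast
    then show ?case by simp
  qed
  then show "lam \<in> multipartitions l \<Longrightarrow> ket lam - G lam \<in> lower_span l s \<alpha> G lam" .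
  show "f \<in> lower_span l s \<alpha> G lam" if "\<And>\<mu>. Poly_Mapping.lookup f \<mu> \<noteq> 0 \<Longrightarrow> \<mu> \<in> multipartitions l \<and>
      mp_above l s \<alpha> lam \<mu> \<and> Poly_Mapping.lookup f \<mu> \<in> (*) vq ` Zv"
    using expand[OF that] ket by blast
qed

theorem theorem3p11:
  fixes l e :: nat and s :: "nat \<Rightarrow> int" and \<alpha> :: "nat \<Rightarrow> rat"
    and Ge Ginf :: "multipartition \<Rightarrow> fock"
  assumes "l \<ge> 1" and "e \<ge> 2"
    and "\<forall>i \<in> {1..l}. 0 < \<alpha> i \<and> \<alpha> i < 1"
    and "\<forall>i \<in> {1..l}. \<forall>j \<in> {1..l}. i < j \<longrightarrow> \<alpha> j < \<alpha> i"
    and "is_plus_canonical_basis (enat e) l s Ge"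
    and "is_plus_canonical_basis \<infinity> l s Ginf"
  shows "\<exists>d :: multipartition \<Rightarrow> multipartition \<Rightarrow> ratfun.
    \<forall>lam \<in> multipartitions l.
      finite {\<nu> \<in> multipartitions l. d lam \<nu> \<noteq> 0} \<and>
      Ge lam = (\<Sum>\<nu> | \<nu> \<in> multipartitions l \<and> d lam \<nu> \<noteq> 0. scale (d lam \<nu>) (Ginf \<nu>)) \<and>
      d lam lam = 1 \<and>
      (\<forall>\<nu> \<in> multipartitions l. lam \<noteq> \<nu> \<longrightarrow> d lam \<nu> \<in> (*) vq ` Zv) \<and>
      (\<forall>\<nu> \<in> multipartitions l. d lam \<nu> \<noteq> 0 \<longrightarrow> lam = \<nu> \<or> mp_greater l s \<alpha> lam \<nu>)"
proof -
  let ?B = "\<lambda>lam. {\<mu> \<in> multipartitions l. mp_above l s \<alpha> lam \<mu>}"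
  have e0: "enat e \<noteq> 0" "(\<infinity> :: enat) \<noteq> 0" using assms(2) by (auto simp: zero_enat_def)
  note tri_e = canonical_basis_triangular[OF assms(5) e0(1) assms(1,3,4)]
  note tri_inf = canonical_basis_triangular[OF assms(6) e0(2) assms(1,3,4)]
  have "\<exists>c. Ge lam - Ginf lam = (\<Sum>\<mu>\<in>?B lam. scale (vq * c \<mu>) (Ginf \<mu>)) \<and> range c \<subseteq> Zv"
    (is "\<exists>c. ?P lam c") if lam: "lam \<in> multipartitions l" for lam
  proof -
    have "ket lam - Ginf lam \<in> lower_span l s \<alpha> Ginf lam"
      by (rule ket_lower[where G = Ginf, OF _ lam]) (rule tri_inf)
    moreover have "Ge lam - ket lam \<in> lower_span l s \<alpha> Ginf lam"
      by (rule expand_lower[where G = Ginf]) (rule tri_inf, assumption+, rule tri_e[OF lam])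
    ultimately have "(ket lam - Ginf lam) + (Ge lam - ket lam) \<in> lower_span l s \<alpha> Ginf lam"
      by (rule lower_span_closed(1))
    then have "Ge lam - Ginf lam \<in> lower_span l s \<alpha> Ginf lam" by simp
    then show ?thesis unfolding lower_span_def by blast
  qed
  then have "\<forall>lam\<in>multipartitions l. \<exists>c. ?P lam c" by blast
  from bchoice[OF this] obtain c where c: "\<forall>lam\<in>multipartitions l. ?P lam (c lam)" ..
  \<comment> \<open>The coefficients c are constrained by the sum only at smaller multipartitions;
    elsewhere d is set to 0, and to 1 on the diagonal.\<close>
  define d where "d lam \<nu> = (if \<nu> = lam then 1 else if mp_above l s \<alpha> lam \<nu> then vq * c lam \<nu> else 0)"
    for lam \<nu>
  have "finite {\<nu> \<in> multipartitions l. d lam \<nu> \<noteq> 0} \<and>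
      Ge lam = (\<Sum>\<nu> | \<nu> \<in> multipartitions l \<and> d lam \<nu> \<noteq> 0. scale (d lam \<nu>) (Ginf \<nu>)) \<and>
      d lam lam = 1 \<and>
      (\<forall>\<nu> \<in> multipartitions l. lam \<noteq> \<nu> \<longrightarrow> d lam \<nu> \<in> (*) vq ` Zv) \<and>
      (\<forall>\<nu> \<in> multipartitions l. d lam \<nu> \<noteq> 0 \<longrightarrow> lam = \<nu> \<or> mp_greater l s \<alpha> lam \<nu>)"
    if lam: "lam \<in> multipartitions l" for lam
  proof (intro conjI ballI impI)
    have fin: "finite (insert lam (?B lam))" using finite_below by simp
    have sub: "{\<nu> \<in> multipartitions l. d lam \<nu> \<noteq> 0} \<subseteq> insert lam (?B lam)" by (auto simp: d_def)
    show "finite {\<nu> \<in> multipartitions l. d lam \<nu> \<noteq> 0}" using sub fin by (rule finite_subset)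
    have irr: "lam \<notin> ?B lam" using mp_above_irrefl by blast
    have "(\<Sum>\<nu> | \<nu> \<in> multipartitions l \<and> d lam \<nu> \<noteq> 0. scale (d lam \<nu>) (Ginf \<nu>)) =
        (\<Sum>\<nu>\<in>insert lam (?B lam). scale (d lam \<nu>) (Ginf \<nu>))"
      using lam by (intro sum.mono_neutral_left fin sub) auto
    also have "\<dots> = scale (d lam lam) (Ginf lam) + (\<Sum>\<nu>\<in>?B lam. scale (d lam \<nu>) (Ginf \<nu>))"
      using irr finite_below by (intro sum.insert) auto
    also have "(\<Sum>\<nu>\<in>?B lam. scale (d lam \<nu>) (Ginf \<nu>)) = (\<Sum>\<nu>\<in>?B lam. scale (vq * c lam \<nu>) (Ginf \<nu>))"
      using irr by (intro sum.cong) (auto simp: d_def)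
    also have "\<dots> = Ge lam - Ginf lam" using bspec[OF c lam] by simp
    finally show "Ge lam = (\<Sum>\<nu> | \<nu> \<in> multipartitions l \<and> d lam \<nu> \<noteq> 0. scale (d lam \<nu>) (Ginf \<nu>))"
      by (simp add: d_def)
    show "d lam lam = 1" by (simp add: d_def)
    show "d lam \<nu> \<in> (*) vq ` Zv" if "lam \<noteq> \<nu>" for \<nu>
      using that bspec[OF c lam] Zv_closed(1) by (auto simp: d_def image_iff)
    show "lam = \<nu> \<or> mp_greater l s \<alpha> lam \<nu>" if "d lam \<nu> \<noteq> 0" for \<nu>
      using that mp_above_imp_greater by (auto simp: d_def split: if_splits)
  qed
  then show ?thesis by (intro exI[of _ d]) blast
qed

end
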